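(* Let $G\in C(Q)$ be such that $m=0$ in the factorization $\det G=\gamma_-(\lambda_-/\lambda_+)^m\gamma_+$, and suppose that its $\Sigma$-symbol $g$ admits a factorization $g=g_-r_0g_+$ with $g_\pm\in\mathcal GC_\mu^\pm(\Gamma)$ and $r_0=\frac{\tau}{(\xi+i)(\xi-ik_0)}$. Then the space of solutions $(\psi_+,\psi_-)$ of $$g\psi_+=\frac{\tau}{\mathfrak p_1}\psi_-,\qquad \psi_+\in C_\mu^+(\Gamma),\ \psi_-\in C_{\mu0}^-(\Gamma),$$ is generated by $$\left(\frac{\xi+i}{\xi+ik_0}\,g_+^{-1},\ \frac{\xi+i}{\xi-ik_0}\,g_-\right),$$ and the space of solutions $(\phi_+,\phi_-)$ of $$G\phi_+=\phi_-,\qquad \phi_+\in(C_\mu^+(\dot{\mathbb R}))^2,\ \phi_-\in(C_{\mu0}^-(\dot{\mathbb R}))^2,$$ is generated by $(\Phi_+,\Phi_-)$ with $$\Phi_+=\left(\frac{\xi+i}{\xi+ik_0}(g_+^{-1})_{\mathcal E},\ (\xi+i)^2(g_+^{-1})_{\mathcal O}\right),\qquad \Phi_-=\left((\xi^2+1)(g_-)_{\mathcal O},\ \frac{\xi+i}{\xi-ik_0}(g_-)_{\mathcal E}\right).$$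
   Context: Fix $k_0>1$, $\mu\in(0,1)$. $\Sigma$ is the compact Riemann surface of genus $1$ obtained from the curve $\tau^2=\mathfrak p(\xi)=(1+\xi^2)(k_0^2+\xi^2)$ in $\mathbb C^2$ by adding two points at infinity; $\Pi(\xi,\tau)=\xi$; functions of $\xi$ are regarded as functions on $\Sigma$ via $\Pi$, and functions $f$ on $\Gamma$ with $f=f_*$ as functions of $\xi$, where $f_*(\xi,\tau)=f(\xi,-\tau)$. $\dot{\mathbb R}=\mathbb R\cup\{\infty\}$, $\Sigma^\pm=\Pi^{-1}(\mathbb C^\pm)$, $\Gamma=\Pi^{-1}(\dot{\mathbb R})$, the disjoint union of two closed curves $\Gamma_1$ ($\tau>0$ over $\mathbb R$) and $\Gamma_2$ ($\tau<0$ over $\mathbb R$). $f_{\mathcal E}=\frac12(f+f_* )$, $f_{\mathcal O}=\frac1{2\tau}(f-f_* )$. $C_\mu(\dot{\mathbb R})$: continuous functions on $\dot{\mathbb R}$ satisfying a Hölder condition of exponent $\mu$ (Hölder after transplanting to the unit circle by $\xi\mapsto(\xi-i)/(\xi+i)$); $C_\mu^\pm(\dot{\mathbb R})=C_\mu(\dot{\mathbb R})\cap H^\infty(\mathbb C^\pm)$. $C_\mu(\Gamma)$: functions on $\Gamma$ whose restrictions to $\Gamma_1,\Gamma_2$, viewed via $\Pi$ on $\dot{\mathbb R}$, are in $C_\mu(\dot{\mathbb R})$. $C_\mu^\pm(\Gamma)$: elements of $C_\mu(\Gamma)$ extending continuously to $\Sigma^\pm\cup\Gamma$ and analytically to $\Sigma^\pm$.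 $\lambda_\pm(\xi)=\xi\pm i$; $C_{\mu0}^-(\dot{\mathbb R})=\frac{\lambda_+}{\lambda_-}C_\mu^-(\dot{\mathbb R})$, $C_{\mu0}^-(\Gamma)=\frac{\lambda_+}{\lambda_-}C_\mu^-(\Gamma)$. $\mathcal G\mathcal A$: invertible elements of $\mathcal A$. $\mathfrak p_1(\xi)=(\xi+i)(\xi+ik_0)$, $\mathfrak p_2(\xi)=(\xi-i)(\xi-ik_0)$, $q=\mathfrak p_1/\mathfrak p_2$, $Q=\begin{bmatrix}-q&0\\ 0&1\end{bmatrix}$. $C(Q)$ is the set of $G\in\mathcal G(C_\mu(\dot{\mathbb R}))^{2\times2}$ with $G^TQG=\det G\cdot Q$; such $G$ have the form $G=\begin{bmatrix}\alpha&\delta\\ q\delta&\alpha\end{bmatrix}$ with $\alpha,\delta\in C_\mu(\dot{\mathbb R})$. The $\Sigma$-symbol of $G$ is $g=\alpha+\frac{\tau}{\mathfrak p_2}\delta\in\mathcal GC_\mu(\Gamma)$. $\det G=\gamma_-(\lambda_-/\lambda_+)^m\gamma_+$ with $\gamma_\pm\in\mathcal GC_\mu^\pm(\dot{\mathbb R})$, $m\in\mathbb Z$. "Generated by" means equal to the complex linear span. *)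

theory Defs
  imports "HOL-Analysis.Analysis"
begin

section \<open>The Riemann surface\<close>

definition frakp :: "real \<Rightarrow> complex \<Rightarrow> complex" where
  "frakp k0 \<xi> = (1 + \<xi>^2) * (of_real k0 ^ 2 + \<xi>^2)"

definition frakp1 :: "real \<Rightarrow> complex \<Rightarrow> complex" where
  "frakp1 k0 \<xi> = (\<xi> + \<i>) * (\<xi> + \<i> * of_real k0)"

definition frakp2 :: "real \<Rightarrow> complex \<Rightarrow> complex" where
  "frakp2 k0 \<xi> = (\<xi> - \<i>) * (\<xi> - \<i> * of_real k0)"

text \<open>
  \<open>Aff \<xi> \<tau>\<close> is the point \<open>(\<xi>, \<tau>)\<close> of the affine curve.  \<open>Inf s\<close> with \<open>s = 1\<close> or \<open>s = -1\<close>
  is the point at infinity at which \<open>\<tau> / \<xi>^2\<close> tends to \<open>s\<close>.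
\<close>
datatype sigma_pt = Aff complex complex | Inf complex

definition Sigma_surf :: "real \<Rightarrow> sigma_pt set" where
  "Sigma_surf k0 = {Aff \<xi> \<tau> | \<xi> \<tau>. \<tau>^2 = frakp k0 \<xi>} \<union> {Inf s | s. s^2 = 1}"

text \<open>
  The surface is glued from the curves \<open>\<tau>^2 = frakp k0 \<xi>\<close> and
  \<open>v^2 = (1 + u^2) (1 + k0^2 u^2)\<close> by \<open>u = 1 / \<xi>\<close>, \<open>v = \<tau> / \<xi>^2\<close>.
\<close>
definition inf_chart :: "complex \<Rightarrow> complex \<Rightarrow> sigma_pt" where
  "inf_chart u v = (if u = 0 then Inf v else Aff (1 / u) (v / u^2))"

definition Sigma_open :: "real \<Rightarrow> sigma_pt set \<Rightarrow> bool" where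
  "Sigma_open k0 U \<longleftrightarrow> U \<subseteq> Sigma_surf k0 \<and>
     openin (top_of_set {(\<xi>, \<tau>). \<tau>^2 = frakp k0 \<xi>}) {(\<xi>, \<tau>). Aff \<xi> \<tau> \<in> U} \<and>
     openin (top_of_set {(u, v). v^2 = (1 + u^2) * (1 + of_real k0 ^ 2 * u^2)})
       {(u, v). inf_chart u v \<in> U}"

definition Sigma_top :: "real \<Rightarrow> sigma_pt topology" where
  "Sigma_top k0 = topology (Sigma_open k0)"

lemma istopology_Sigma_open: "istopology (Sigma_open k0)"
  unfolding istopology_def
proof (intro conjI allI impI)
  fix S T assume S: "Sigma_open k0 S" and T: "Sigma_open k0 T"
  have 1: "{(\<xi>, \<tau>). Aff \<xi> \<tau> \<in> S \<inter> T} = {(\<xi>, \<tau>). Aff \<xi> \<tau> \<in> S} \<inter> {(\<xi>, \<tau>). Aff \<xi> \<tau> \<in> T}"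
    and 2: "{(u, v). inf_chart u v \<in> S \<inter> T} = {(u, v). inf_chart u v \<in> S} \<inter> {(u, v). inf_chart u v \<in> T}"
    by auto
  show "Sigma_open k0 (S \<inter> T)"
    using S T unfolding Sigma_open_def 1 2 by (auto intro: openin_Int)
next
  fix K assume K: "\<forall>S\<in>K. Sigma_open k0 S"
  have 1: "{(\<xi>, \<tau>). Aff \<xi> \<tau> \<in> \<Union>K} = (\<Union>S\<in>K. {(\<xi>, \<tau>). Aff \<xi> \<tau> \<in> S})"
    and 2: "{(u, v). inf_chart u v \<in> \<Union>K} = (\<Union>S\<in>K. {(u, v). inf_chart u v \<in> S})"
    by auto
  show "Sigma_open k0 (\<Union>K)"
    using K unfolding Sigma_open_def 1 2 by (auto intro!: openin_Union)
qed

lemma openin_Sigma_top: "openin (Sigma_top k0) U \<longleftrightarrow> Sigma_open k0 U"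
  unfolding Sigma_top_def using istopology_Sigma_open by (simp add: topology_inverse')

text \<open>
  \<open>local_coord P\<close> is a local coordinate of the surface at \<open>P\<close>, meaningful near \<open>P\<close> only: \<open>\<tau>\<close> at a
  branch point (a point with \<open>\<tau> = 0\<close>), \<open>\<xi>\<close> at the other finite points, \<open>1 / \<xi>\<close> at infinity.
\<close>
fun local_coord :: "sigma_pt \<Rightarrow> sigma_pt \<Rightarrow> complex" where
  "local_coord (Aff \<xi>0 \<tau>0) (Aff \<xi> \<tau>) = (if \<tau>0 = 0 then \<tau> else \<xi>)"
| "local_coord (Aff \<xi>0 \<tau>0) (Inf s) = undefined"
| "local_coord (Inf s0) (Aff \<xi> \<tau>) = 1 / \<xi>"
| "local_coord (Inf s0) (Inf s) = 0"

definition Sigma_analytic_on :: "real \<Rightarrow> sigma_pt set \<Rightarrow> (sigma_pt \<Rightarrow> complex) \<Rightarrow> bool" where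
  "Sigma_analytic_on k0 W F \<longleftrightarrow>
     (\<forall>P\<in>W. \<exists>U h. openin (Sigma_top k0) U \<and> P \<in> U \<and> U \<subseteq> W \<and>
        h analytic_on {local_coord P P} \<and> (\<forall>R\<in>U. F R = h (local_coord P R)))"

definition upper_half :: "complex set" where
  "upper_half = {z. Im z > 0}"

definition lower_half :: "complex set" where
  "lower_half = {z. Im z < 0}"

text \<open>The preimage in the surface of a set \<open>H\<close> of finite points.\<close>
definition Sigma_over :: "real \<Rightarrow> complex set \<Rightarrow> sigma_pt set" where
  "Sigma_over k0 H = {Aff \<xi> \<tau> | \<xi> \<tau>. \<xi> \<in> H \<and> \<tau>^2 = frakp k0 \<xi>}"

definition Gamma_closed :: "real \<Rightarrow> sigma_pt set" where
  "Gamma_closed k0 = Sigma_over k0 \<real> \<union> {Inf s | s. s^2 = 1}"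

section \<open>Function spaces on the extended real line\<close>

text \<open>
  The functions on the extended real line and on its preimage in the surface that occur in the
  spaces \<open>C_mu\<close> and \<open>CG_mu\<close> below are continuous.  They are represented by their restrictions to the dense set of finite points: a
  function on the extended line is a function \<open>complex \<Rightarrow> complex\<close> of which only the values on
  \<open>\<real>\<close> matter, and a function on the preimage is a function \<open>complex \<times> complex \<Rightarrow> complex\<close> of which
  only the values on \<open>Gamma_fin\<close> matter.  The values at infinity are the limits, whose existence
  is part of the definitions of the function spaces.
\<close>

definition units_on :: "'x set \<Rightarrow> ('x \<Rightarrow> complex) set \<Rightarrow> ('x \<Rightarrow> complex) set" where
  "units_on D A = {f \<in> A. \<exists>h\<in>A. \<forall>x\<in>D. f x * h x = 1}"

definition cayley :: "complex \<Rightarrow> complex" where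
  "cayley \<xi> = (\<xi> - \<i>) / (\<xi> + \<i>)"

text \<open>
  The transplant of \<open>f\<close> satisfies a Hoelder condition on the unit circle without the point \<open>1\<close>;
  equivalently, it extends (continuously and uniquely) to a function with the same Hoelder
  condition on the whole unit circle, so that \<open>f\<close> extends to the extended real line.
\<close>
definition C_mu :: "real \<Rightarrow> (complex \<Rightarrow> complex) set" where
  "C_mu \<mu> = {f. \<exists>C. \<forall>\<xi>\<in>\<real>. \<forall>\<eta>\<in>\<real>. cmod (f \<xi> - f \<eta>) \<le> C * cmod (cayley \<xi> - cayley \<eta>) powr \<mu>}"

text \<open>
  The boundary functions of the bounded holomorphic functions on a half-plane \<open>H\<close>: the boundary
  values are the limits along vertical lines, almost everywhere.
\<close>
definition H_infty :: "complex set \<Rightarrow> (complex \<Rightarrow> complex) set" where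
  "H_infty H = {f. \<exists>F. F holomorphic_on H \<and> bounded (F ` H) \<and>
     (AE x in lborel. (F \<longlongrightarrow> f (of_real x)) (at (of_real x) within {z\<in>H. Re z = x}))}"

definition C_mu_plus :: "real \<Rightarrow> (complex \<Rightarrow> complex) set" where
  "C_mu_plus \<mu> = C_mu \<mu> \<inter> H_infty upper_half"

definition C_mu_minus :: "real \<Rightarrow> (complex \<Rightarrow> complex) set" where
  "C_mu_minus \<mu> = C_mu \<mu> \<inter> H_infty lower_half"

definition C_mu0_minus :: "real \<Rightarrow> (complex \<Rightarrow> complex) set" where
  "C_mu0_minus \<mu> = {f. \<exists>h\<in>C_mu_minus \<mu>. \<forall>\<xi>\<in>\<real>. f \<xi> = (\<xi> + \<i>) / (\<xi> - \<i>) * h \<xi>}"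

section \<open>Function spaces on the preimage of the extended real line\<close>

definition Gamma_fin :: "real \<Rightarrow> (complex \<times> complex) set" where
  "Gamma_fin k0 = {(\<xi>, \<tau>). \<xi> \<in> \<real> \<and> \<tau>^2 = frakp k0 \<xi>}"

text \<open>
  For real \<open>\<xi>\<close> the number \<open>frakp k0 \<xi>\<close> is positive, so \<open>tau1 k0 \<xi>\<close> is the positive root: the
  points \<open>(\<xi>, tau1 k0 \<xi>)\<close> and \<open>(\<xi>, - tau1 k0 \<xi>)\<close> run through the two components.
\<close>
definition tau1 :: "real \<Rightarrow> complex \<Rightarrow> complex" where
  "tau1 k0 \<xi> = csqrt (frakp k0 \<xi>)"

definition CG_mu :: "real \<Rightarrow> real \<Rightarrow> (complex \<times> complex \<Rightarrow> complex) set" where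
  "CG_mu k0 \<mu> = {f. (\<lambda>\<xi>. f (\<xi>, tau1 k0 \<xi>)) \<in> C_mu \<mu> \<and> (\<lambda>\<xi>. f (\<xi>, - tau1 k0 \<xi>)) \<in> C_mu \<mu>}"

definition CG_mu_half :: "real \<Rightarrow> real \<Rightarrow> complex set \<Rightarrow> (complex \<times> complex \<Rightarrow> complex) set" where
  "CG_mu_half k0 \<mu> H = {f \<in> CG_mu k0 \<mu>. \<exists>F.
     continuous_map (subtopology (Sigma_top k0) (Sigma_over k0 H \<union> Gamma_closed k0)) euclidean F \<and>
     Sigma_analytic_on k0 (Sigma_over k0 H) F \<and>
     (\<forall>(\<xi>, \<tau>)\<in>Gamma_fin k0. F (Aff \<xi> \<tau>) = f (\<xi>, \<tau>))}"

definition CG_mu_plus :: "real \<Rightarrow> real \<Rightarrow> (complex \<times> complex \<Rightarrow> complex) set" where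
  "CG_mu_plus k0 \<mu> = CG_mu_half k0 \<mu> upper_half"

definition CG_mu_minus :: "real \<Rightarrow> real \<Rightarrow> (complex \<times> complex \<Rightarrow> complex) set" where
  "CG_mu_minus k0 \<mu> = CG_mu_half k0 \<mu> lower_half"

definition CG_mu0_minus :: "real \<Rightarrow> real \<Rightarrow> (complex \<times> complex \<Rightarrow> complex) set" where
  "CG_mu0_minus k0 \<mu> =
     {f. \<exists>h\<in>CG_mu_minus k0 \<mu>. \<forall>(\<xi>, \<tau>)\<in>Gamma_fin k0. f (\<xi>, \<tau>) = (\<xi> + \<i>) / (\<xi> - \<i>) * h (\<xi>, \<tau>)}"

text \<open>
  The functions \<open>(f + f\<^sub>*) / 2\<close> and \<open>(f - f\<^sub>*) / (2 \<tau>)\<close>, where \<open>f\<^sub>*(\<xi>, \<tau>) = f(\<xi>, -\<tau>)\<close>, take the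
  same value at the two points over \<open>\<xi>\<close>; they are regarded as functions of \<open>\<xi>\<close>.
\<close>
definition even_part :: "real \<Rightarrow> (complex \<times> complex \<Rightarrow> complex) \<Rightarrow> complex \<Rightarrow> complex" where
  "even_part k0 f \<xi> = (let \<tau> = tau1 k0 \<xi> in (f (\<xi>, \<tau>) + f (\<xi>, - \<tau>)) / 2)"

definition odd_part :: "real \<Rightarrow> (complex \<times> complex \<Rightarrow> complex) \<Rightarrow> complex \<Rightarrow> complex" where
  "odd_part k0 f \<xi> = (let \<tau> = tau1 k0 \<xi> in (f (\<xi>, \<tau>) - f (\<xi>, - \<tau>)) / (2 * \<tau>))"

section \<open>The matrix class\<close>

definition Q_mat :: "real \<Rightarrow> complex \<Rightarrow> complex^2^2" where
  "Q_mat k0 \<xi> = vector [vector [- (frakp1 k0 \<xi> / frakp2 k0 \<xi>), 0], vector [0, 1]]"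

definition C_mu_mat :: "real \<Rightarrow> (complex \<Rightarrow> complex^2^2) set" where
  "C_mu_mat \<mu> = {G. \<forall>i j. (\<lambda>\<xi>. G \<xi> $ i $ j) \<in> C_mu \<mu>}"

definition C_Q :: "real \<Rightarrow> real \<Rightarrow> (complex \<Rightarrow> complex^2^2) set" where
  "C_Q k0 \<mu> = {G \<in> C_mu_mat \<mu>.
     (\<exists>H\<in>C_mu_mat \<mu>. \<forall>\<xi>\<in>\<real>. G \<xi> ** H \<xi> = mat 1 \<and> H \<xi> ** G \<xi> = mat 1) \<and>
     (\<forall>\<xi>\<in>\<real>. transpose (G \<xi>) ** Q_mat k0 \<xi> ** G \<xi> = mat (det (G \<xi>)) ** Q_mat k0 \<xi>)}"

text \<open>
  Every \<open>G\<close> in \<open>C_Q k0 \<mu>\<close> has the rows \<open>(\<alpha>, \<delta>)\<close> and \<open>(q \<delta>, \<alpha>)\<close> with \<open>q = frakp1 k0 / frakp2 k0\<close>;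
  its symbol is \<open>\<alpha> + \<tau> \<delta> / frakp2 k0\<close>.
\<close>
definition Sigma_symbol :: "real \<Rightarrow> (complex \<Rightarrow> complex^2^2) \<Rightarrow> complex \<times> complex \<Rightarrow> complex" where
  "Sigma_symbol k0 G = (\<lambda>(\<xi>, \<tau>). G \<xi> $ 1 $ 1 + \<tau> / frakp2 k0 \<xi> * G \<xi> $ 1 $ 2)"

end

theory Submission
  imports Defs "HOL-Complex_Analysis.Meromorphic"
begin

text \<open>
  Let \<open>(\<psi>\<^sub>+, \<psi>\<^sub>-)\<close> solve the scalar problem, with \<open>\<psi>\<^sub>- = (\<xi> + \<i>) / (\<xi> - \<i>) * h\<close>.  After inserting
  \<open>g = g\<^sub>- r\<^sub>0 g\<^sub>+\<close> and cancelling \<open>\<tau>\<close>, the equation says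

    \<open>(\<xi> + \<i> k0) / (\<xi> + \<i>) * g\<^sub>+ \<psi>\<^sub>+ = (\<xi> - \<i> k0) / (\<xi> - \<i>) * g\<^sub>-\<^sup>-\<^sup>1 h\<close>

  on the preimage of the line.  The left side extends analytically over the upper half of the surface
  and the right side over the lower half, so together they form a function without singularities on a
  compact surface, a constant \<open>c\<close>.  Solving for \<open>\<psi>\<^sub>+\<close> and \<open>\<psi>\<^sub>-\<close> gives \<open>c\<close> times the stated generator
  (\<open>symbol_equation_solution\<close>).

  This Liouville theorem (\<open>Liouville_curve\<close>) is reduced to the plane.  A function on the curve is
  \<open>E + \<tau> O\<close> with an even part \<open>E\<close> and an odd part \<open>O\<close> that depend on \<open>\<xi>\<close> only; both are analytic on
  either half-plane, \<open>E\<close> is bounded, and \<open>O\<close> is bounded even after multiplication by a quadratic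
  polynomial, because \<open>\<tau>\<close> grows like \<open>\<xi>\<^sup>2\<close>.  Two bounded holomorphic functions on the two half-planes
  with the same boundary values are the same constant (\<open>Liouville_across_line\<close>); so \<open>E\<close> and \<open>O\<close> are
  constant, and \<open>O = 0\<close>.

  The vector problem is the scalar one in other coordinates: since \<open>\<tau>\<^sup>2 = p\<^sub>1 p\<^sub>2\<close>, the matrix \<open>G\<close> acts on
  \<open>(a, b)\<close> as multiplication by its symbol acts on \<open>a + \<tau> b / p\<^sub>1\<close>
  (\<open>vector_equation_iff_symbol\<close>), where \<open>p\<^sub>1\<close> and \<open>p\<^sub>2\<close> are \<open>frakp1 k0\<close> and \<open>frakp2 k0\<close>.  The
  components \<open>a, b\<close> are boundary functions of bounded holomorphic functions, a condition weaker in form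
  than a continuous extension to the closed half of the surface.  The class \<open>CG_Hinf\<close> contains the
  functions of both kinds, so one Liouville theorem serves both problems.

  Conversely, the parts of the generators must lie in the spaces on the line.  For a function that is
  continuous on the closed half of the surface and analytic inside, the even and odd part extend over
  the branch points by removability of singularities, and they are bounded because the curve is compact
  (\<open>parts_H_infty\<close>).
\<close>

(* From here on the dollar sign selects components of vectors, not coefficients of power series. *)
no_notation fps_nth (infixl \<open>$\<close> 75)

section \<open>The Hoelder algebra on the line\<close>

lemma C_mu_cong: "(\<And>\<xi>. \<xi> \<in> \<real> \<Longrightarrow> f \<xi> = g \<xi>) \<Longrightarrow> f \<in> C_mu \<mu> \<longleftrightarrow> g \<in> C_mu \<mu>"
  by (simp add: C_mu_def)

lemma C_muE:
  assumes "f \<in> C_mu \<mu>"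
  obtains C where "0 \<le> C"
    "\<And>\<xi> \<eta>. \<xi> \<in> \<real> \<Longrightarrow> \<eta> \<in> \<real> \<Longrightarrow> cmod (f \<xi> - f \<eta>) \<le> C * cmod (cayley \<xi> - cayley \<eta>) powr \<mu>"
proof -
  obtain C where C: "\<forall>\<xi>\<in>\<real>. \<forall>\<eta>\<in>\<real>. cmod (f \<xi> - f \<eta>) \<le> C * cmod (cayley \<xi> - cayley \<eta>) powr \<mu>"
    using assms by (auto simp: C_mu_def)
  have "C * x powr \<mu> \<le> max C 0 * x powr \<mu>" for x
    by (intro mult_right_mono) auto
  then show thesis
    using that[of "max C 0"] C by (meson max.cobounded2 order_trans)
qed

lemma C_muI:
  assumes "\<And>\<xi> \<eta>. \<xi> \<in> \<real> \<Longrightarrow> \<eta> \<in> \<real> \<Longrightarrow> cmod (f \<xi> - f \<eta>) \<le> C * cmod (cayley \<xi> - cayley \<eta>) powr \<mu>"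
  shows "f \<in> C_mu \<mu>"
  using assms by (auto simp: C_mu_def)

lemma cmod_cayley: "\<xi> \<in> \<real> \<Longrightarrow> cmod (cayley \<xi>) = 1"
proof -
  assume "\<xi> \<in> \<real>"
  then obtain x where x: "\<xi> = of_real x" by (auto elim: Reals_cases)
  have "cmod (\<xi> - \<i>) = cmod (\<xi> + \<i>)" by (simp add: x cmod_def)
  moreover have "\<xi> + \<i> \<noteq> 0" by (simp add: x complex_eq_iff)
  ultimately show ?thesis by (simp add: cayley_def norm_divide)
qed

lemma cmod_cayley_diff_le: "\<xi> \<in> \<real> \<Longrightarrow> \<eta> \<in> \<real> \<Longrightarrow> cmod (cayley \<xi> - cayley \<eta>) \<le> 2"
  using norm_triangle_ineq4[of "cayley \<xi>" "cayley \<eta>"] by (simp add: cmod_cayley)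

text \<open>
  The circle has diameter \<open>2\<close>, so a Hoelder function differs by a bounded amount from its value at \<open>0\<close>.
\<close>
lemma C_mu_bounded:
  assumes "f \<in> C_mu \<mu>" "0 < \<mu>"
  obtains B where "0 \<le> B" "\<And>\<xi>. \<xi> \<in> \<real> \<Longrightarrow> cmod (f \<xi>) \<le> B"
proof -
  obtain C where C: "0 \<le> C"
    "\<And>\<xi> \<eta>. \<xi> \<in> \<real> \<Longrightarrow> \<eta> \<in> \<real> \<Longrightarrow> cmod (f \<xi> - f \<eta>) \<le> C * cmod (cayley \<xi> - cayley \<eta>) powr \<mu>"
    using C_muE[OF assms(1)] by blast
  have "cmod (f \<xi>) \<le> C * 2 powr \<mu> + cmod (f 0)" if "\<xi> \<in> \<real>" for \<xi>
  proof -
    have "cmod (f \<xi> - f 0) \<le> C * cmod (cayley \<xi> - cayley 0) powr \<mu>" using C that by simp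
    also have "\<dots> \<le> C * 2 powr \<mu>"
      using C(1) assms(2) cmod_cayley_diff_le[OF that, of 0] by (intro mult_left_mono powr_mono2) auto
    finally show ?thesis using norm_triangle_ineq[of "f \<xi> - f 0" "f 0"] by simp
  qed
  then show thesis using that[of "C * 2 powr \<mu> + cmod (f 0)"] C(1) by simp
qed

lemma C_mu_const: "(\<lambda>_. c) \<in> C_mu \<mu>"
  by (rule C_muI[of _ 0]) simp

lemma C_mu_add:
  assumes "f \<in> C_mu \<mu>" "g \<in> C_mu \<mu>"
  shows "(\<lambda>\<xi>. f \<xi> + g \<xi>) \<in> C_mu \<mu>"
proof -
  obtain C where C:
    "\<And>\<xi> \<eta>. \<xi> \<in> \<real> \<Longrightarrow> \<eta> \<in> \<real> \<Longrightarrow> cmod (f \<xi> - f \<eta>) \<le> C * cmod (cayley \<xi> - cayley \<eta>) powr \<mu>"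
    using C_muE[OF assms(1)] by metis
  obtain D where D:
    "\<And>\<xi> \<eta>. \<xi> \<in> \<real> \<Longrightarrow> \<eta> \<in> \<real> \<Longrightarrow> cmod (g \<xi> - g \<eta>) \<le> D * cmod (cayley \<xi> - cayley \<eta>) powr \<mu>"
    using C_muE[OF assms(2)] by metis
  show ?thesis
  proof (rule C_muI[of _ "C + D"])
    fix \<xi> \<eta> :: complex assume "\<xi> \<in> \<real>" "\<eta> \<in> \<real>"
    then show "cmod (f \<xi> + g \<xi> - (f \<eta> + g \<eta>)) \<le> (C + D) * cmod (cayley \<xi> - cayley \<eta>) powr \<mu>"
      using C[of \<xi> \<eta>] D[of \<xi> \<eta>] norm_triangle_ineq[of "f \<xi> - f \<eta>" "g \<xi> - g \<eta>"]
      by (simp add: algebra_simps)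
  qed
qed

lemma C_mu_mult:
  assumes f: "f \<in> C_mu \<mu>" and g: "g \<in> C_mu \<mu>" and "0 < \<mu>"
  shows "(\<lambda>\<xi>. f \<xi> * g \<xi>) \<in> C_mu \<mu>"
proof -
  obtain C where C: "0 \<le> C"
    "\<And>\<xi> \<eta>. \<xi> \<in> \<real> \<Longrightarrow> \<eta> \<in> \<real> \<Longrightarrow> cmod (f \<xi> - f \<eta>) \<le> C * cmod (cayley \<xi> - cayley \<eta>) powr \<mu>"
    using C_muE[OF f] by metis
  obtain D where D: "0 \<le> D"
    "\<And>\<xi> \<eta>. \<xi> \<in> \<real> \<Longrightarrow> \<eta> \<in> \<real> \<Longrightarrow> cmod (g \<xi> - g \<eta>) \<le> D * cmod (cayley \<xi> - cayley \<eta>) powr \<mu>"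
    using C_muE[OF g] by metis
  obtain A where A: "0 \<le> A" "\<And>\<xi>. \<xi> \<in> \<real> \<Longrightarrow> cmod (f \<xi>) \<le> A" using C_mu_bounded[OF f \<open>0 < \<mu>\<close>] by blast
  obtain B where B: "0 \<le> B" "\<And>\<xi>. \<xi> \<in> \<real> \<Longrightarrow> cmod (g \<xi>) \<le> B" using C_mu_bounded[OF g \<open>0 < \<mu>\<close>] by blast
  show ?thesis
  proof (rule C_muI[of _ "A * D + C * B"])
    fix \<xi> \<eta> :: complex assume R: "\<xi> \<in> \<real>" "\<eta> \<in> \<real>"
    define t where "t = cmod (cayley \<xi> - cayley \<eta>) powr \<mu>"
    have "f \<xi> * g \<xi> - f \<eta> * g \<eta> = f \<xi> * (g \<xi> - g \<eta>) + (f \<xi> - f \<eta>) * g \<eta>"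
      by (simp add: algebra_simps)
    then have "cmod (f \<xi> * g \<xi> - f \<eta> * g \<eta>) \<le> cmod (f \<xi>) * cmod (g \<xi> - g \<eta>) + cmod (f \<xi> - f \<eta>) * cmod (g \<eta>)"
      by (metis norm_mult norm_triangle_ineq)
    also have "\<dots> \<le> A * (D * t) + (C * t) * B"
      using A B C D R unfolding t_def by (intro add_mono mult_mono) auto
    finally show "cmod (f \<xi> * g \<xi> - f \<eta> * g \<eta>) \<le> (A * D + C * B) * cmod (cayley \<xi> - cayley \<eta>) powr \<mu>"
      by (simp add: t_def algebra_simps)
  qed
qed

lemma Reals_add_nonreal: "\<xi> \<in> \<real> \<Longrightarrow> Im b \<noteq> 0 \<Longrightarrow> \<xi> + b \<noteq> 0"
  by (metis Im_complex_of_real Reals_cases add.commute add_cancel_right_left plus_complex.sel(2) zero_complex.sel(2))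

text \<open>
  A Moebius function with a finite value at infinity and no pole on the line is a smooth function
  of \<open>cayley \<xi>\<close> on the circle, so it is Lipschitz there and Hoelder for every exponent up to \<open>1\<close>.
\<close>
lemma C_mu_moebius:
  assumes b: "Im b \<noteq> 0" and \<mu>: "0 < \<mu>" "\<mu> < 1"
  shows "(\<lambda>\<xi>. (\<xi> + a) / (\<xi> + b)) \<in> C_mu \<mu>"
proof -
  \<comment> \<open>\<open>K\<close> compares the distances of a real point from \<open>- \<i>\<close>, the pole of \<open>cayley\<close>, and from \<open>- b\<close>.\<close>
  define K where "K = 1 + cmod (\<i> - b) / \<bar>Im b\<bar>"
  have K0: "0 \<le> K" by (simp add: K_def)
  have K: "cmod (\<xi> + \<i>) \<le> K * cmod (\<xi> + b)" if "\<xi> \<in> \<real>" for \<xi>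
  proof -
    have "\<bar>Im b\<bar> \<le> cmod (\<xi> + b)"
      using abs_Im_le_cmod[of "\<xi> + b"] that by (auto elim!: Reals_cases)
    then have "cmod (\<i> - b) \<le> cmod (\<i> - b) / \<bar>Im b\<bar> * cmod (\<xi> + b)"
      using b mult_left_mono[of "\<bar>Im b\<bar>" "cmod (\<xi> + b)" "cmod (\<i> - b) / \<bar>Im b\<bar>"] by simp
    then show ?thesis
      using norm_triangle_ineq[of "\<xi> + b" "\<i> - b"] by (simp add: K_def algebra_simps)
  qed
  show ?thesis
  proof (rule C_muI[of _ "cmod (b - a) * K * K / 2 * 2"])
    fix \<xi> \<eta> :: complex assume R: "\<xi> \<in> \<real>" "\<eta> \<in> \<real>"
    have nz: "\<xi> + b \<noteq> 0" "\<eta> + b \<noteq> 0" "\<xi> + \<i> \<noteq> 0" "\<eta> + \<i> \<noteq> 0"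
      using R b by (simp_all add: Reals_add_nonreal)
    define d where "d = cmod (cayley \<xi> - cayley \<eta>)"
    have d2: "d \<le> 2" using cmod_cayley_diff_le[OF R] by (simp add: d_def)
    have ca: "cayley \<xi> - cayley \<eta> = 2 * \<i> * (\<xi> - \<eta>) / ((\<xi> + \<i>) * (\<eta> + \<i>))"
      using nz by (simp add: cayley_def field_simps)
    have e1: "(\<xi> + a) / (\<xi> + b) - (\<eta> + a) / (\<eta> + b) = (b - a) * (\<xi> - \<eta>) / ((\<xi> + b) * (\<eta> + b))"
      using nz by (simp add: field_simps)
    have P: "0 < cmod (\<xi> + b) * cmod (\<eta> + b)" "0 < cmod (\<xi> + \<i>) * cmod (\<eta> + \<i>)" using nz by simp_all
    have "1 / (cmod (\<xi> + b) * cmod (\<eta> + b)) \<le> (K * K) / (cmod (\<xi> + \<i>) * cmod (\<eta> + \<i>))"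
    proof -
      have "cmod (\<xi> + \<i>) * cmod (\<eta> + \<i>) \<le> (K * cmod (\<xi> + b)) * (K * cmod (\<eta> + b))"
        using K R K0 by (intro mult_mono) auto
      then show ?thesis using P by (simp add: divide_simps mult_ac)
    qed
    then have "cmod (b - a) * cmod (\<xi> - \<eta>) * (1 / (cmod (\<xi> + b) * cmod (\<eta> + b)))
        \<le> cmod (b - a) * cmod (\<xi> - \<eta>) * ((K * K) / (cmod (\<xi> + \<i>) * cmod (\<eta> + \<i>)))"
      by (intro mult_left_mono) auto
    also have "\<dots> = cmod (b - a) * K * K / 2 * d"
      by (simp add: d_def ca norm_mult norm_divide)
    finally have "cmod ((\<xi> + a) / (\<xi> + b) - (\<eta> + a) / (\<eta> + b)) \<le> cmod (b - a) * K * K / 2 * d"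
      by (simp add: e1 norm_mult norm_divide)
    also have "\<dots> \<le> cmod (b - a) * K * K / 2 * (2 * d powr \<mu>)"
    proof (rule mult_left_mono)
      show "d \<le> 2 * d powr \<mu>"
      proof (cases "d = 0")
      case False
      then have dp: "0 < d" by (simp add: d_def)
      have "d = d powr (1 - \<mu>) * d powr \<mu>" using dp by (simp flip: powr_add)
      also have "d powr (1 - \<mu>) \<le> 2 powr (1 - \<mu>)" using dp d2 \<mu> by (intro powr_mono2) auto
      also have "2 powr (1 - \<mu>) \<le> 2 powr (1::real)" using \<mu> by (intro powr_mono) auto
      finally show ?thesis by (simp add: mult_right_mono)
      qed simp
    qed (use K0 in simp)
    finally show "cmod ((\<xi> + a) / (\<xi> + b) - (\<eta> + a) / (\<eta> + b))
        \<le> cmod (b - a) * K * K / 2 * 2 * cmod (cayley \<xi> - cayley \<eta>) powr \<mu>"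
      by (simp add: d_def mult_ac)
  qed
qed

lemma C_mu_continuous:
  assumes "f \<in> C_mu \<mu>" "0 < \<mu>"
  shows "continuous_on UNIV (\<lambda>x::real. f (of_real x))"
proof -
  obtain C where C: "0 \<le> C"
    "\<And>\<xi> \<eta>. \<xi> \<in> \<real> \<Longrightarrow> \<eta> \<in> \<real> \<Longrightarrow> cmod (f \<xi> - f \<eta>) \<le> C * cmod (cayley \<xi> - cayley \<eta>) powr \<mu>"
    using C_muE[OF assms(1)] by metis
  have "((\<lambda>y. f (of_real y)) \<longlongrightarrow> f (of_real x)) (at x)" for x :: real
  proof -
    have "((\<lambda>y::real. cayley (of_real y)) \<longlongrightarrow> cayley (of_real x)) (at x)"
      unfolding cayley_def by (intro tendsto_intros) (auto simp: complex_eq_iff)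
    then have "((\<lambda>y::real. cmod (cayley (of_real y) - cayley (of_real x))) \<longlongrightarrow> 0) (at x)"
      by (simp add: LIM_zero tendsto_norm_zero)
    then have "((\<lambda>y::real. cmod (cayley (of_real y) - cayley (of_real x)) powr \<mu>) \<longlongrightarrow> 0 powr \<mu>) (at x)"
      using assms(2) by (intro tendsto_powr') auto
    then have "((\<lambda>y::real. C * cmod (cayley (of_real y) - cayley (of_real x)) powr \<mu>) \<longlongrightarrow> 0) (at x)"
      by (auto intro: tendsto_mult_right_zero)
    then have "((\<lambda>y::real. f (of_real y) - f (of_real x)) \<longlongrightarrow> 0) (at x)"
      by (rule Lim_null_comparison[rotated]) (auto intro!: always_eventually C)
    then show ?thesis by (rule LIM_zero_cancel)
  qed
  then show ?thesis by (simp add: continuous_on_def)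
qed

section \<open>Bounded holomorphic functions on a half-plane\<close>

definition half :: "real \<Rightarrow> complex set" where
  "half \<sigma> = {z. 0 < \<sigma> * Im z}"

lemma half_one: "half 1 = upper_half" and half_minus_one: "half (- 1) = lower_half"
  by (auto simp: half_def upper_half_def lower_half_def)

lemma open_half: "open (half \<sigma>)"
  unfolding half_def by (intro open_Collect_less continuous_intros)

lemma convex_half: "convex (half \<sigma>)"
proof (rule convexI)
  fix z w :: complex and u v :: real
  assume "z \<in> half \<sigma>" "w \<in> half \<sigma>" and uv: "0 \<le> u" "0 \<le> v" "u + v = 1"
  then have "0 < \<sigma> * Im z" "0 < \<sigma> * Im w" by (auto simp: half_def)
  then have "0 < u * (\<sigma> * Im z) + v * (\<sigma> * Im w)"
    using uv by (metis add.right_neutral add_nonneg_pos add_pos_nonneg less_eq_real_def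
        mult_nonneg_nonneg mult_pos_pos mult_zero_left zero_neq_one)
  then show "u *\<^sub>R z + v *\<^sub>R w \<in> half \<sigma>" by (simp add: half_def algebra_simps)
qed

abbreviation vertical :: "complex set \<Rightarrow> real \<Rightarrow> complex filter" where
  "vertical H x \<equiv> at (of_real x) within {z\<in>H. Re z = x}"

lemma vertical_half_nontrivial: "\<sigma> \<noteq> 0 \<Longrightarrow> vertical (half \<sigma>) x \<noteq> bot"
proof -
  assume s: "\<sigma> \<noteq> 0"
  have "(of_real x :: complex) islimpt {z\<in>half \<sigma>. Re z = x}"
    unfolding islimpt_approachable
  proof (intro allI impI)
    fix e :: real assume "0 < e"
    then show "\<exists>y\<in>{z\<in>half \<sigma>. Re z = x}. y \<noteq> of_real x \<and> dist y (of_real x) < e"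
      using s by (intro bexI[of _ "Complex x (sgn \<sigma> * (e / 2))"])
        (auto simp: half_def complex_eq_iff dist_norm cmod_def sgn_real_def mult_neg_pos not_less)
  qed
  then show ?thesis by (simp add: trivial_limit_within)
qed

lemma H_inftyE:
  assumes "f \<in> H_infty H"
  obtains F B where "F holomorphic_on H" "\<And>z. z \<in> H \<Longrightarrow> cmod (F z) \<le> B"
    "AE x in lborel. (F \<longlongrightarrow> f (of_real x)) (vertical H x)"
  using assms unfolding H_infty_def bounded_iff by blast

lemma H_inftyI:
  assumes "F holomorphic_on H" "\<And>z. z \<in> H \<Longrightarrow> cmod (F z) \<le> B"
    "\<And>x. (F \<longlongrightarrow> f (of_real x)) (vertical H x)"
  shows "f \<in> H_infty H"
  using assms unfolding H_infty_def bounded_iff by fastforce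

lemma H_infty_cong: "(\<And>\<xi>. \<xi> \<in> \<real> \<Longrightarrow> f \<xi> = g \<xi>) \<Longrightarrow> f \<in> H_infty H \<longleftrightarrow> g \<in> H_infty H"
  by (simp add: H_infty_def)

lemma C_mu_H_infty_transfer:
  assumes "g \<in> C_mu \<mu> \<inter> H_infty H" "\<And>\<xi>. \<xi> \<in> \<real> \<Longrightarrow> f \<xi> = g \<xi>"
  shows "f \<in> C_mu \<mu> \<inter> H_infty H"
  using assms(1) C_mu_cong[of f g] H_infty_cong[of f g] assms(2) by simp

lemma H_infty_add:
  assumes "f \<in> H_infty H" "g \<in> H_infty H"
  shows "(\<lambda>\<xi>. f \<xi> + g \<xi>) \<in> H_infty H"
proof -
  obtain F A where F: "F holomorphic_on H" "\<And>z. z \<in> H \<Longrightarrow> cmod (F z) \<le> A"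
    "AE x in lborel. (F \<longlongrightarrow> f (of_real x)) (vertical H x)"
    using H_inftyE[OF assms(1)] by blast
  obtain G B where G: "G holomorphic_on H" "\<And>z. z \<in> H \<Longrightarrow> cmod (G z) \<le> B"
    "AE x in lborel. (G \<longlongrightarrow> g (of_real x)) (vertical H x)"
    using H_inftyE[OF assms(2)] by blast
  have "(\<lambda>z. F z + G z) holomorphic_on H" using F G by (intro holomorphic_intros)
  moreover have "bounded ((\<lambda>z. F z + G z) ` H)"
    unfolding bounded_iff using F(2) G(2) by (auto intro!: exI[of _ "A + B"] norm_triangle_le add_mono)
  moreover have "AE x in lborel. ((\<lambda>z. F z + G z) \<longlongrightarrow> f (of_real x) + g (of_real x)) (vertical H x)"
    using F(3) G(3) by eventually_elim (rule tendsto_add)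
  ultimately show ?thesis unfolding H_infty_def by blast
qed

lemma H_infty_mult:
  assumes "f \<in> H_infty H" "g \<in> H_infty H"
  shows "(\<lambda>\<xi>. f \<xi> * g \<xi>) \<in> H_infty H"
proof -
  obtain F A where F: "F holomorphic_on H" "\<And>z. z \<in> H \<Longrightarrow> cmod (F z) \<le> A"
    "AE x in lborel. (F \<longlongrightarrow> f (of_real x)) (vertical H x)"
    using H_inftyE[OF assms(1)] by blast
  obtain G B where G: "G holomorphic_on H" "\<And>z. z \<in> H \<Longrightarrow> cmod (G z) \<le> B"
    "AE x in lborel. (G \<longlongrightarrow> g (of_real x)) (vertical H x)"
    using H_inftyE[OF assms(2)] by blast
  have "(\<lambda>z. F z * G z) holomorphic_on H" using F G by (intro holomorphic_intros)
  moreover have "cmod (F z * G z) \<le> A * B" if "z \<in> H" for z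
    unfolding norm_mult using F(2)[OF that] G(2)[OF that] order_trans[OF norm_ge_zero F(2)[OF that]]
    by (intro mult_mono) auto
  then have "bounded ((\<lambda>z. F z * G z) ` H)" unfolding bounded_iff by blast
  moreover have "AE x in lborel. ((\<lambda>z. F z * G z) \<longlongrightarrow> f (of_real x) * g (of_real x)) (vertical H x)"
    using F(3) G(3) by eventually_elim (rule tendsto_mult)
  ultimately show ?thesis unfolding H_infty_def by blast
qed

lemma H_infty_const: "(\<lambda>_. c) \<in> H_infty H"
  by (rule H_inftyI[of "\<lambda>_. c" _ "cmod c"]) auto

lemma half_add_bound:
  assumes "\<xi> \<in> half \<sigma> \<union> \<real>" "0 < \<sigma> * Im b" "\<bar>\<sigma>\<bar> = 1"
  shows "\<bar>Im b\<bar> \<le> cmod (\<xi> + b)"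
proof -
  have "0 \<le> \<sigma> * Im \<xi>" using assms(1) by (auto simp: half_def elim!: Reals_cases)
  then have "\<sigma> * Im b \<le> \<sigma> * Im (\<xi> + b)" by (simp add: algebra_simps)
  then have "\<bar>Im b\<bar> \<le> \<bar>Im (\<xi> + b)\<bar>"
    using assms(2,3) by (auto simp: abs_if split: if_splits)
  then show ?thesis using abs_Im_le_cmod order_trans by blast
qed

lemma half_add_nonzero:
  assumes "\<xi> \<in> half \<sigma> \<union> \<real>" "0 < \<sigma> * Im b"
  shows "\<xi> + b \<noteq> 0"
proof
  assume "\<xi> + b = 0"
  then have "\<xi> = - b" by (simp add: eq_neg_iff_add_eq_0)
  moreover have "0 \<le> \<sigma> * Im \<xi>" using assms(1) by (auto simp: half_def elim!: Reals_cases)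
  ultimately show False using assms(2) by simp
qed

lemma H_infty_moebius:
  assumes b: "0 < \<sigma> * Im b" and \<sigma>: "\<bar>\<sigma>\<bar> = 1"
  shows "(\<lambda>\<xi>. (\<xi> + a) / (\<xi> + b)) \<in> H_infty (half \<sigma>)"
proof (rule H_inftyI)
  have nz: "\<xi> + b \<noteq> 0" if "\<xi> \<in> half \<sigma> \<union> \<real>" for \<xi> using half_add_nonzero[OF that b] .
  then show "(\<lambda>\<xi>. (\<xi> + a) / (\<xi> + b)) holomorphic_on half \<sigma>" by (intro holomorphic_intros) auto
  show "((\<lambda>\<xi>. (\<xi> + a) / (\<xi> + b)) \<longlongrightarrow> (of_real x + a) / (of_real x + b)) (vertical (half \<sigma>) x)" for x
    by (intro tendsto_intros nz) auto
  fix \<xi> assume \<xi>: "\<xi> \<in> half \<sigma>"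
  have I: "\<bar>Im b\<bar> \<le> cmod (\<xi> + b)" using half_add_bound[of \<xi> \<sigma> b] \<xi> b \<sigma> by simp
  have "(\<xi> + a) / (\<xi> + b) = 1 + (a - b) / (\<xi> + b)" using nz[of \<xi>] \<xi> by (simp add: field_simps)
  then have "cmod ((\<xi> + a) / (\<xi> + b)) \<le> 1 + cmod (a - b) / cmod (\<xi> + b)"
    by (metis norm_divide norm_one norm_triangle_ineq)
  also have "\<dots> \<le> 1 + cmod (a - b) / \<bar>Im b\<bar>" using I b by (intro add_left_mono divide_left_mono mult_pos_pos) auto
  finally show "cmod ((\<xi> + a) / (\<xi> + b)) \<le> 1 + cmod (a - b) / \<bar>Im b\<bar>" .
qed

section \<open>Liouville's theorem across the line\<close>

lemma closure_half:
  assumes "0 \<le> \<sigma> * Im z" "\<bar>\<sigma>\<bar> = 1"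
  shows "z \<in> closure (half \<sigma>)"
proof -
  have "\<sigma> * \<sigma> = 1" using assms(2) by (auto simp: abs_if split: if_splits)
  then have m: "z + of_real \<sigma> * \<i> * of_real (inverse (real (Suc n))) \<in> half \<sigma>" for n
    using assms(1) by (simp add: half_def ring_distribs add_nonneg_pos flip: mult.assoc)
  have "(\<lambda>n. z + of_real \<sigma> * \<i> * of_real (inverse (real (Suc n)))) \<longlonglongrightarrow> z + of_real \<sigma> * \<i> * of_real 0"
    by (intro tendsto_intros LIMSEQ_inverse_real_of_nat)
  then show ?thesis unfolding closure_sequential
    using m by (intro exI[of _ "\<lambda>n. z + of_real \<sigma> * \<i> * of_real (inverse (real (Suc n)))"]) auto
qed

text \<open>
  The passage to primitives turns bounded functions, which have limits on the line only almost
  everywhere, into Lipschitz functions, which extend continuously to the whole line.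
\<close>
lemma lipschitz_primitive_half:
  assumes "F holomorphic_on half \<sigma>" "\<And>z. z \<in> half \<sigma> \<Longrightarrow> cmod (F z) \<le> B" "\<bar>\<sigma>\<bar> = 1"
  obtains P where "\<And>z. z \<in> half \<sigma> \<Longrightarrow> (P has_field_derivative F z) (at z)"
    "continuous_on {z. 0 \<le> \<sigma> * Im z} P"
proof -
  obtain P0 where P0: "\<And>z. z \<in> half \<sigma> \<Longrightarrow> (P0 has_field_derivative F z) (at z within half \<sigma>)"
    using holomorphic_convex_primitive'[OF convex_half open_half assms(1)] by blast
  have "(max B 0)-lipschitz_on (half \<sigma>) P0"
  proof (rule lipschitz_onI)
    fix z w assume "z \<in> half \<sigma>" "w \<in> half \<sigma>"
    then show "dist (P0 z) (P0 w) \<le> max B 0 * dist z w"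
      unfolding dist_norm using assms(2)
      by (intro field_differentiable_bound[OF convex_half P0]) (auto simp: le_max_iff_disj)
  qed simp
  then obtain P where P: "(max B 0)-lipschitz_on (closure (half \<sigma>)) P" "\<And>z. z \<in> half \<sigma> \<Longrightarrow> P z = P0 z"
    using lipschitz_extend_closure by blast
  have sub: "{z. 0 \<le> \<sigma> * Im z} \<subseteq> closure (half \<sigma>)"
    using closure_half assms(3) by (simp add: subset_iff)
  have 1: "continuous_on {z. 0 \<le> \<sigma> * Im z} P"
    using continuous_on_subset[OF lipschitz_on_continuous_on[OF P(1)] sub] .
  have 2: "(P has_field_derivative F z) (at z)" if z: "z \<in> half \<sigma>" for z
  proof -
    have "(P0 has_field_derivative F z) (at z)" 
      using P0[OF z] unfolding at_within_open[OF z open_half] .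
    then show ?thesis
      by (rule has_field_derivative_transform_within_open[OF _ open_half z]) (simp add: P(2))
  qed
  show thesis using that[OF 2 1] .
qed

lemma Complex_sequence_vertical:
  assumes "\<bar>\<sigma>\<bar> = 1"
  shows "filterlim (\<lambda>n. Complex t (\<sigma> * inverse (real (Suc n)))) (vertical (half \<sigma>) t) sequentially"
  unfolding filterlim_at
proof (intro conjI)
  have "(\<lambda>n. Complex t (\<sigma> * inverse (real (Suc n)))) \<longlonglongrightarrow> Complex t (\<sigma> * 0)"
    by (intro tendsto_Complex tendsto_intros LIMSEQ_inverse_real_of_nat)
  then show "(\<lambda>n. Complex t (\<sigma> * inverse (real (Suc n)))) \<longlonglongrightarrow> of_real t"
    by (simp add: Complex_eq)
  have "\<sigma> * \<sigma> = 1" "\<sigma> \<noteq> 0" using assms by (auto simp: abs_if split: if_splits)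
  then show "\<forall>\<^sub>F n in sequentially. Complex t (\<sigma> * inverse (real (Suc n))) \<in> {z \<in> half \<sigma>. Re z = t}
      \<and> Complex t (\<sigma> * inverse (real (Suc n))) \<noteq> of_real t"
    by (auto simp: half_def complex_eq_iff simp flip: mult.assoc)
qed

text \<open>
  The difference of the primitives at height \<open>1 / n\<close> above and below the line has the derivative
  \<open>Fp - Fm\<close>, which is bounded and tends to \<open>0\<close> almost everywhere.  By dominated convergence its
  integral over \<open>[a, b]\<close> tends to \<open>0\<close>.  The two sides are compared with each other rather than with
  the integral of \<open>f\<close>, because \<open>f\<close> may fail to be measurable.
\<close>
lemma boundary_primitives_differ_by_constant:
  fixes Fp Fm Pp Pm :: "complex \<Rightarrow> complex"
  assumes Fp: "Fp holomorphic_on half 1" "\<And>z. z \<in> half 1 \<Longrightarrow> cmod (Fp z) \<le> A"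
    "AE x in lborel. (Fp \<longlongrightarrow> f x) (vertical (half 1) x)"
    and Fm: "Fm holomorphic_on half (-1)" "\<And>z. z \<in> half (-1) \<Longrightarrow> cmod (Fm z) \<le> B"
    "AE x in lborel. (Fm \<longlongrightarrow> f x) (vertical (half (-1)) x)"
    and Pp: "\<And>z. z \<in> half 1 \<Longrightarrow> (Pp has_field_derivative Fp z) (at z)" "continuous_on {z. 0 \<le> 1 * Im z} Pp"
    and Pm: "\<And>z. z \<in> half (-1) \<Longrightarrow> (Pm has_field_derivative Fm z) (at z)" "continuous_on {z. 0 \<le> (-1) * Im z} Pm"
    and "a \<le> b"
  shows "Pp (of_real b) - Pm (of_real b) = Pp (of_real a) - Pm (of_real a)"
proof -
  define u where "u n t = Complex t (1 * inverse (real (Suc n)))" for n t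
  define v where "v n t = Complex t (-1 * inverse (real (Suc n)))" for n t
  have uv: "u n t \<in> half 1" "v n t \<in> half (-1)" for n t by (simp_all add: u_def v_def half_def)
  have ueq: "u n = (\<lambda>t. of_real t + \<i> * of_real (inverse (real (Suc n))))"
    and veq: "v n = (\<lambda>t. of_real t - \<i> * of_real (inverse (real (Suc n))))" for n
    unfolding u_def v_def Complex_eq by (rule ext, simp only: of_real_mult of_real_1 of_real_minus, algebra)+
  have contu: "continuous_on S (u n)" and contv: "continuous_on S (v n)" for n S
    unfolding ueq veq by (intro continuous_intros)+
  define D where "D n t = Fp (u n t) - Fm (v n t)" for n t
  define Q where "Q n t = Pp (u n t) - Pm (v n t)" for n t
  have Qd: "(Q n has_vector_derivative D n t) (at t within {a..b})" for n t
  proof -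
    have 1: "(complex_of_real has_vector_derivative 1) (at t within {a..b})"
      unfolding has_vector_derivative_def scaleR_conv_of_real
      by (rule has_derivative_eq_rhs[OF has_derivative_of_real[OF has_derivative_ident]]) simp
    have "(u n has_vector_derivative 1) (at t within {a..b})"
      using has_vector_derivative_add[OF 1 has_vector_derivative_const] unfolding ueq by simp
    from field_vector_diff_chain_within[OF this has_field_derivative_at_within[OF Pp(1)[OF uv(1)]]]
    have p: "((\<lambda>t. Pp (u n t)) has_vector_derivative Fp (u n t)) (at t within {a..b})" by (simp add: o_def)
    have "(v n has_vector_derivative 1) (at t within {a..b})"
      using has_vector_derivative_diff[OF 1 has_vector_derivative_const] unfolding veq by simp
    from field_vector_diff_chain_within[OF this has_field_derivative_at_within[OF Pm(1)[OF uv(2)]]]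
    have m: "((\<lambda>t. Pm (v n t)) has_vector_derivative Fm (v n t)) (at t within {a..b})" by (simp add: o_def)
    show ?thesis unfolding Q_def D_def by (rule has_vector_derivative_diff[OF p m])
  qed
  have Dc: "continuous_on {a..b} (D n)" for n
    unfolding D_def
    by (intro continuous_on_diff continuous_on_compose2[OF holomorphic_on_imp_continuous_on[OF Fp(1)]]
        continuous_on_compose2[OF holomorphic_on_imp_continuous_on[OF Fm(1)]] contu contv)
      (auto simp: uv)
  have I: "integral\<^sup>L lborel (\<lambda>x. indicator {a..b} x *\<^sub>R D n x) = Q n b - Q n a" for n
    by (rule integral_FTC_atLeastAtMost[OF \<open>a \<le> b\<close> Qd Dc])
  have "(\<lambda>n. integral\<^sup>L lborel (\<lambda>x. indicator {a..b} x *\<^sub>R D n x)) \<longlonglongrightarrow> integral\<^sup>L lborel (\<lambda>x::real. 0 :: complex)"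
  proof (rule integral_dominated_convergence)
    show "integrable lborel (\<lambda>x. indicator {a..b} x * (A + B))"
      by (intro integrable_mult_left integrable_real_indicator) (simp_all add: emeasure_lborel_Icc_eq)
    show "(\<lambda>x. indicator {a..b} x *\<^sub>R D n x) \<in> borel_measurable lborel" for n
      using borel_measurable_continuous_on_indicator[OF _ Dc[of n]] by simp
    show "AE x in lborel. norm (indicator {a..b} x *\<^sub>R D n x) \<le> indicator {a..b} x * (A + B)" for n
      using Fp(2)[OF uv(1)] Fm(2)[OF uv(2)]
      by (auto simp: D_def indicator_def intro!: norm_triangle_le_diff add_mono)
    show "AE x in lborel. (\<lambda>n. indicator {a..b} x *\<^sub>R D n x) \<longlonglongrightarrow> 0"
      using Fp(3) Fm(3)
    proof eventually_elim
      case (elim x)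
      have "(\<lambda>n. D n x) \<longlonglongrightarrow> f x - f x"
        unfolding D_def u_def v_def
        by (intro tendsto_diff filterlim_compose[OF elim(1)] filterlim_compose[OF elim(2)]
            Complex_sequence_vertical) auto
      then show ?case by (auto intro: tendsto_eq_intros)
    qed
  qed simp
  then have "(\<lambda>n. Q n b - Q n a) \<longlonglongrightarrow> 0" by (simp add: I)
  moreover have "(\<lambda>n. Q n t) \<longlonglongrightarrow> Pp (of_real t) - Pm (of_real t)" for t
  proof -
    have "(\<lambda>n. u n t) \<longlonglongrightarrow> of_real t" "(\<lambda>n. v n t) \<longlonglongrightarrow> of_real t"
      using Complex_sequence_vertical[of 1 t] Complex_sequence_vertical[of "-1" t]
      unfolding u_def v_def filterlim_at by auto
    then show ?thesis unfolding Q_def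
      using uv[unfolded half_def]
      by (intro tendsto_diff continuous_on_tendsto_compose[OF Pp(2)] continuous_on_tendsto_compose[OF Pm(2)])
        (auto intro!: always_eventually simp: less_imp_le)
  qed
  ultimately have "Pp (of_real b) - Pm (of_real b) - (Pp (of_real a) - Pm (of_real a)) = 0"
    by (intro LIMSEQ_unique[of "\<lambda>n. Q n b - Q n a"] tendsto_diff)
  then show ?thesis by simp
qed

text \<open>
  The primitives from both sides can be chosen to agree on the line, so they paste to an entire
  function.  Its derivative is bounded, hence constant by the classical theorem of Liouville.
\<close>
theorem Liouville_across_line:
  assumes p: "f \<in> H_infty (half 1)" and m: "f \<in> H_infty (half (-1))"
  shows "\<exists>c. AE x in lborel. f (of_real x) = c"
proof -
  obtain Fp A where Fp: "Fp holomorphic_on half 1" "\<And>z. z \<in> half 1 \<Longrightarrow> cmod (Fp z) \<le> A"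
    "AE x in lborel. (Fp \<longlongrightarrow> f (of_real x)) (vertical (half 1) x)" using H_inftyE[OF p] by blast
  obtain Fm B where Fm: "Fm holomorphic_on half (-1)" "\<And>z. z \<in> half (-1) \<Longrightarrow> cmod (Fm z) \<le> B"
    "AE x in lborel. (Fm \<longlongrightarrow> f (of_real x)) (vertical (half (-1)) x)" using H_inftyE[OF m] by blast
  obtain Pp where Pp: "\<And>z. z \<in> half 1 \<Longrightarrow> (Pp has_field_derivative Fp z) (at z)"
      "continuous_on {z. 0 \<le> 1 * Im z} Pp" using lipschitz_primitive_half[OF Fp(1,2)] by auto
  obtain Pm where Pm: "\<And>z. z \<in> half (-1) \<Longrightarrow> (Pm has_field_derivative Fm z) (at z)"
      "continuous_on {z. 0 \<le> (-1) * Im z} Pm" using lipschitz_primitive_half[OF Fm(1,2)] by auto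
  \<comment> \<open>Shifting \<open>Pm\<close> by \<open>d\<close> makes the primitives agree at \<open>0\<close>, hence on the whole line.\<close>
  define d where "d = Pp 0 - Pm 0"
  define P where "P z = (if 0 \<le> Im z then Pp z else Pm z + d)" for z
  have agree: "Pp (of_real x) = Pm (of_real x) + d" for x
    using boundary_primitives_differ_by_constant[OF Fp Fm Pp Pm, of 0 x] boundary_primitives_differ_by_constant[OF Fp Fm Pp Pm, of x 0]
    by (cases "0 \<le> x") (auto simp: d_def algebra_simps)
  have Pc: "continuous_on UNIV P"
  proof -
    have "continuous_on ({z. 0 \<le> Im z} \<union> {z. Im z \<le> 0}) P"
      unfolding P_def
    proof (rule continuous_on_cases)
      show "closed {z. 0 \<le> Im z}" "closed {z. Im z \<le> 0}"
        by (intro closed_Collect_le continuous_intros)+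
      show "continuous_on {z. 0 \<le> Im z} Pp" using Pp(2) by simp
      show "continuous_on {z. Im z \<le> 0} (\<lambda>z. Pm z + d)" using Pm(2) by (intro continuous_intros) simp
      show "\<forall>z. z \<in> {z. 0 \<le> Im z} \<and> \<not> 0 \<le> Im z \<or> z \<in> {z. Im z \<le> 0} \<and> 0 \<le> Im z \<longrightarrow> Pp z = Pm z + d"
      proof (intro allI impI)
        fix z assume "z \<in> {z. 0 \<le> Im z} \<and> \<not> 0 \<le> Im z \<or> z \<in> {z. Im z \<le> 0} \<and> 0 \<le> Im z"
        then have "z = of_real (Re z)" by (auto simp: complex_eq_iff)
        then show "Pp z = Pm z + d" using agree by metis
      qed
    qed
    moreover have "{z. 0 \<le> Im z} \<union> {z. Im z \<le> 0} = UNIV" by auto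
    ultimately show ?thesis by simp
  qed
  have dp: "(P has_field_derivative Fp z) (at z)" if "z \<in> half 1" for z
    by (rule has_field_derivative_transform_within_open[OF Pp(1)[OF that] open_half that])
      (simp add: P_def half_def)
  have dm: "(P has_field_derivative Fm z) (at z)" if "z \<in> half (-1)" for z
  proof (rule has_field_derivative_transform_within_open[OF _ open_half that])
    show "((\<lambda>z. Pm z + d) has_field_derivative Fm z) (at z)"
      using Pm(1)[OF that] by (auto intro!: derivative_eq_intros)
  qed (simp add: P_def half_def)
  have "P holomorphic_on UNIV"
  proof (rule holomorphic_on_paste_across_line[OF open_UNIV _ _ _ Pc])
    have "UNIV \<inter> {z. \<i> \<bullet> z < 0} = half (-1)" "UNIV \<inter> {z. 0 < \<i> \<bullet> z} = half 1"
      by (auto simp: half_def inner_complex_def)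
    then show "P holomorphic_on UNIV \<inter> {z. \<i> \<bullet> z < 0}" "P holomorphic_on UNIV \<inter> {z. 0 < \<i> \<bullet> z}"
      using dp dm by (simp_all add: holomorphic_on_open open_half) blast+
  qed simp
  then have hd: "deriv P holomorphic_on UNIV" by (simp add: holomorphic_deriv)
  \<comment> \<open>The bound holds off the line, where the derivative is \<open>Fp\<close> or \<open>Fm\<close>, and extends by continuity.\<close>
  have "cmod (deriv P z) \<le> max A B" for z
  proof (rule continuous_le_on_closure[of "half 1 \<union> half (-1)" "\<lambda>z. cmod (deriv P z)"])
    show "continuous_on (closure (half 1 \<union> half (-1))) (\<lambda>z. cmod (deriv P z))"
      by (rule continuous_on_norm[OF continuous_on_subset[OF holomorphic_on_imp_continuous_on[OF hd] subset_UNIV]])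
    show "z \<in> closure (half 1 \<union> half (-1))"
      using closure_half[of 1 z] closure_half[of "-1" z] by (cases "0 \<le> Im z") (simp_all add: closure_Un)
    fix w assume "w \<in> half 1 \<union> half (-1)"
    then show "cmod (deriv P w) \<le> max A B"
      using DERIV_imp_deriv[OF dp, of w] DERIV_imp_deriv[OF dm, of w] Fp(2)[of w] Fm(2)[of w]
      by (auto simp: le_max_iff_disj)
  qed
  then have "bounded (range (deriv P))" unfolding bounded_iff by blast
  then obtain c where c: "\<And>z. deriv P z = c"
    using Liouville_theorem[OF hd] unfolding constant_on_def by auto
  have "Fp z = c" if "z \<in> half 1" for z using DERIV_imp_deriv[OF dp[OF that]] c by simp
  then have fc: "f (of_real x) = c" if "(Fp \<longlongrightarrow> f (of_real x)) (vertical (half 1) x)" for x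
  proof -
    assume c: "\<And>z. z \<in> half 1 \<Longrightarrow> Fp z = c"
    have "(Fp \<longlongrightarrow> c) (vertical (half 1) x)"
      by (rule tendsto_eventually) (auto simp: eventually_at_filter c)
    then show ?thesis using tendsto_unique[OF vertical_half_nontrivial that] by simp
  qed
  have "AE x in lborel. f (of_real x) = c" using Fp(3) by eventually_elim (rule fc)
  then show ?thesis ..
qed

text \<open>
  A continuous function that is constant almost everywhere is constant, because a nonempty open set
  is not negligible.
\<close>
corollary Liouville_C_mu:
  assumes f: "f \<in> C_mu \<mu>" "0 < \<mu>" and "f \<in> H_infty (half 1)" "f \<in> H_infty (half (-1))"
  obtains c where "\<And>\<xi>. \<xi> \<in> \<real> \<Longrightarrow> f \<xi> = c"
proof -
  obtain c where c: "AE x in lborel. f (of_real x) = c" using Liouville_across_line[OF assms(3,4)] by blast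
  define S where "S = {x::real. f (of_real x) \<noteq> c}"
  have "open S"
    unfolding S_def using C_mu_continuous[OF f] by (intro open_Collect_neq continuous_intros)
  moreover have "negligible S"
  proof -
    have "S \<in> sets lborel" using \<open>open S\<close> by simp
    then have "S \<in> null_sets lborel" using c by (subst AE_iff_null_sets) (simp_all add: S_def)
    then show ?thesis by (simp add: negligible_iff_null_sets null_sets_completionI)
  qed
  ultimately have "S = {}" using open_not_negligible by blast
  then show thesis using that[of c] by (auto simp: S_def elim!: Reals_cases)
qed

section \<open>Analytic functions on half of the curve\<close>

lemma half_Un_Reals: "\<bar>\<sigma>\<bar> = 1 \<Longrightarrow> half \<sigma> \<union> \<real> = {z. 0 \<le> \<sigma> * Im z}"
  by (auto simp: half_def complex_is_Real_iff abs_if less_le split: if_splits)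

text \<open>
  A criterion for the even and odd part of a function on the curve, with \<open>Z\<close> the set of branch
  points, where such a part has limits but no reliable values: the singularities are removable, the
  extension is continuous up to the line and therefore bounded on a compact part, and near infinity it is
  bounded by assumption.
\<close>
lemma bounded_extension:
  assumes \<sigma>: "\<bar>\<sigma>\<bar> = 1"
    and Z: "finite Z" "Z \<inter> \<real> = {}" "Z \<subseteq> cball 0 R"
    and hol: "\<And>z. z \<in> half \<sigma> \<Longrightarrow> z \<notin> Z \<Longrightarrow> E analytic_on {z}"
    and lim: "\<And>z. z \<in> half \<sigma> \<Longrightarrow> z \<in> Z \<Longrightarrow> \<exists>c. E \<midarrow>z\<rightarrow> c"
    and real: "\<And>x. (E \<longlongrightarrow> E (of_real x)) (at (of_real x) within half \<sigma> \<union> \<real>)"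
    and bdd: "\<And>z. z \<in> half \<sigma> \<union> \<real> \<Longrightarrow> R < cmod z \<Longrightarrow> cmod (E z) \<le> B"
  shows "E \<in> H_infty (half \<sigma>)"
proof -
  define g where "g z = (if z \<in> Z then remove_sings E z else E z)" for z
  have gr: "g z = remove_sings E z" if "z \<in> half \<sigma>" for z
    using hol[OF that] by (simp add: g_def)
  have ana: "remove_sings E analytic_on {z}" if z: "z \<in> half \<sigma>" for z
  proof (cases "z \<in> Z")
    case False
    then show ?thesis using hol[OF z] by (intro remove_sings_analytic_on)
  next
    case True
    have "open (half \<sigma> - (Z - {z}))" using Z(1) by (intro open_Diff open_half finite_imp_closed) auto
    moreover have "E holomorphic_on (half \<sigma> - (Z - {z})) - {z}"
      by (rule analytic_imp_holomorphic, subst analytic_on_analytic_at) (use hol in blast)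
    ultimately have "isolated_singularity_at E z"
      using z by (intro isolated_singularity_at_holomorphic[of _ "half \<sigma> - (Z - {z})"]) auto
    then show ?thesis using lim[OF z True] remove_sings_analytic_at by blast
  qed
  have "remove_sings E analytic_on half \<sigma>"
    using ana by (subst analytic_on_analytic_at) blast
  then have "remove_sings E holomorphic_on half \<sigma>" by (rule analytic_imp_holomorphic)
  then have gh: "g holomorphic_on half \<sigma>" using gr by (simp cong: holomorphic_cong)
  have gE: "\<forall>\<^sub>F z in at (of_real x) within S. g z = E z" for x S
  proof -
    have "\<forall>\<^sub>F z in nhds (of_real x). z \<in> - Z"
      using Z by (intro eventually_nhds_in_open) (auto simp: finite_imp_closed open_Compl)
    then show ?thesis unfolding eventually_at_filter by eventually_elim (simp add: g_def)
  qed
  have real': "(g \<longlongrightarrow> E (of_real x)) (at (of_real x) within half \<sigma> \<union> \<real>)" for x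
    using real[of x] tendsto_cong[OF gE] by blast
  have gc: "continuous_on (half \<sigma> \<union> \<real>) g"
    unfolding continuous_on_eq_continuous_within
  proof
    fix z assume "z \<in> half \<sigma> \<union> \<real>"
    then consider "z \<in> half \<sigma>" | x where "z = of_real x" by (auto elim: Reals_cases)
    then show "continuous (at z within half \<sigma> \<union> \<real>) g"
    proof cases
      case 1
      then have "isCont g z"
        using holomorphic_on_imp_continuous_on[OF gh] continuous_on_eq_continuous_at[OF open_half] by blast
      then show ?thesis by (rule continuous_at_imp_continuous_at_within)
    next
      case 2
      then have "g z = E z" using Z(2) by (auto simp: g_def)
      then show ?thesis using real'[of x] 2 by (simp add: continuous_within)
    qed
  qed
  have "closed (half \<sigma> \<union> \<real>)"
    unfolding half_Un_Reals[OF \<sigma>] by (intro closed_Collect_le continuous_intros)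
  then have "compact ((half \<sigma> \<union> \<real>) \<inter> cball 0 R)" by (intro closed_Int_compact) auto
  then have "compact (g ` ((half \<sigma> \<union> \<real>) \<inter> cball 0 R))"
    by (rule compact_continuous_image[OF continuous_on_subset[OF gc Int_lower1]])
  then have "bounded (g ` ((half \<sigma> \<union> \<real>) \<inter> cball 0 R))" by (rule compact_imp_bounded)
  then obtain A where A: "\<And>z. z \<in> (half \<sigma> \<union> \<real>) \<inter> cball 0 R \<Longrightarrow> cmod (g z) \<le> A"
    by (meson bounded_iff imageI)
  show ?thesis
  proof (rule H_inftyI[OF gh])
    show "cmod (g z) \<le> max A B" if z: "z \<in> half \<sigma>" for z
    proof (cases "cmod z \<le> R")
      case True
      then show ?thesis using A[of z] z by (auto simp: le_max_iff_disj)
    next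
      case False
      then have "z \<notin> Z" using Z(3) by auto
      then show ?thesis using bdd[of z] z False by (auto simp: g_def le_max_iff_disj)
    qed
    show "(g \<longlongrightarrow> E (of_real x)) (vertical (half \<sigma>) x)" for x
      by (rule tendsto_within_subset[OF real']) auto
  qed
qed

subsection \<open>Charts\<close>

lemma frakp_inf: "u \<noteq> 0 \<Longrightarrow> frakp k0 (1 / u) = ((1 + u^2) * (1 + of_real k0 ^ 2 * u^2)) / u^4"
  by (simp add: frakp_def field_simps power2_eq_square power4_eq_xxxx)

lemma inf_chart_in_Sigma:
  "inf_chart u v \<in> Sigma_surf k0 \<longleftrightarrow> v^2 = (1 + u^2) * (1 + of_real k0 ^ 2 * u^2)"
proof (cases "u = 0")
  case False
  have "(v / u^2)^2 = v^2 / u^4" by (simp add: power_divide power2_eq_square power4_eq_xxxx)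
  then have "(v / u^2)^2 = frakp k0 (1 / u) \<longleftrightarrow> v^2 = (1 + u^2) * (1 + of_real k0 ^ 2 * u^2)"
    using False by (simp add: frakp_inf)
  then show ?thesis using False by (auto simp: inf_chart_def Sigma_surf_def)
qed (auto simp: inf_chart_def Sigma_surf_def)

lemma Aff_in_Sigma: "Aff \<xi> \<tau> \<in> Sigma_surf k0 \<longleftrightarrow> \<tau>^2 = frakp k0 \<xi>"
  by (auto simp: Sigma_surf_def)

lemma topspace_Sigma: "topspace (Sigma_top k0) = Sigma_surf k0"
proof
  show "topspace (Sigma_top k0) \<subseteq> Sigma_surf k0"
    using openin_topspace[of "Sigma_top k0"] unfolding openin_Sigma_top Sigma_open_def by blast
  have "Sigma_open k0 (Sigma_surf k0)"
    unfolding Sigma_open_def Aff_in_Sigma inf_chart_in_Sigma by simp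
  then show "Sigma_surf k0 \<subseteq> topspace (Sigma_top k0)"
    by (intro openin_subset) (simp add: openin_Sigma_top)
qed

text \<open>
  The topology of the surface is the final one for its two charts, so composing a continuous function
  with a chart gives a continuous function on the affine curve.
\<close>
lemma continuous_map_Aff:
  fixes F :: "sigma_pt \<Rightarrow> complex"
  assumes F: "continuous_map (subtopology (Sigma_top k0) S) euclidean F"
  shows "continuous_on {(\<xi>, \<tau>). \<tau>^2 = frakp k0 \<xi> \<and> Aff \<xi> \<tau> \<in> S} (\<lambda>(\<xi>, \<tau>). F (Aff \<xi> \<tau>))"
  unfolding continuous_on_open_invariant
proof (intro allI impI)
  fix V :: "complex set" assume "open V"
  then have "openin (subtopology (Sigma_top k0) S) {P \<in> topspace (subtopology (Sigma_top k0) S). F P \<in> V}"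
    using F by (auto simp: continuous_map_def)
  then obtain T where T: "Sigma_open k0 T" "{P \<in> Sigma_surf k0 \<inter> S. F P \<in> V} = T \<inter> S"
    by (auto simp: openin_subtopology openin_Sigma_top topspace_Sigma)
  then obtain A where A: "open A" "{(\<xi>, \<tau>). Aff \<xi> \<tau> \<in> T} = {(\<xi>, \<tau>). \<tau>^2 = frakp k0 \<xi>} \<inter> A"
    unfolding Sigma_open_def openin_open by blast
  have "(\<xi>, \<tau>) \<in> A \<longleftrightarrow> F (Aff \<xi> \<tau>) \<in> V" if "\<tau>^2 = frakp k0 \<xi>" "Aff \<xi> \<tau> \<in> S" for \<xi> \<tau>
  proof -
    have "(\<xi>, \<tau>) \<in> A \<longleftrightarrow> Aff \<xi> \<tau> \<in> T" using A(2) that(1) by auto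
    also have "\<dots> \<longleftrightarrow> F (Aff \<xi> \<tau>) \<in> V" using T(2) that Aff_in_Sigma by blast
    finally show ?thesis .
  qed
  then show "\<exists>A. open A \<and> A \<inter> {(\<xi>, \<tau>). \<tau>^2 = frakp k0 \<xi> \<and> Aff \<xi> \<tau> \<in> S}
      = (\<lambda>(\<xi>, \<tau>). F (Aff \<xi> \<tau>)) -` V \<inter> {(\<xi>, \<tau>). \<tau>^2 = frakp k0 \<xi> \<and> Aff \<xi> \<tau> \<in> S}"
    using A(1) by (intro exI[of _ A]) auto
qed

lemma continuous_map_inf_chart:
  fixes F :: "sigma_pt \<Rightarrow> complex"
  assumes F: "continuous_map (subtopology (Sigma_top k0) S) euclidean F"
  shows "continuous_on {(u, v). v^2 = (1 + u^2) * (1 + of_real k0 ^ 2 * u^2) \<and> inf_chart u v \<in> S}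
    (\<lambda>(u, v). F (inf_chart u v))"
  unfolding continuous_on_open_invariant
proof (intro allI impI)
  fix V :: "complex set" assume "open V"
  then have "openin (subtopology (Sigma_top k0) S) {P \<in> topspace (subtopology (Sigma_top k0) S). F P \<in> V}"
    using F by (auto simp: continuous_map_def)
  then obtain T where T: "Sigma_open k0 T" "{P \<in> Sigma_surf k0 \<inter> S. F P \<in> V} = T \<inter> S"
    by (auto simp: openin_subtopology openin_Sigma_top topspace_Sigma)
  then obtain A where A: "open A"
      "{(u, v). inf_chart u v \<in> T} = {(u, v). v^2 = (1 + u^2) * (1 + of_real k0 ^ 2 * u^2)} \<inter> A"
    unfolding Sigma_open_def openin_open by blast
  have "(u, v) \<in> A \<longleftrightarrow> F (inf_chart u v) \<in> V"
    if "v^2 = (1 + u^2) * (1 + of_real k0 ^ 2 * u^2)" "inf_chart u v \<in> S" for u v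
  proof -
    have "(u, v) \<in> A \<longleftrightarrow> inf_chart u v \<in> T" using A(2) that(1) by auto
    also have "\<dots> \<longleftrightarrow> F (inf_chart u v) \<in> V" using T(2) that inf_chart_in_Sigma by blast
    finally show ?thesis .
  qed
  then show "\<exists>A. open A \<and> A \<inter> {(u, v). v^2 = (1 + u^2) * (1 + of_real k0 ^ 2 * u^2) \<and> inf_chart u v \<in> S}
      = (\<lambda>(u, v). F (inf_chart u v)) -` V \<inter> {(u, v). v^2 = (1 + u^2) * (1 + of_real k0 ^ 2 * u^2) \<and> inf_chart u v \<in> S}"
    using A(1) by (intro exI[of _ A]) auto
qed

abbreviation closed_over :: "real \<Rightarrow> complex set \<Rightarrow> sigma_pt set" where
  "closed_over k0 H \<equiv> Sigma_over k0 H \<union> Gamma_closed k0"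

lemma Aff_closed_over: "Aff \<xi> \<tau> \<in> closed_over k0 H \<longleftrightarrow> \<xi> \<in> H \<union> \<real> \<and> \<tau>^2 = frakp k0 \<xi>"
  by (auto simp: Sigma_over_def Gamma_closed_def)

text \<open>
  In the chart at infinity the points over \<open>half \<sigma> \<union> \<real>\<close> with \<open>1 \<le> cmod \<xi>\<close> lie in a compact set,
  on which \<open>F\<close> is bounded.  Note that \<open>\<xi> \<mapsto> 1 / \<xi>\<close> exchanges the two half-planes.
\<close>
lemma bounded_near_infinity:
  fixes F :: "sigma_pt \<Rightarrow> complex"
  assumes \<sigma>: "\<bar>\<sigma>\<bar> = 1"
    and F: "continuous_map (subtopology (Sigma_top k0) (closed_over k0 (half \<sigma>))) euclidean F"
  obtains B where "\<And>\<xi> \<tau>. \<xi> \<in> half \<sigma> \<union> \<real> \<Longrightarrow> \<tau>^2 = frakp k0 \<xi> \<Longrightarrow> 1 \<le> cmod \<xi> \<Longrightarrow> cmod (F (Aff \<xi> \<tau>)) \<le> B"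
proof -
  define T where "T = {(u::complex, v::complex). v^2 = (1 + u^2) * (1 + of_real k0 ^ 2 * u^2)} \<inter>
    {(u, v). \<sigma> * Im u \<le> 0} \<inter> {(u, v). cmod u \<le> 1}"
  have sub: "T \<subseteq> {(u, v). v^2 = (1 + u^2) * (1 + of_real k0 ^ 2 * u^2) \<and> inf_chart u v \<in> closed_over k0 (half \<sigma>)}"
  proof -
    have "inf_chart u v \<in> closed_over k0 (half \<sigma>)"
      if uv: "v^2 = (1 + u^2) * (1 + of_real k0 ^ 2 * u^2)" "\<sigma> * Im u \<le> 0" for u v
    proof (cases "u = 0")
      case True
      then show ?thesis using uv by (simp add: inf_chart_def Gamma_closed_def)
    next
      case False
      have "Im (1 / u) = - Im u / (cmod u)^2" by (simp add: Im_divide cmod_power2)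
      then have "0 \<le> \<sigma> * Im (1 / u)" using uv(2) by (simp add: divide_nonpos_nonneg)
      then have "1 / u \<in> half \<sigma> \<union> \<real>" using half_Un_Reals[OF \<sigma>] by simp
      moreover have "(v / u^2)^2 = frakp k0 (1 / u)"
        using uv(1) inf_chart_in_Sigma[of u v k0] False by (simp add: inf_chart_def Aff_in_Sigma)
      ultimately show ?thesis using False Aff_closed_over by (simp add: inf_chart_def)
    qed
    then show ?thesis by (auto simp: T_def)
  qed
  have "T \<subseteq> cball 0 1 \<times> cball 0 (2 + 2 * k0^2)"
  proof -
    have "cmod v \<le> 2 + 2 * k0^2" if "v^2 = (1 + u^2) * (1 + of_real k0 ^ 2 * u^2)" "cmod u \<le> 1" for u v
    proof -
      have u2: "cmod (u^2) \<le> 1" using that(2) by (simp add: norm_power power_le_one)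
      have "cmod (1 + u^2) \<le> 2" using norm_triangle_ineq[of 1 "u^2"] u2 by simp
      moreover have "cmod (1 + of_real k0 ^ 2 * u^2) \<le> 1 + k0^2"
        using norm_triangle_ineq[of 1 "of_real k0 ^ 2 * u^2"] u2
          mult_left_mono[OF u2, of "k0^2"] by (simp add: norm_mult norm_power)
      ultimately have "cmod (1 + u^2) * cmod (1 + of_real k0 ^ 2 * u^2) \<le> 2 * (1 + k0^2)"
        by (rule mult_mono) auto
      then have "(cmod v)^2 \<le> 2 * (1 + k0^2)"
        using that(1) by (simp add: norm_mult flip: norm_power)
      then have "(cmod v)^2 \<le> 2 + 2 * k0^2" by simp
      also have "\<dots> \<le> (2 + 2 * k0^2)^2"
        by (rule self_le_power) auto
      finally show ?thesis by (rule power2_le_imp_le) simp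
    qed
    then show ?thesis by (auto simp: T_def)
  qed
  then have "bounded T" using bounded_Times bounded_cball bounded_subset by blast
  moreover have "closed T"
    unfolding T_def case_prod_unfold by (intro closed_Int closed_Collect_le closed_Collect_eq continuous_intros)
  ultimately have "compact T" by (simp add: compact_eq_bounded_closed)
  then have "compact ((\<lambda>(u, v). F (inf_chart u v)) ` T)"
    by (rule compact_continuous_image[OF continuous_on_subset[OF continuous_map_inf_chart[OF F] sub]])
  then have "bounded ((\<lambda>(u, v). F (inf_chart u v)) ` T)" by (rule compact_imp_bounded)
  then obtain B where B: "\<And>u v. (u, v) \<in> T \<Longrightarrow> cmod (F (inf_chart u v)) \<le> B"
    unfolding bounded_iff by (metis (mono_tags, lifting) case_prod_conv imageI)
  show thesis
  proof (rule that)
    fix \<xi> \<tau> assume \<xi>: "\<xi> \<in> half \<sigma> \<union> \<real>" "\<tau>^2 = frakp k0 \<xi>" "1 \<le> cmod \<xi>"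
    then have nz: "\<xi> \<noteq> 0" by auto
    have c: "inf_chart (1 / \<xi>) (\<tau> / \<xi>^2) = Aff \<xi> \<tau>" using nz by (simp add: inf_chart_def field_simps)
    have "0 \<le> \<sigma> * Im \<xi>" using \<xi>(1) half_Un_Reals[OF \<sigma>] by blast
    then have "\<sigma> * Im (1 / \<xi>) \<le> 0" by (simp add: Im_divide divide_nonpos_nonneg)
    moreover have "cmod (1 / \<xi>) \<le> 1" using \<xi>(3) by (simp add: norm_divide divide_le_eq)
    moreover have "(\<tau> / \<xi>^2)^2 = (1 + (1 / \<xi>)^2) * (1 + of_real k0 ^ 2 * (1 / \<xi>)^2)"
      using \<xi>(2) inf_chart_in_Sigma[of "1 / \<xi>" "\<tau> / \<xi>^2" k0] 
      by (simp only: c Aff_in_Sigma simp_thms)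
    ultimately have "(1 / \<xi>, \<tau> / \<xi>^2) \<in> T" by (simp add: T_def)
    from B[OF this] show "cmod (F (Aff \<xi> \<tau>)) \<le> B" by (simp only: c)
  qed
qed

subsection \<open>Even and odd parts of a function on the curve\<close>

lemma tau1_square: "tau1 k0 \<xi> ^ 2 = frakp k0 \<xi>"
  by (simp add: tau1_def)

lemma root_cases: "\<tau>^2 = frakp k0 \<xi> \<Longrightarrow> \<tau> = tau1 k0 \<xi> \<or> \<tau> = - tau1 k0 \<xi>"
  using tau1_square[of k0 \<xi>] power2_eq_iff by metis

text \<open>
  The parts are defined through the principal root \<open>tau1\<close>, which is discontinuous off the line.  As
  they do not change under \<open>\<tau> \<mapsto> - \<tau>\<close>, any other root may be used, such as a locally analytic one.
\<close>
lemma even_part_root: "\<tau>^2 = frakp k0 \<xi> \<Longrightarrow> even_part k0 f \<xi> = (f (\<xi>, \<tau>) + f (\<xi>, - \<tau>)) / 2"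
  using root_cases[of \<tau> k0 \<xi>] by (auto simp: even_part_def Let_def add.commute)

lemma odd_part_root: "\<tau>^2 = frakp k0 \<xi> \<Longrightarrow> odd_part k0 f \<xi> = (f (\<xi>, \<tau>) - f (\<xi>, - \<tau>)) / (2 * \<tau>)"
  using root_cases[of \<tau> k0 \<xi>]
  by (auto simp: odd_part_def Let_def minus_divide_left minus_divide_right)

definition branch_points :: "real \<Rightarrow> complex set" where
  "branch_points k0 = {\<i>, - \<i>, \<i> * of_real k0, - \<i> * of_real k0}"

lemma frakp_factor: "frakp k0 \<xi> = (\<xi> + \<i>) * (\<xi> - \<i>) * ((\<xi> + \<i> * of_real k0) * (\<xi> - \<i> * of_real k0))"
  by (simp add: frakp_def algebra_simps power2_eq_square)

lemma frakp_eq_0_iff: "frakp k0 \<xi> = 0 \<longleftrightarrow> \<xi> \<in> branch_points k0"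
  by (auto simp: frakp_factor branch_points_def eq_neg_iff_add_eq_0)

lemma branch_points_real: "k0 \<noteq> 0 \<Longrightarrow> branch_points k0 \<inter> \<real> = {}"
  by (auto simp: branch_points_def complex_is_Real_iff)

lemma frakp_real_nonzero: "k0 \<noteq> 0 \<Longrightarrow> \<xi> \<in> \<real> \<Longrightarrow> frakp k0 \<xi> \<noteq> 0"
  using branch_points_real frakp_eq_0_iff by blast

lemma local_root:
  assumes "frakp k0 \<xi>0 \<noteq> 0" "\<tau>0^2 = frakp k0 \<xi>0"
  obtains s where "s analytic_on {\<xi>0}" "s \<xi>0 = \<tau>0"
    "\<forall>\<^sub>F \<xi> in nhds \<xi>0. s \<xi> ^ 2 = frakp k0 \<xi>" "\<forall>\<^sub>F \<xi> in nhds \<xi>0. s \<xi> \<noteq> 0"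
proof -
  \<comment> \<open>The quotient is \<open>1\<close> at \<open>\<xi>0\<close>, where the principal root is analytic.\<close>
  define s where "s \<xi> = \<tau>0 * csqrt (frakp k0 \<xi> / frakp k0 \<xi>0)" for \<xi>
  have an: "s analytic_on {\<xi>0}"
    unfolding s_def frakp_def using assms(1) by (intro analytic_intros) (auto simp: frakp_def)
  have s0: "s \<xi>0 = \<tau>0" using assms(1) by (simp add: s_def)
  have sq: "s \<xi> ^ 2 = frakp k0 \<xi>" for \<xi> using assms by (simp add: s_def power_mult_distrib)
  have "(s \<longlongrightarrow> \<tau>0) (nhds \<xi>0)"
    using analytic_at_imp_isCont[OF an] s0 by (simp add: isCont_def tendsto_nhds_iff)
  moreover have "\<tau>0 \<noteq> 0" using assms by auto
  ultimately have "\<forall>\<^sub>F \<xi> in nhds \<xi>0. s \<xi> \<noteq> 0" by (rule tendsto_imp_eventually_ne)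
  then show thesis using that[OF an s0] sq by simp
qed

text \<open>
  Analyticity on the surface near \<open>(\<xi>0, \<tau>0)\<close> as a statement about a neighbourhood in the plane of
  \<open>\<xi>\<close> and \<open>\<tau>\<close>, in which limits along curves can be taken.
\<close>
lemma Sigma_analytic_local:
  assumes "Sigma_analytic_on k0 (Sigma_over k0 H) F" "\<xi>0 \<in> H" "\<tau>0^2 = frakp k0 \<xi>0"
  obtains h where "h analytic_on {if \<tau>0 = 0 then 0 else \<xi>0}"
    "\<forall>\<^sub>F (\<xi>, \<tau>) in nhds (\<xi>0, \<tau>0). \<tau>^2 = frakp k0 \<xi> \<longrightarrow> F (Aff \<xi> \<tau>) = h (if \<tau>0 = 0 then \<tau> else \<xi>)"
proof -
  have "Aff \<xi>0 \<tau>0 \<in> Sigma_over k0 H" using assms by (simp add: Sigma_over_def)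
  then obtain U h where U: "Sigma_open k0 U" "Aff \<xi>0 \<tau>0 \<in> U"
      "h analytic_on {local_coord (Aff \<xi>0 \<tau>0) (Aff \<xi>0 \<tau>0)}" "\<And>R. R \<in> U \<Longrightarrow> F R = h (local_coord (Aff \<xi>0 \<tau>0) R)"
    using assms(1) unfolding Sigma_analytic_on_def openin_Sigma_top by blast
  obtain A where A: "open A" "{(\<xi>, \<tau>). Aff \<xi> \<tau> \<in> U} = {(\<xi>, \<tau>). \<tau>^2 = frakp k0 \<xi>} \<inter> A"
    using U(1) unfolding Sigma_open_def openin_open by blast
  have "(\<xi>0, \<tau>0) \<in> A" using A(2) U(2) by blast
  then have "\<forall>\<^sub>F p in nhds (\<xi>0, \<tau>0). p \<in> A" using A(1) by (intro eventually_nhds_in_open)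
  then have "\<forall>\<^sub>F (\<xi>, \<tau>) in nhds (\<xi>0, \<tau>0). \<tau>^2 = frakp k0 \<xi> \<longrightarrow> F (Aff \<xi> \<tau>) = h (if \<tau>0 = 0 then \<tau> else \<xi>)"
  proof eventually_elim
    case (elim p)
    obtain \<xi> \<tau> where p: "p = (\<xi>, \<tau>)" by fastforce
    have "F (Aff \<xi> \<tau>) = h (if \<tau>0 = 0 then \<tau> else \<xi>)" if "\<tau>^2 = frakp k0 \<xi>"
    proof -
      have "Aff \<xi> \<tau> \<in> U" using A(2) that elim p by blast
      then show ?thesis using U(4) by simp
    qed
    then show ?case by (simp add: p)
  qed
  moreover have "h analytic_on {if \<tau>0 = 0 then 0 else \<xi>0}" using U(3) by (auto split: if_splits)
  ultimately show thesis using that by blast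
qed

abbreviation on_curve :: "(sigma_pt \<Rightarrow> complex) \<Rightarrow> complex \<times> complex \<Rightarrow> complex" where
  "on_curve F \<equiv> (\<lambda>(\<xi>, \<tau>). F (Aff \<xi> \<tau>))"

lemma parts_analytic:
  assumes F: "Sigma_analytic_on k0 (Sigma_over k0 H) F" and \<xi>0: "\<xi>0 \<in> H" "frakp k0 \<xi>0 \<noteq> 0"
  shows "even_part k0 (on_curve F) analytic_on {\<xi>0}" "odd_part k0 (on_curve F) analytic_on {\<xi>0}"
proof -
  define \<tau>0 where "\<tau>0 = tau1 k0 \<xi>0"
  have \<tau>0: "\<tau>0^2 = frakp k0 \<xi>0" "(-\<tau>0)^2 = frakp k0 \<xi>0" "\<tau>0 \<noteq> 0" "-\<tau>0 \<noteq> 0"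
    using tau1_square[of k0 \<xi>0] \<xi>0(2) by (auto simp: \<tau>0_def)
  obtain s where s: "s analytic_on {\<xi>0}" "s \<xi>0 = \<tau>0" "\<forall>\<^sub>F \<xi> in nhds \<xi>0. s \<xi> ^ 2 = frakp k0 \<xi>"
      "\<forall>\<^sub>F \<xi> in nhds \<xi>0. s \<xi> \<noteq> 0"
    using local_root[OF \<xi>0(2) \<tau>0(1)] .
  obtain h1 where h1: "h1 analytic_on {\<xi>0}"
    "\<forall>\<^sub>F (\<xi>, \<tau>) in nhds (\<xi>0, \<tau>0). \<tau>^2 = frakp k0 \<xi> \<longrightarrow> F (Aff \<xi> \<tau>) = h1 \<xi>"
    using Sigma_analytic_local[OF F \<xi>0(1) \<tau>0(1)] unfolding if_not_P[OF \<tau>0(3)] .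
  obtain h2 where h2: "h2 analytic_on {\<xi>0}"
    "\<forall>\<^sub>F (\<xi>, \<tau>) in nhds (\<xi>0, -\<tau>0). \<tau>^2 = frakp k0 \<xi> \<longrightarrow> F (Aff \<xi> \<tau>) = h2 \<xi>"
    using Sigma_analytic_local[OF F \<xi>0(1) \<tau>0(2)] unfolding if_not_P[OF \<tau>0(4)] .
  have st: "(s \<longlongrightarrow> \<tau>0) (nhds \<xi>0)"
    using analytic_at_imp_isCont[OF s(1)] s(2) by (simp add: isCont_def tendsto_nhds_iff)
  then have l1: "filterlim (\<lambda>\<xi>. (\<xi>, s \<xi>)) (nhds (\<xi>0, \<tau>0)) (nhds \<xi>0)"
    and l2: "filterlim (\<lambda>\<xi>. (\<xi>, - s \<xi>)) (nhds (\<xi>0, - \<tau>0)) (nhds \<xi>0)"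
    by (auto intro!: tendsto_intros simp: filterlim_ident)
  have e1: "\<forall>\<^sub>F \<xi> in nhds \<xi>0. F (Aff \<xi> (s \<xi>)) = h1 \<xi>"
    using eventually_compose_filterlim[OF h1(2) l1] s(3) by eventually_elim simp
  have e2: "\<forall>\<^sub>F \<xi> in nhds \<xi>0. F (Aff \<xi> (- s \<xi>)) = h2 \<xi>"
    using eventually_compose_filterlim[OF h2(2) l2] s(3) by eventually_elim simp
  have "(\<lambda>\<xi>. (h1 \<xi> + h2 \<xi>) / 2) analytic_on {\<xi>0}"
    using h1(1) h2(1) by (intro analytic_intros) auto
  moreover have "\<forall>\<^sub>F \<xi> in nhds \<xi>0. even_part k0 (on_curve F) \<xi> = (h1 \<xi> + h2 \<xi>) / 2"
    using e1 e2 s(3) by eventually_elim (simp add: even_part_root)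
  ultimately show "even_part k0 (on_curve F) analytic_on {\<xi>0}"
    by (subst analytic_at_cong[OF _ refl])
  have "(\<lambda>\<xi>. (h1 \<xi> - h2 \<xi>) / (2 * s \<xi>)) analytic_on {\<xi>0}"
    using h1(1) h2(1) s(1,2) \<tau>0(3) by (intro analytic_intros) auto
  moreover have "\<forall>\<^sub>F \<xi> in nhds \<xi>0. odd_part k0 (on_curve F) \<xi> = (h1 \<xi> - h2 \<xi>) / (2 * s \<xi>)"
    using e1 e2 s(3) by eventually_elim (simp add: odd_part_root)
  ultimately show "odd_part k0 (on_curve F) analytic_on {\<xi>0}"
    by (subst analytic_at_cong[OF _ refl])
qed

lemma frakp_tendsto: "(frakp k0 \<longlongrightarrow> frakp k0 \<xi>) (at \<xi> within S)"
  unfolding frakp_def[abs_def] by (intro tendsto_intros)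

text \<open>
  Near a branch point \<open>F\<close> is an analytic function \<open>h\<close> of \<open>\<tau>\<close>.  The even part is
  \<open>(h \<tau> + h (- \<tau>)) / 2\<close> and tends to \<open>h 0\<close>; the odd part is \<open>(h \<tau> - h (- \<tau>)) / (2 \<tau>)\<close> and tends to the
  derivative of \<open>h\<close> at \<open>0\<close>.
\<close>
lemma parts_limit_branch:
  assumes F: "Sigma_analytic_on k0 (Sigma_over k0 H) F" and \<xi>0: "\<xi>0 \<in> H" "frakp k0 \<xi>0 = 0"
  shows "\<exists>c. even_part k0 (on_curve F) \<midarrow>\<xi>0\<rightarrow> c" "\<exists>c. odd_part k0 (on_curve F) \<midarrow>\<xi>0\<rightarrow> c"
proof -
  obtain h where h: "h analytic_on {0}"
    "\<forall>\<^sub>F (\<xi>, \<tau>) in nhds (\<xi>0, 0). \<tau>^2 = frakp k0 \<xi> \<longrightarrow> F (Aff \<xi> \<tau>) = h \<tau>"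
    using Sigma_analytic_local[OF F \<xi>0(1), of 0] \<xi>0(2) by auto
  define t where "t = tau1 k0"
  have "((\<lambda>\<xi>. sqrt (cmod (frakp k0 \<xi>))) \<longlongrightarrow> sqrt (cmod (frakp k0 \<xi>0))) (at \<xi>0)"
    by (rule tendsto_real_sqrt[OF tendsto_norm[OF frakp_tendsto]])
  then have "((\<lambda>\<xi>. cmod (t \<xi>)) \<longlongrightarrow> 0) (at \<xi>0)"
    by (simp add: \<xi>0(2) t_def tau1_def)
  then have t0: "t \<midarrow>\<xi>0\<rightarrow> 0" by (rule tendsto_norm_zero_cancel)
  have "\<forall>\<^sub>F \<xi> in nhds \<xi>0. \<xi> \<in> - (branch_points k0 - {\<xi>0})"
    by (intro eventually_nhds_in_open open_Compl finite_imp_closed) (auto simp: branch_points_def)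
  then have tnz: "\<forall>\<^sub>F \<xi> in at \<xi>0. t \<xi> \<noteq> 0"
    unfolding eventually_at_filter
    by eventually_elim (auto simp: t_def tau1_def frakp_eq_0_iff)
  have l1: "filterlim (\<lambda>\<xi>. (\<xi>, t \<xi>)) (nhds (\<xi>0, 0)) (at \<xi>0)"
    using t0 by (intro tendsto_Pair tendsto_ident_at)
  have "((\<lambda>\<xi>. - t \<xi>) \<longlongrightarrow> - 0) (at \<xi>0)" using t0 by (rule tendsto_minus)
  then have l2: "filterlim (\<lambda>\<xi>. (\<xi>, - t \<xi>)) (nhds (\<xi>0, 0)) (at \<xi>0)"
    by (intro tendsto_Pair tendsto_ident_at) simp
  have sq: "t \<xi> ^ 2 = frakp k0 \<xi>" for \<xi> by (simp add: t_def tau1_square)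
  have e1: "\<forall>\<^sub>F \<xi> in at \<xi>0. F (Aff \<xi> (t \<xi>)) = h (t \<xi>)"
    using eventually_compose_filterlim[OF h(2) l1] by eventually_elim (simp add: sq)
  have e2: "\<forall>\<^sub>F \<xi> in at \<xi>0. F (Aff \<xi> (- t \<xi>)) = h (- t \<xi>)"
    using eventually_compose_filterlim[OF h(2) l2] by eventually_elim (simp add: sq)
  have hc: "isCont h 0" by (rule analytic_at_imp_isCont[OF h(1)])
  have mt0: "(\<lambda>\<xi>. - t \<xi>) \<midarrow>\<xi>0\<rightarrow> 0" using tendsto_minus[OF t0] by simp
  have "((\<lambda>\<xi>. (h (t \<xi>) + h (- t \<xi>)) / 2) \<longlongrightarrow> (h 0 + h 0) / 2) (at \<xi>0)"
    by (rule tendsto_divide[OF tendsto_add[OF isCont_tendsto_compose[OF hc t0]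
            isCont_tendsto_compose[OF hc mt0]] tendsto_const]) simp
  moreover have "\<forall>\<^sub>F \<xi> in at \<xi>0. even_part k0 (on_curve F) \<xi> = (h (t \<xi>) + h (- t \<xi>)) / 2"
    using e1 e2 by eventually_elim (simp add: even_part_root[OF sq])
  ultimately show "\<exists>c. even_part k0 (on_curve F) \<midarrow>\<xi>0\<rightarrow> c"
    using tendsto_cong by fast
  \<comment> \<open>The two difference quotients of \<open>h\<close> at \<open>0\<close>, along \<open>t\<close> and along \<open>- t\<close>, have the same limit.\<close>
  define d where "d = deriv h 0"
  have "(h has_field_derivative d) (at 0)"
    unfolding d_def using analytic_on_imp_differentiable_at[OF h(1)]
    by (simp add: DERIV_deriv_iff_field_differentiable)
  then have q: "((\<lambda>w. (h w - h 0) / w) \<longlongrightarrow> d) (at 0)"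
    by (simp add: has_field_derivative_iff)
  have f1: "filterlim t (at 0) (at \<xi>0)" using t0 tnz by (simp add: filterlim_at)
  have f2: "filterlim (\<lambda>\<xi>. - t \<xi>) (at 0) (at \<xi>0)"
    using mt0 tnz by (simp add: filterlim_at)
  have "((\<lambda>\<xi>. ((h (t \<xi>) - h 0) / t \<xi> + (h (- t \<xi>) - h 0) / (- t \<xi>)) / 2) \<longlongrightarrow> (d + d) / 2) (at \<xi>0)"
    by (intro tendsto_divide tendsto_add tendsto_const filterlim_compose[OF q f1] filterlim_compose[OF q f2]) simp
  moreover have "\<forall>\<^sub>F \<xi> in at \<xi>0. odd_part k0 (on_curve F) \<xi>
      = ((h (t \<xi>) - h 0) / t \<xi> + (h (- t \<xi>) - h 0) / (- t \<xi>)) / 2"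
    using e1 e2 tnz by eventually_elim (simp add: odd_part_root[OF sq] field_simps)
  ultimately show "\<exists>c. odd_part k0 (on_curve F) \<midarrow>\<xi>0\<rightarrow> c"
    using tendsto_cong by fast
qed

lemma parts_limit_real:
  assumes F: "continuous_map (subtopology (Sigma_top k0) (closed_over k0 H)) euclidean F"
    and k0: "k0 \<noteq> 0" and x: "x \<in> \<real>"
  shows "(even_part k0 (on_curve F) \<longlongrightarrow> even_part k0 (on_curve F) x) (at x within H \<union> \<real>)"
    "(odd_part k0 (on_curve F) \<longlongrightarrow> odd_part k0 (on_curve F) x) (at x within H \<union> \<real>)"
proof -
  define \<tau>0 where "\<tau>0 = tau1 k0 x"
  have \<tau>0: "\<tau>0^2 = frakp k0 x" "\<tau>0 \<noteq> 0"
    using tau1_square[of k0 x] frakp_real_nonzero[OF k0 x] by (auto simp: \<tau>0_def)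
  obtain s where s: "s analytic_on {x}" "s x = \<tau>0" "\<forall>\<^sub>F \<xi> in nhds x. s \<xi> ^ 2 = frakp k0 \<xi>"
      "\<forall>\<^sub>F \<xi> in nhds x. s \<xi> \<noteq> 0"
    using local_root[OF frakp_real_nonzero[OF k0 x] \<tau>0(1)] .
  have st: "(s \<longlongrightarrow> \<tau>0) (at x within H \<union> \<real>)"
    using continuous_at_imp_continuous_at_within[OF analytic_at_imp_isCont[OF s(1)]] s(2)
    by (simp add: continuous_within)
  have ev: "\<forall>\<^sub>F \<xi> in at x within H \<union> \<real>. s \<xi> ^ 2 = frakp k0 \<xi> \<and> \<xi> \<in> H \<union> \<real>"
    using s(3) unfolding eventually_at_filter by eventually_elim simp
  define C where "C = {(\<xi>, \<tau>). \<tau>^2 = frakp k0 \<xi> \<and> \<xi> \<in> H \<union> \<real>}"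
  have "C \<subseteq> {(\<xi>, \<tau>). \<tau>^2 = frakp k0 \<xi> \<and> Aff \<xi> \<tau> \<in> closed_over k0 H}"
    unfolding C_def Aff_closed_over by blast
  then have c: "continuous_on C (on_curve F)"
    by (rule continuous_on_subset[OF continuous_map_Aff[OF F]])
  have C: "(x, \<tau>0) \<in> C" "(x, - \<tau>0) \<in> C" using \<tau>0 x by (auto simp: C_def)
  have evC: "\<forall>\<^sub>F \<xi> in at x within H \<union> \<real>. (\<xi>, s \<xi>) \<in> C" "\<forall>\<^sub>F \<xi> in at x within H \<union> \<real>. (\<xi>, - s \<xi>) \<in> C"
    using ev by (eventually_elim; simp add: C_def)+
  note A1 = continuous_on_tendsto_compose[OF c tendsto_Pair[OF tendsto_ident_at st] C(1) evC(1)]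
  note A2 = continuous_on_tendsto_compose[OF c tendsto_Pair[OF tendsto_ident_at tendsto_minus[OF st]] C(2) evC(2)]
  have l1: "((\<lambda>\<xi>. (on_curve F (\<xi>, s \<xi>) + on_curve F (\<xi>, - s \<xi>)) / 2)
        \<longlongrightarrow> (on_curve F (x, \<tau>0) + on_curve F (x, - \<tau>0)) / 2) (at x within H \<union> \<real>)"
    by (rule tendsto_divide[OF tendsto_add[OF A1 A2] tendsto_const]) simp
  have l2: "((\<lambda>\<xi>. (on_curve F (\<xi>, s \<xi>) - on_curve F (\<xi>, - s \<xi>)) / (2 * s \<xi>))
        \<longlongrightarrow> (on_curve F (x, \<tau>0) - on_curve F (x, - \<tau>0)) / (2 * \<tau>0)) (at x within H \<union> \<real>)"
    by (rule tendsto_divide[OF tendsto_diff[OF A1 A2] tendsto_mult[OF tendsto_const st]]) (simp add: \<tau>0)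
  have "\<forall>\<^sub>F \<xi> in at x within H \<union> \<real>. even_part k0 (on_curve F) \<xi>
      = (on_curve F (\<xi>, s \<xi>) + on_curve F (\<xi>, - s \<xi>)) / 2"
    using ev by eventually_elim (intro even_part_root, simp)
  from tendsto_cong[OF this] l1 show "(even_part k0 (on_curve F) \<longlongrightarrow> even_part k0 (on_curve F) x) (at x within H \<union> \<real>)"
    unfolding even_part_root[OF \<tau>0(1)] by (rule iffD2)
  have "\<forall>\<^sub>F \<xi> in at x within H \<union> \<real>. odd_part k0 (on_curve F) \<xi>
      = (on_curve F (\<xi>, s \<xi>) - on_curve F (\<xi>, - s \<xi>)) / (2 * s \<xi>)"
    using ev by eventually_elim (intro odd_part_root, simp)
  from tendsto_cong[OF this] l2 show "(odd_part k0 (on_curve F) \<longlongrightarrow> odd_part k0 (on_curve F) x) (at x within H \<union> \<real>)"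
    unfolding odd_part_root[OF \<tau>0(1)] by (rule iffD2)
qed

text \<open>
  For \<open>2 * k0 \<le> cmod \<xi>\<close> both \<open>1\<close> and \<open>k0\<^sup>2\<close> are at most a quarter of \<open>(cmod \<xi>)\<^sup>2\<close>, so each factor
  of \<open>frakp k0 \<xi>\<close> keeps at least three quarters of it.
\<close>
lemma root_lower_bound:
  assumes "1 < k0" "2 * k0 \<le> cmod \<xi>" "\<tau>^2 = frakp k0 \<xi>"
  shows "3 / 4 * (cmod \<xi>)^2 \<le> cmod \<tau>"
proof -
  define N where "N = (cmod \<xi>)^2"
  have "(2 * k0)^2 \<le> N" unfolding N_def using assms by (intro power_mono) auto
  then have N: "4 * k0^2 \<le> N" by (simp add: power2_eq_square)
  have k: "1 \<le> k0^2" using assms(1) by simp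
  have "N \<le> cmod (1 + \<xi>^2) + 1"
    using norm_triangle_ineq4[of "1 + \<xi>^2" 1] by (simp add: N_def norm_power)
  moreover have "N \<le> cmod (of_real k0 ^ 2 + \<xi>^2) + k0^2"
    using norm_triangle_ineq4[of "of_real k0 ^ 2 + \<xi>^2" "of_real k0 ^ 2"] by (simp add: N_def norm_power)
  ultimately have "3 / 4 * N \<le> cmod (1 + \<xi>^2)" "3 / 4 * N \<le> cmod (of_real k0 ^ 2 + \<xi>^2)" using N k by linarith+
  then have "(3 / 4 * N) * (3 / 4 * N) \<le> cmod (1 + \<xi>^2) * cmod (of_real k0 ^ 2 + \<xi>^2)"
    by (intro mult_mono) (auto simp: N_def)
  also have "\<dots> = (cmod \<tau>)^2" by (simp add: assms(3) frakp_def norm_mult flip: norm_power)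
  finally have "(3 / 4 * N)^2 \<le> (cmod \<tau>)^2" by (simp only: power2_eq_square)
  then show ?thesis unfolding N_def by (rule power2_le_imp_le) simp
qed

text \<open>
  The factor \<open>(\<xi> + a) * (\<xi> + b)\<close> is compensated at infinity by the growth of \<open>\<tau>\<close> in the
  denominator of the odd part.
\<close>
lemma parts_H_infty:
  assumes k0: "1 < k0" and \<sigma>: "\<bar>\<sigma>\<bar> = 1"
    and cont: "continuous_map (subtopology (Sigma_top k0) (closed_over k0 (half \<sigma>))) euclidean F"
    and ana: "Sigma_analytic_on k0 (Sigma_over k0 (half \<sigma>)) F"
  shows "even_part k0 (on_curve F) \<in> H_infty (half \<sigma>)"
    "(\<lambda>\<xi>. (\<xi> + a) * (\<xi> + b) * odd_part k0 (on_curve F) \<xi>) \<in> H_infty (half \<sigma>)"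
proof -
  have k0': "k0 \<noteq> 0" using k0 by simp
  obtain B where B: "\<And>\<xi> \<tau>. \<xi> \<in> half \<sigma> \<union> \<real> \<Longrightarrow> \<tau>^2 = frakp k0 \<xi> \<Longrightarrow> 1 \<le> cmod \<xi> \<Longrightarrow> cmod (F (Aff \<xi> \<tau>)) \<le> B"
    using bounded_near_infinity[OF \<sigma> cont] by metis
  define R where "R = 2 * k0 + cmod a + cmod b"
  have R: "2 * k0 \<le> R" "cmod a \<le> R" "cmod b \<le> R" using k0 by (auto simp: R_def)
  have Z: "finite (branch_points k0)" "branch_points k0 \<inter> \<real> = {}" "branch_points k0 \<subseteq> cball 0 R"
    using k0 R(1) branch_points_real[OF k0'] by (auto simp: branch_points_def norm_mult)
  have bd: "cmod (F (Aff \<xi> (tau1 k0 \<xi>))) \<le> B" "cmod (F (Aff \<xi> (- tau1 k0 \<xi>))) \<le> B"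
    if "\<xi> \<in> half \<sigma> \<union> \<real>" "R < cmod \<xi>" for \<xi>
    using B[OF that(1), of "tau1 k0 \<xi>"] B[OF that(1), of "- tau1 k0 \<xi>"] that(2) R(1) k0
    by (auto simp: tau1_square)
  show "even_part k0 (on_curve F) \<in> H_infty (half \<sigma>)"
  proof (rule bounded_extension[OF \<sigma> Z])
    fix \<xi> assume \<xi>: "\<xi> \<in> half \<sigma> \<union> \<real>" "R < cmod \<xi>"
    have "cmod (F (Aff \<xi> (tau1 k0 \<xi>)) + F (Aff \<xi> (- tau1 k0 \<xi>))) \<le> B + B"
      using bd[OF \<xi>] by (intro norm_triangle_le add_mono)
    then show "cmod (even_part k0 (on_curve F) \<xi>) \<le> B"
      by (simp add: even_part_def Let_def norm_divide)
  qed (use parts_analytic[OF ana] parts_limit_branch[OF ana] parts_limit_real[OF cont k0'] in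
      \<open>auto simp: frakp_eq_0_iff\<close>)
  show "(\<lambda>\<xi>. (\<xi> + a) * (\<xi> + b) * odd_part k0 (on_curve F) \<xi>) \<in> H_infty (half \<sigma>)"
  proof (rule bounded_extension[OF \<sigma> Z])
    fix \<xi> assume "\<xi> \<in> half \<sigma>" "\<xi> \<notin> branch_points k0"
    then show "(\<lambda>\<xi>. (\<xi> + a) * (\<xi> + b) * odd_part k0 (on_curve F) \<xi>) analytic_on {\<xi>}"
      using parts_analytic(2)[OF ana] by (intro analytic_intros) (auto simp: frakp_eq_0_iff)
  next
    fix \<xi> assume "\<xi> \<in> half \<sigma>" "\<xi> \<in> branch_points k0"
    then obtain c where "odd_part k0 (on_curve F) \<midarrow>\<xi>\<rightarrow> c"
      using parts_limit_branch(2)[OF ana] by (auto simp: frakp_eq_0_iff)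
    then have "(\<lambda>\<xi>. (\<xi> + a) * (\<xi> + b) * odd_part k0 (on_curve F) \<xi>) \<midarrow>\<xi>\<rightarrow> (\<xi> + a) * (\<xi> + b) * c"
      by (intro tendsto_intros)
    then show "\<exists>c. (\<lambda>\<xi>. (\<xi> + a) * (\<xi> + b) * odd_part k0 (on_curve F) \<xi>) \<midarrow>\<xi>\<rightarrow> c" ..
  next
    fix x
    show "((\<lambda>\<xi>. (\<xi> + a) * (\<xi> + b) * odd_part k0 (on_curve F) \<xi>) \<longlongrightarrow>
        (of_real x + a) * (of_real x + b) * odd_part k0 (on_curve F) (of_real x)) (at (of_real x) within half \<sigma> \<union> \<real>)"
      by (intro tendsto_intros parts_limit_real(2)[OF cont k0']) simp
  next
    fix \<xi> assume \<xi>: "\<xi> \<in> half \<sigma> \<union> \<real>" "R < cmod \<xi>"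
    define r where "r = (cmod \<xi>)^2"
    have r: "0 < r" using \<xi>(2) R k0 by (auto simp: r_def)
    have "cmod (\<xi> + a) \<le> 2 * cmod \<xi>" "cmod (\<xi> + b) \<le> 2 * cmod \<xi>"
      using norm_triangle_ineq[of \<xi> a] norm_triangle_ineq[of \<xi> b] \<xi>(2) R by linarith+
    then have 1: "cmod (\<xi> + a) * cmod (\<xi> + b) \<le> (2 * cmod \<xi>) * (2 * cmod \<xi>)"
      by (intro mult_mono) auto
    have 2: "3 / 4 * r \<le> cmod (tau1 k0 \<xi>)"
      unfolding r_def using \<xi>(2) R(1) k0 by (intro root_lower_bound) (auto simp: tau1_square)
    have 3: "cmod (F (Aff \<xi> (tau1 k0 \<xi>)) - F (Aff \<xi> (- tau1 k0 \<xi>))) \<le> B + B"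
      using bd[OF \<xi>] by (intro norm_triangle_le_diff add_mono)
    have "cmod ((\<xi> + a) * (\<xi> + b) * odd_part k0 (on_curve F) \<xi>)
        = (cmod (\<xi> + a) * cmod (\<xi> + b)) * (cmod (F (Aff \<xi> (tau1 k0 \<xi>)) - F (Aff \<xi> (- tau1 k0 \<xi>)))
          / (2 * cmod (tau1 k0 \<xi>)))"
      by (simp add: odd_part_def Let_def norm_mult norm_divide)
    also have "\<dots> \<le> (4 * r) * ((B + B) / (2 * (3 / 4 * r)))"
    proof (rule mult_mono)
      show "cmod (\<xi> + a) * cmod (\<xi> + b) \<le> 4 * r" using 1 by (simp add: r_def power2_eq_square)
      show "cmod (F (Aff \<xi> (tau1 k0 \<xi>)) - F (Aff \<xi> (- tau1 k0 \<xi>))) / (2 * cmod (tau1 k0 \<xi>))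
          \<le> (B + B) / (2 * (3 / 4 * r))"
        using 2 3 r order_trans[OF norm_ge_zero 3] by (intro frac_le) auto
    qed (use r in auto)
    also have "\<dots> = 16 / 3 * B" using r by simp
    finally show "cmod ((\<xi> + a) * (\<xi> + b) * odd_part k0 (on_curve F) \<xi>) \<le> 16 / 3 * B" .
  qed
qed

subsection \<open>Multiplication by Moebius functions of the coordinate\<close>

lemma Sigma_open_over:
  assumes "open N"
  shows "Sigma_open k0 (Sigma_over k0 N)"
proof -
  have 1: "{(\<xi>, \<tau>). Aff \<xi> \<tau> \<in> Sigma_over k0 N} = {(\<xi>, \<tau>). \<tau>^2 = frakp k0 \<xi>} \<inter> N \<times> UNIV"
    by (auto simp: Sigma_over_def)
  have o1: "open (N \<times> (UNIV :: complex set))" using assms by (intro open_Times) auto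
  have 2: "{(u, v). inf_chart u v \<in> Sigma_over k0 N} = {(u, v). v^2 = (1 + u^2) * (1 + of_real k0 ^ 2 * u^2)}
      \<inter> (- {0} \<inter> (\<lambda>u. 1 / u) -` N) \<times> UNIV"
  proof (rule set_eqI, clarify)
    fix u v :: complex
    have "inf_chart u v \<in> Sigma_over k0 N \<longleftrightarrow> inf_chart u v \<in> Sigma_surf k0 \<and> u \<noteq> 0 \<and> 1 / u \<in> N"
      by (auto simp: inf_chart_def Sigma_over_def Sigma_surf_def)
    then show "(u, v) \<in> {(u, v). inf_chart u v \<in> Sigma_over k0 N} \<longleftrightarrow>
        (u, v) \<in> {(u, v). v^2 = (1 + u^2) * (1 + of_real k0 ^ 2 * u^2)} \<inter> (- {0} \<inter> (\<lambda>u. 1 / u) -` N) \<times> UNIV"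
      by (auto simp: inf_chart_in_Sigma)
  qed
  have o2: "open ((- {0} \<inter> (\<lambda>u. 1 / u) -` N) \<times> (UNIV :: complex set))"
    using assms by (intro open_Times continuous_open_preimage continuous_intros) auto
  have sub: "Sigma_over k0 N \<subseteq> Sigma_surf k0" by (auto simp: Sigma_over_def Sigma_surf_def)
  show ?thesis unfolding Sigma_open_def 1 2 by (intro conjI sub openin_open_Int o1 o2)
qed

text \<open>The function \<open>c * (\<xi> + a) / (\<xi> + b)\<close> as a function on the surface, with its value at infinity.\<close>
fun moebius_pt :: "complex \<Rightarrow> complex \<Rightarrow> complex \<Rightarrow> sigma_pt \<Rightarrow> complex" where
  "moebius_pt c a b (Aff \<xi> \<tau>) = c * ((\<xi> + a) / (\<xi> + b))"
| "moebius_pt c a b (Inf s) = c"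

text \<open>
  The pole \<open>\<xi> = - b\<close> lies outside the closed half; without it the function is continuous in both
  charts, in the chart at infinity as \<open>c * (1 + a u) / (1 + b u)\<close>.
\<close>
lemma continuous_map_moebius_pt:
  assumes b: "0 < \<sigma> * Im b"
  shows "continuous_map (subtopology (Sigma_top k0) (closed_over k0 (half \<sigma>))) euclidean (moebius_pt c a b)"
  unfolding continuous_map_def
proof (intro conjI allI impI)
  fix V :: "complex set" assume "openin euclidean V"
  then have V: "open V" by simp
  define A where "A = {\<xi>. \<xi> + b \<noteq> 0} \<inter> (\<lambda>\<xi>. c * ((\<xi> + a) / (\<xi> + b))) -` V"
  define A' where "A' = {u. 1 + b * u \<noteq> 0} \<inter> (\<lambda>u. c * ((1 + a * u) / (1 + b * u))) -` V"
  define T where "T = {P \<in> Sigma_surf k0. moebius_pt c a b P \<in> V \<and> (\<forall>\<tau>. P \<noteq> Aff (- b) \<tau>)}"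
  have "open A"
    unfolding A_def using V by (intro continuous_open_preimage continuous_intros open_Collect_neq) auto
  have "open A'"
    unfolding A'_def using V by (intro continuous_open_preimage continuous_intros open_Collect_neq) auto
  have 1: "{(\<xi>, \<tau>). Aff \<xi> \<tau> \<in> T} = {(\<xi>, \<tau>). \<tau>^2 = frakp k0 \<xi>} \<inter> A \<times> UNIV"
    by (auto simp: T_def A_def Aff_in_Sigma eq_neg_iff_add_eq_0)
  have mu: "moebius_pt c a b (inf_chart u v) \<in> V \<and> (\<forall>\<tau>. inf_chart u v \<noteq> Aff (- b) \<tau>) \<longleftrightarrow> u \<in> A'" for u v
  proof (cases "u = 0")
    case False
    have "1 / u = - b \<longleftrightarrow> 1 + b * u = 0" using False by (simp add: field_simps eq_neg_iff_add_eq_0)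
    moreover have "(1 / u + a) / (1 / u + b) = (1 + a * u) / (1 + b * u)"
    proof -
      have "1 / u + a = (1 + a * u) / u" "1 / u + b = (1 + b * u) / u"
        using False by (simp_all add: add_divide_distrib)
      then show ?thesis using False by simp
    qed
    ultimately show ?thesis using False by (auto simp: inf_chart_def A'_def)
  qed (simp add: inf_chart_def A'_def)
  have 2: "{(u, v). inf_chart u v \<in> T} = {(u, v). v^2 = (1 + u^2) * (1 + of_real k0 ^ 2 * u^2)} \<inter> A' \<times> UNIV"
    unfolding T_def using mu by (auto simp: inf_chart_in_Sigma)
  have "open (A \<times> (UNIV :: complex set))" "open (A' \<times> (UNIV :: complex set))"
    using \<open>open A\<close> \<open>open A'\<close> by (auto intro: open_Times)
  then have "Sigma_open k0 T"
    unfolding Sigma_open_def 1 2 by (auto simp: T_def intro: openin_open_Int)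
  moreover have "{P \<in> topspace (subtopology (Sigma_top k0) (closed_over k0 (half \<sigma>))). moebius_pt c a b P \<in> V}
      = T \<inter> closed_over k0 (half \<sigma>)"
  proof -
    have "Aff (- b) \<tau> \<notin> closed_over k0 (half \<sigma>)" for \<tau>
      using half_add_nonzero[of "- b" \<sigma> b] b unfolding Aff_closed_over by auto
    then show ?thesis unfolding T_def topspace_subtopology topspace_Sigma by blast
  qed
  ultimately show "openin (subtopology (Sigma_top k0) (closed_over k0 (half \<sigma>)))
      {P \<in> topspace (subtopology (Sigma_top k0) (closed_over k0 (half \<sigma>))). moebius_pt c a b P \<in> V}"
    by (simp add: openin_subtopology openin_Sigma_top) blast
qed simp

lemma continuous_map_complex_mult:
  fixes f g :: "'a \<Rightarrow> complex"
  assumes "continuous_map X euclidean f" "continuous_map X euclidean g"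
  shows "continuous_map X euclidean (\<lambda>x. f x * g x)"
proof -
  have "continuous_map X euclidean (\<lambda>x. (f x, g x))"
    using continuous_map_pairedI[OF assms] by (simp add: euclidean_product_topology)
  moreover have "continuous_map euclidean euclidean (\<lambda>p :: complex \<times> complex. fst p * snd p)"
    by (simp add: continuous_map_iff_continuous2 continuous_intros)
  ultimately have "continuous_map X euclidean ((\<lambda>p. fst p * snd p) \<circ> (\<lambda>x. (f x, g x)))"
    by (rule continuous_map_compose)
  then show ?thesis by (simp add: o_def)
qed

text \<open>
  The zeros of \<open>frakp k0\<close> are simple because \<open>k0\<^sup>2 \<noteq> 1\<close>.  So near a branch point \<open>\<xi>\<close> is an analytic
  function of \<open>frakp k0 \<xi> = \<tau>\<^sup>2\<close>.
\<close>
lemma frakp_local_inverse: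
  assumes k0: "1 < k0" and "frakp k0 \<xi>0 = 0"
  obtains N g where "open N" "\<xi>0 \<in> N" "g analytic_on {0}" "\<And>\<xi>. \<xi> \<in> N \<Longrightarrow> g (frakp k0 \<xi>) = \<xi>"
proof -
  have hol: "frakp k0 holomorphic_on UNIV"
    unfolding frakp_def[abs_def] by (intro holomorphic_intros)
  have d: "(frakp k0 has_field_derivative 2 * \<xi>0 * (1 + of_real k0 ^ 2 + 2 * \<xi>0^2)) (at \<xi>0)"
    unfolding frakp_def[abs_def]
    by (rule derivative_eq_intros refl | simp add: algebra_simps power2_eq_square power3_eq_cube)+
  have "2 * \<xi>0 * (1 + of_real k0 ^ 2 + 2 * \<xi>0^2) \<noteq> 0"
  proof -
    have k: "of_real k0 ^ 2 \<noteq> (1::complex)" "of_real k0 ^ 2 \<noteq> (0::complex)"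
      using k0 by (auto simp flip: of_real_power simp: power2_eq_1_iff)
    consider "\<xi>0^2 = -1" | "\<xi>0^2 = - (of_real k0 ^ 2)"
      using assms(2) by (auto simp: frakp_def add_eq_0_iff)
    then show ?thesis using k by cases auto
  qed
  then have "deriv (frakp k0) \<xi>0 \<noteq> 0" using DERIV_imp_deriv[OF d] by simp
  then obtain r where r: "0 < r" "inj_on (frakp k0) (ball \<xi>0 r)" "open (frakp k0 ` ball \<xi>0 r)"
    using has_complex_derivative_locally_invertible[OF hol UNIV_I open_UNIV] by blast
  have hb: "frakp k0 holomorphic_on ball \<xi>0 r" by (rule holomorphic_on_subset[OF hol subset_UNIV])
  obtain g where g: "g holomorphic_on frakp k0 ` ball \<xi>0 r" "\<And>\<xi>. \<xi> \<in> ball \<xi>0 r \<Longrightarrow> g (frakp k0 \<xi>) = \<xi>"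
    using holomorphic_has_inverse[OF hb open_ball r(2)] by metis
  have "0 \<in> frakp k0 ` ball \<xi>0 r" using assms(2) r(1) by (metis centre_in_ball image_eqI)
  then have "g analytic_on {0}" using g(1) r(3) analytic_at by blast
  then show thesis using that[of "ball \<xi>0 r" g] r(1) g(2) by simp
qed

lemma Sigma_analytic_moebius_mult:
  assumes k0: "1 < k0" and b: "0 < \<sigma> * Im b"
    and F: "Sigma_analytic_on k0 (Sigma_over k0 (half \<sigma>)) F"
  shows "Sigma_analytic_on k0 (Sigma_over k0 (half \<sigma>)) (\<lambda>P. moebius_pt c a b P * F P)"
  unfolding Sigma_analytic_on_def
proof
  fix P assume P: "P \<in> Sigma_over k0 (half \<sigma>)"
  from F P have "\<exists>U h. openin (Sigma_top k0) U \<and> P \<in> U \<and> U \<subseteq> Sigma_over k0 (half \<sigma>) \<and>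
      h analytic_on {local_coord P P} \<and> (\<forall>R\<in>U. F R = h (local_coord P R))"
    unfolding Sigma_analytic_on_def by (rule bspec)
  then obtain U h where U: "openin (Sigma_top k0) U" "P \<in> U" "U \<subseteq> Sigma_over k0 (half \<sigma>)"
      "h analytic_on {local_coord P P}" "\<forall>R\<in>U. F R = h (local_coord P R)"
    by (elim exE conjE)
  obtain \<xi>0 \<tau>0 where P0: "P = Aff \<xi>0 \<tau>0" "\<xi>0 \<in> half \<sigma>" "\<tau>0^2 = frakp k0 \<xi>0"
    using P by (auto simp: Sigma_over_def)
  have nz: "\<xi>0 + b \<noteq> 0" using half_add_nonzero[OF _ b] P0(2) by blast
  obtain N \<rho> where N: "open N" "\<xi>0 \<in> N" "\<rho> analytic_on {local_coord P P}"
    "\<And>\<xi> \<tau>. \<xi> \<in> N \<Longrightarrow> \<tau>^2 = frakp k0 \<xi> \<Longrightarrow> \<rho> (local_coord P (Aff \<xi> \<tau>)) = c * ((\<xi> + a) / (\<xi> + b))"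
  proof (cases "\<tau>0 = 0")
    case False
    have "(\<lambda>\<xi>. c * ((\<xi> + a) / (\<xi> + b))) analytic_on {\<xi>0}"
      using nz by (intro analytic_intros) auto
    then show thesis using that[of UNIV "\<lambda>\<xi>. c * ((\<xi> + a) / (\<xi> + b))"] False P0(1) by simp
  next
    \<comment> \<open>At a branch point the coordinate is \<open>\<tau>\<close>, and \<open>\<xi>\<close> is an analytic function of \<open>\<tau>\<^sup>2\<close>.\<close>
    case True
    then have z: "frakp k0 \<xi>0 = 0" using P0(3) by simp
    obtain N g where g: "open N" "\<xi>0 \<in> N" "g analytic_on {0}" "\<And>\<xi>. \<xi> \<in> N \<Longrightarrow> g (frakp k0 \<xi>) = \<xi>"
      using frakp_local_inverse[OF k0 z] by metis
    have g0: "g 0 = \<xi>0" using g(2,4) z by metis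
    have "(g \<circ> (\<lambda>t. t^2)) analytic_on {0}"
      by (rule analytic_on_compose) (use g(3) in \<open>auto intro!: analytic_intros\<close>)
    then have "(\<lambda>t. g (t^2)) analytic_on {0}" by (simp add: o_def)
    then have "(\<lambda>t. c * ((g (t^2) + a) / (g (t^2) + b))) analytic_on {0}"
      using nz g0 by (intro analytic_on_mult analytic_on_divide analytic_on_add analytic_on_const) auto
    then show thesis
      using that[OF g(1,2), of "\<lambda>t. c * ((g (t^2) + a) / (g (t^2) + b))"] True P0(1) g(4) by simp
  qed
  have "openin (Sigma_top k0) (U \<inter> Sigma_over k0 N)"
    using U(1) Sigma_open_over[OF N(1)] by (intro openin_Int) (auto simp: openin_Sigma_top)
  moreover have "P \<in> U \<inter> Sigma_over k0 N" using U(2) N(2) P0 by (auto simp: Sigma_over_def)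
  moreover have "(\<lambda>w. \<rho> w * h w) analytic_on {local_coord P P}"
    using N(3) U(4) by (intro analytic_intros)
  moreover have "moebius_pt c a b R * F R = \<rho> (local_coord P R) * h (local_coord P R)"
    if RN: "R \<in> U \<inter> Sigma_over k0 N" for R
  proof -
    obtain \<xi> \<tau> where R: "R = Aff \<xi> \<tau>" "\<xi> \<in> N" "\<tau>^2 = frakp k0 \<xi>"
      using RN by (auto simp: Sigma_over_def)
    have "F R = h (local_coord P R)" using U(5) RN by blast
    then show ?thesis using N(4)[OF R(2,3)] R(1) by simp
  qed
  ultimately show "\<exists>U h. openin (Sigma_top k0) U \<and> P \<in> U \<and> U \<subseteq> Sigma_over k0 (half \<sigma>) \<and>
      h analytic_on {local_coord P P} \<and> (\<forall>R\<in>U. moebius_pt c a b R * F R = h (local_coord P R))"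
    using U(3) by (intro exI[of _ "U \<inter> Sigma_over k0 N"] exI[of _ "\<lambda>w. \<rho> w * h w"]) blast
qed

text \<open>
  With this lemma the generators of the scalar problem are seen to lie in the required spaces.
\<close>
lemma CG_mu_half_moebius_mult:
  assumes k0: "1 < k0" and \<mu>: "0 < \<mu>" "\<mu> < 1" and \<sigma>: "\<bar>\<sigma>\<bar> = 1" and b: "0 < \<sigma> * Im b"
    and f: "f \<in> CG_mu_half k0 \<mu> (half \<sigma>)"
  shows "(\<lambda>(\<xi>, \<tau>). c * ((\<xi> + a) / (\<xi> + b)) * f (\<xi>, \<tau>)) \<in> CG_mu_half k0 \<mu> (half \<sigma>)"
proof -
  obtain F where fC: "f \<in> CG_mu k0 \<mu>"
    and F: "continuous_map (subtopology (Sigma_top k0) (closed_over k0 (half \<sigma>))) euclidean F"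
      "Sigma_analytic_on k0 (Sigma_over k0 (half \<sigma>)) F" "\<forall>(\<xi>, \<tau>)\<in>Gamma_fin k0. F (Aff \<xi> \<tau>) = f (\<xi>, \<tau>)"
    using f unfolding CG_mu_half_def by blast
  have "Im b \<noteq> 0" using b by auto
  then have "(\<lambda>\<xi>. c * ((\<xi> + a) / (\<xi> + b))) \<in> C_mu \<mu>"
    using C_mu_mult[OF C_mu_const C_mu_moebius] \<mu> by blast
  then have "(\<lambda>(\<xi>, \<tau>). c * ((\<xi> + a) / (\<xi> + b)) * f (\<xi>, \<tau>)) \<in> CG_mu k0 \<mu>"
    using fC \<mu> C_mu_mult[of "\<lambda>\<xi>. c * ((\<xi> + a) / (\<xi> + b))"] by (simp add: CG_mu_def)
  moreover have "\<forall>(\<xi>, \<tau>)\<in>Gamma_fin k0. moebius_pt c a b (Aff \<xi> \<tau>) * F (Aff \<xi> \<tau>)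
      = c * ((\<xi> + a) / (\<xi> + b)) * f (\<xi>, \<tau>)"
    using F(3) by auto
  ultimately show ?thesis
    unfolding CG_mu_half_def
    using continuous_map_complex_mult[OF continuous_map_moebius_pt[OF b] F(1)]
      Sigma_analytic_moebius_mult[OF k0 b F(2)]
    by (auto intro!: exI[of _ "\<lambda>P. moebius_pt c a b P * F P"])
qed

section \<open>Splitting functions on the curve into an even and an odd part\<close>

text \<open>
  The factor of \<open>frakp k0\<close> without zeros on \<open>half \<sigma> \<union> \<real>\<close>: \<open>frakp1\<close> for the upper and \<open>frakp2\<close> for the
  lower half-plane.  It allows both half-planes to be treated at once.
\<close>
definition half_factor :: "real \<Rightarrow> real \<Rightarrow> complex \<Rightarrow> complex" where
  "half_factor k0 \<sigma> \<xi> = (\<xi> + of_real \<sigma> * \<i>) * (\<xi> + of_real \<sigma> * \<i> * of_real k0)"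

lemma abs_1_cases: "\<bar>\<sigma>::real\<bar> = 1 \<Longrightarrow> (\<sigma> = 1 \<Longrightarrow> P) \<Longrightarrow> (\<sigma> = -1 \<Longrightarrow> P) \<Longrightarrow> P"
  by (auto simp: abs_if split: if_splits)

lemma half_factor_1: "half_factor k0 1 \<xi> = frakp1 k0 \<xi>"
  and half_factor_minus_1: "half_factor k0 (-1) \<xi> = frakp2 k0 \<xi>"
  by (simp_all add: half_factor_def frakp1_def frakp2_def)

lemma half_factor_mult: "\<bar>\<sigma>\<bar> = 1 \<Longrightarrow> half_factor k0 \<sigma> \<xi> * half_factor k0 (- \<sigma>) \<xi> = frakp k0 \<xi>"
  by (erule abs_1_cases) (simp_all add: half_factor_def frakp_factor algebra_simps)

lemma frakp1_frakp2: "frakp k0 \<xi> = frakp1 k0 \<xi> * frakp2 k0 \<xi>"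
  by (simp add: frakp1_def frakp2_def frakp_factor algebra_simps)

lemma tau1_real_nonzero: "k0 \<noteq> 0 \<Longrightarrow> \<xi> \<in> \<real> \<Longrightarrow> tau1 k0 \<xi> \<noteq> 0"
  using tau1_square[of k0 \<xi>] frakp_real_nonzero[of k0 \<xi>] by auto

lemma C_mu_cmult: "f \<in> C_mu \<mu> \<Longrightarrow> 0 < \<mu> \<Longrightarrow> (\<lambda>\<xi>. c * f \<xi>) \<in> C_mu \<mu>"
  by (rule C_mu_mult[OF C_mu_const])

text \<open>
  Over the line, \<open>(\<xi>\<^sup>2 + 1) / \<tau>\<close> is the square root of \<open>(\<xi>\<^sup>2 + 1) / (\<xi>\<^sup>2 + k0\<^sup>2)\<close>, a Hoelder function
  with values in \<open>[1 / k0\<^sup>2, 1]\<close>, where the square root is Lipschitz.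
\<close>
lemma C_mu_ratio_tau1:
  assumes k0: "1 < k0" and \<mu>: "0 < \<mu>" "\<mu> < 1"
  shows "(\<lambda>\<xi>. (\<xi>^2 + 1) / tau1 k0 \<xi>) \<in> C_mu \<mu>"
proof -
  define \<rho> where "\<rho> x = sqrt ((1 + x^2) / (k0^2 + x^2))" for x
  define q where "q \<xi> = ((\<xi> + \<i>) / (\<xi> + \<i> * of_real k0)) * ((\<xi> + - \<i>) / (\<xi> + - \<i> * of_real k0))" for \<xi>
  have pos: "0 < 1 + x^2" "0 < k0^2 + x^2" for x using k0 by (auto intro!: add_pos_nonneg)
  have "q \<in> C_mu \<mu>"
    unfolding q_def using k0 \<mu> by (intro C_mu_mult C_mu_moebius) auto
  then obtain C where C: "0 \<le> C"
    "\<And>\<xi> \<eta>. \<xi> \<in> \<real> \<Longrightarrow> \<eta> \<in> \<real> \<Longrightarrow> cmod (q \<xi> - q \<eta>) \<le> C * cmod (cayley \<xi> - cayley \<eta>) powr \<mu>"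
    using C_muE by metis
  have rr: "((of_real x)^2 + 1) / tau1 k0 (of_real x) = of_real (\<rho> x)" for x
  proof -
    have "frakp k0 (of_real x) = of_real ((1 + x^2) * (k0^2 + x^2))" by (simp add: frakp_def)
    then have t: "tau1 k0 (of_real x) = of_real (sqrt ((1 + x^2) * (k0^2 + x^2)))"
      unfolding tau1_def using pos[of x] by (simp only: csqrt_of_real[OF less_imp_le[OF mult_pos_pos]])
    have "(1 + x^2) / sqrt ((1 + x^2) * (k0^2 + x^2)) = \<rho> x"
      unfolding \<rho>_def real_sqrt_mult real_sqrt_divide using pos[of x]
      by (simp add: real_div_sqrt flip: divide_divide_eq_left)
    then show ?thesis unfolding t by (metis add.commute of_real_1 of_real_add of_real_divide of_real_power)
  qed
  have qr: "q (of_real x) = of_real ((\<rho> x)^2)" for x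
  proof -
    have "(of_real x + \<i> * of_real k0) * (of_real x + - \<i> * of_real k0) = (of_real (k0^2 + x^2) :: complex)"
      "(of_real x + \<i>) * (of_real x + - \<i>) = (of_real (1 + x^2) :: complex)"
      by (simp_all add: algebra_simps power2_eq_square)
    then have "q (of_real x) = of_real ((1 + x^2) / (k0^2 + x^2))"
      unfolding q_def times_divide_times_eq by simp
    then show ?thesis using pos[of x] by (simp add: \<rho>_def)
  qed
  \<comment> \<open>\<open>q\<close> is the square \<open>\<rho>\<^sup>2\<close>, and \<open>\<bar>\<rho> x - \<rho> y\<bar> = \<bar>(\<rho> x)\<^sup>2 - (\<rho> y)\<^sup>2\<bar> / (\<rho> x + \<rho> y)\<close>.\<close>
  have low: "1 / k0 \<le> \<rho> x" for x
  proof (rule power2_le_imp_le)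
    have "1 * x^2 \<le> k0^2 * x^2" using k0 by (intro mult_right_mono) auto
    then have "k0^2 + x^2 \<le> (1 + x^2) * k0^2" by (simp add: algebra_simps)
    then show "(1 / k0)^2 \<le> (\<rho> x)^2"
      using pos[of x] k0 by (simp add: \<rho>_def power_divide divide_simps mult_ac)
  qed (use pos[of x] in \<open>simp add: \<rho>_def\<close>)
  show ?thesis
  proof (rule C_muI[of _ "k0 / 2 * C"])
    fix \<xi> \<eta> :: complex assume R: "\<xi> \<in> \<real>" "\<eta> \<in> \<real>"
    then obtain x y where xy: "\<xi> = of_real x" "\<eta> = of_real y" by (metis Reals_cases)
    have "\<bar>\<rho> x - \<rho> y\<bar> * (2 / k0) \<le> \<bar>\<rho> x - \<rho> y\<bar> * \<bar>\<rho> x + \<rho> y\<bar>"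
      using low[of x] low[of y] by (intro mult_left_mono) auto
    also have "\<dots> = \<bar>(\<rho> x)^2 - (\<rho> y)^2\<bar>" by (simp add: power2_eq_square algebra_simps flip: abs_mult)
    also have "\<dots> = cmod (q \<xi> - q \<eta>)" unfolding xy qr by (metis norm_of_real of_real_diff)
    also have "\<dots> \<le> C * cmod (cayley \<xi> - cayley \<eta>) powr \<mu>" by (rule C(2)[OF R])
    finally have "\<bar>\<rho> x - \<rho> y\<bar> \<le> k0 / 2 * C * cmod (cayley \<xi> - cayley \<eta>) powr \<mu>"
      using k0 by (simp add: field_simps)
    then show "cmod ((\<xi>^2 + 1) / tau1 k0 \<xi> - (\<eta>^2 + 1) / tau1 k0 \<eta>) \<le> k0 / 2 * C * cmod (cayley \<xi> - cayley \<eta>) powr \<mu>"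
      unfolding xy rr by (metis norm_of_real of_real_diff)
  qed
qed

text \<open>
  The linear factors of \<open>half_factor k0 \<sigma> \<xi> / \<tau>\<close> are regrouped as a Moebius function times the
  square root from the preceding lemma.
\<close>
lemma C_mu_half_factor_tau1:
  assumes k0: "1 < k0" and \<mu>: "0 < \<mu>" "\<mu> < 1" and \<sigma>: "\<bar>\<sigma>\<bar> = 1"
  shows "(\<lambda>\<xi>. half_factor k0 \<sigma> \<xi> / tau1 k0 \<xi>) \<in> C_mu \<mu>"
proof -
  define b where "b = of_real (- \<sigma>) * \<i>"
  have "(\<lambda>\<xi>. (\<xi> + of_real \<sigma> * \<i> * of_real k0) / (\<xi> + b) * ((\<xi>^2 + 1) / tau1 k0 \<xi>)) \<in> C_mu \<mu>"
    using \<sigma> by (intro C_mu_mult C_mu_moebius C_mu_ratio_tau1 assms) (auto simp: b_def)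
  moreover have "(\<xi> + of_real \<sigma> * \<i> * of_real k0) / (\<xi> + b) * ((\<xi>^2 + 1) / tau1 k0 \<xi>) = half_factor k0 \<sigma> \<xi> / tau1 k0 \<xi>"
    if "\<xi> \<in> \<real>" for \<xi>
  proof -
    have "\<xi> + b \<noteq> 0" using \<sigma> that by (intro Reals_add_nonreal) (auto simp: b_def)
    moreover have "\<xi>^2 + 1 = (\<xi> + of_real \<sigma> * \<i>) * (\<xi> + b)"
      using \<sigma> by (elim abs_1_cases) (simp_all add: b_def algebra_simps power2_eq_square)
    ultimately show ?thesis by (simp add: half_factor_def)
  qed
  ultimately show ?thesis using C_mu_cong by (metis (no_types, lifting))
qed

lemma CG_mu_parts:
  assumes k0: "1 < k0" and \<mu>: "0 < \<mu>" "\<mu> < 1" and \<sigma>: "\<bar>\<sigma>\<bar> = 1" and f: "f \<in> CG_mu k0 \<mu>"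
  shows "even_part k0 f \<in> C_mu \<mu>" "(\<lambda>\<xi>. half_factor k0 \<sigma> \<xi> * odd_part k0 f \<xi>) \<in> C_mu \<mu>"
proof -
  have f1: "(\<lambda>\<xi>. f (\<xi>, tau1 k0 \<xi>)) \<in> C_mu \<mu>" and f2: "(\<lambda>\<xi>. f (\<xi>, - tau1 k0 \<xi>)) \<in> C_mu \<mu>"
    using f by (auto simp: CG_mu_def)
  have "(\<lambda>\<xi>. 1 / 2 * (f (\<xi>, tau1 k0 \<xi>) + f (\<xi>, - tau1 k0 \<xi>))) \<in> C_mu \<mu>"
    by (intro C_mu_cmult C_mu_add f1 f2 \<mu>)
  then show "even_part k0 f \<in> C_mu \<mu>" by (simp add: even_part_def[abs_def] Let_def)
  have "(\<lambda>\<xi>. half_factor k0 \<sigma> \<xi> / tau1 k0 \<xi> * (1 / 2 * (f (\<xi>, tau1 k0 \<xi>) + (- 1) * f (\<xi>, - tau1 k0 \<xi>)))) \<in> C_mu \<mu>"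
    by (intro C_mu_mult[OF C_mu_half_factor_tau1] C_mu_cmult C_mu_add f1 f2 assms)
  then show "(\<lambda>\<xi>. half_factor k0 \<sigma> \<xi> * odd_part k0 f \<xi>) \<in> C_mu \<mu>"
    by (simp add: odd_part_def[abs_def] Let_def mult_ac)
qed

lemma Gamma_fin_tau1: "\<xi> \<in> \<real> \<Longrightarrow> (\<xi>, tau1 k0 \<xi>) \<in> Gamma_fin k0" "\<xi> \<in> \<real> \<Longrightarrow> (\<xi>, - tau1 k0 \<xi>) \<in> Gamma_fin k0"
  by (simp_all add: Gamma_fin_def tau1_square)

lemma Gamma_fin_cases:
  assumes "(\<xi>, \<tau>) \<in> Gamma_fin k0"
  shows "\<xi> \<in> \<real>" "\<tau> = tau1 k0 \<xi> \<or> \<tau> = - tau1 k0 \<xi>" "\<tau>^2 = frakp k0 \<xi>"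
  using assms root_cases by (auto simp: Gamma_fin_def)

lemma parts_cong:
  assumes "\<And>\<xi> \<tau>. (\<xi>, \<tau>) \<in> Gamma_fin k0 \<Longrightarrow> f (\<xi>, \<tau>) = g (\<xi>, \<tau>)" "\<xi> \<in> \<real>"
  shows "even_part k0 f \<xi> = even_part k0 g \<xi>" "odd_part k0 f \<xi> = odd_part k0 g \<xi>"
  using assms Gamma_fin_tau1[OF assms(2)] by (simp_all add: even_part_def odd_part_def Let_def)

lemma even_odd_decomposition:
  assumes "k0 \<noteq> 0" "(\<xi>, \<tau>) \<in> Gamma_fin k0"
  shows "f (\<xi>, \<tau>) = even_part k0 f \<xi> + \<tau> * odd_part k0 f \<xi>"
proof -
  have "\<tau> \<noteq> 0" using Gamma_fin_cases[OF assms(2)] tau1_real_nonzero[OF assms(1)] by auto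
  then show ?thesis
    using Gamma_fin_cases(3)[OF assms(2)] by (simp add: even_part_root odd_part_root field_simps)
qed

lemma parts_mult:
  assumes "k0 \<noteq> 0" "\<xi> \<in> \<real>"
  shows "even_part k0 (\<lambda>P. f P * g P) \<xi>
      = even_part k0 f \<xi> * even_part k0 g \<xi> + frakp k0 \<xi> * (odd_part k0 f \<xi> * odd_part k0 g \<xi>)"
    "odd_part k0 (\<lambda>P. f P * g P) \<xi> = even_part k0 f \<xi> * odd_part k0 g \<xi> + odd_part k0 f \<xi> * even_part k0 g \<xi>"
  using tau1_real_nonzero[OF assms] unfolding tau1_square[symmetric]
  by (simp_all add: even_part_def odd_part_def Let_def field_simps power2_eq_square)

lemma parts_coordinate_mult:
  "even_part k0 (\<lambda>(\<xi>, \<tau>). r \<xi> * f (\<xi>, \<tau>)) \<xi> = r \<xi> * even_part k0 f \<xi>"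
  "odd_part k0 (\<lambda>(\<xi>, \<tau>). r \<xi> * f (\<xi>, \<tau>)) \<xi> = r \<xi> * odd_part k0 f \<xi>"
  by (simp_all add: even_part_def odd_part_def Let_def ring_distribs diff_divide_distrib right_diff_distrib)

lemma parts_of_sum:
  assumes "k0 \<noteq> 0" "\<xi> \<in> \<real>"
  shows "even_part k0 (\<lambda>(\<xi>, \<tau>). a \<xi> + \<tau> / p \<xi> * b \<xi>) \<xi> = a \<xi>"
    "odd_part k0 (\<lambda>(\<xi>, \<tau>). a \<xi> + \<tau> / p \<xi> * b \<xi>) \<xi> = b \<xi> / p \<xi>"
  using tau1_real_nonzero[OF assms] by (simp_all add: even_part_def odd_part_def Let_def field_simps)

text \<open>
  The functions on the preimage of the line that come from a bounded function on the half of the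
  surface over \<open>half \<sigma>\<close>, expressed through their parts.  Boundary values are required only almost
  everywhere.  The odd part is multiplied by \<open>half_factor\<close>, which grows at infinity like \<open>\<tau>\<close> and
  has no zero on the half-plane: this makes the class closed under products.
\<close>
definition CG_Hinf :: "real \<Rightarrow> real \<Rightarrow> real \<Rightarrow> (complex \<times> complex \<Rightarrow> complex) set" where
  "CG_Hinf k0 \<mu> \<sigma> = {f \<in> CG_mu k0 \<mu>. even_part k0 f \<in> H_infty (half \<sigma>) \<and>
     (\<lambda>\<xi>. half_factor k0 \<sigma> \<xi> * odd_part k0 f \<xi>) \<in> H_infty (half \<sigma>)}"

lemma CG_mu_cong:
  assumes "\<And>\<xi> \<tau>. (\<xi>, \<tau>) \<in> Gamma_fin k0 \<Longrightarrow> f (\<xi>, \<tau>) = g (\<xi>, \<tau>)"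
  shows "f \<in> CG_mu k0 \<mu> \<longleftrightarrow> g \<in> CG_mu k0 \<mu>"
  unfolding CG_mu_def mem_Collect_eq
  by (intro arg_cong2[where f = "(\<and>)"] C_mu_cong assms Gamma_fin_tau1)

lemma CG_Hinf_cong:
  assumes "\<And>\<xi> \<tau>. (\<xi>, \<tau>) \<in> Gamma_fin k0 \<Longrightarrow> f (\<xi>, \<tau>) = g (\<xi>, \<tau>)"
  shows "f \<in> CG_Hinf k0 \<mu> \<sigma> \<longleftrightarrow> g \<in> CG_Hinf k0 \<mu> \<sigma>"
  unfolding CG_Hinf_def mem_Collect_eq
  by (intro arg_cong2[where f = "(\<and>)"] CG_mu_cong H_infty_cong assms arg_cong2[where f = "(*)"] parts_cong refl)

lemma CG_mu_half_cong:
  assumes "\<And>\<xi> \<tau>. (\<xi>, \<tau>) \<in> Gamma_fin k0 \<Longrightarrow> f (\<xi>, \<tau>) = g (\<xi>, \<tau>)"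
  shows "f \<in> CG_mu_half k0 \<mu> H \<longleftrightarrow> g \<in> CG_mu_half k0 \<mu> H"
proof -
  have "(\<forall>(\<xi>, \<tau>)\<in>Gamma_fin k0. F (Aff \<xi> \<tau>) = f (\<xi>, \<tau>)) \<longleftrightarrow> (\<forall>(\<xi>, \<tau>)\<in>Gamma_fin k0. F (Aff \<xi> \<tau>) = g (\<xi>, \<tau>))" for F
    using assms by auto
  moreover have "f \<in> CG_mu k0 \<mu> \<longleftrightarrow> g \<in> CG_mu k0 \<mu>" by (rule CG_mu_cong) (rule assms)
  ultimately show ?thesis unfolding CG_mu_half_def mem_Collect_eq by simp
qed

lemma CG_mu_half_subset_Hinf:
  assumes k0: "1 < k0" and \<sigma>: "\<bar>\<sigma>\<bar> = 1" and f: "f \<in> CG_mu_half k0 \<mu> (half \<sigma>)"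
  shows "f \<in> CG_Hinf k0 \<mu> \<sigma>"
proof -
  obtain F where fC: "f \<in> CG_mu k0 \<mu>"
    and F: "continuous_map (subtopology (Sigma_top k0) (closed_over k0 (half \<sigma>))) euclidean F"
      "Sigma_analytic_on k0 (Sigma_over k0 (half \<sigma>)) F" "\<forall>(\<xi>, \<tau>)\<in>Gamma_fin k0. F (Aff \<xi> \<tau>) = f (\<xi>, \<tau>)"
    using f unfolding CG_mu_half_def by blast
  have "on_curve F \<in> CG_mu k0 \<mu> \<longleftrightarrow> f \<in> CG_mu k0 \<mu>" by (rule CG_mu_cong) (use F(3) in auto)
  then have "on_curve F \<in> CG_Hinf k0 \<mu> \<sigma>"
    unfolding CG_Hinf_def half_factor_def using parts_H_infty[OF k0 \<sigma> F(1,2)] fC by auto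
  moreover have "on_curve F \<in> CG_Hinf k0 \<mu> \<sigma> \<longleftrightarrow> f \<in> CG_Hinf k0 \<mu> \<sigma>"
    by (rule CG_Hinf_cong) (use F(3) in auto)
  ultimately show ?thesis by simp
qed

lemma CG_mu_mult:
  assumes "f \<in> CG_mu k0 \<mu>" "g \<in> CG_mu k0 \<mu>" "0 < \<mu>"
  shows "(\<lambda>P. f P * g P) \<in> CG_mu k0 \<mu>"
  using assms by (auto simp: CG_mu_def intro: C_mu_mult)

text \<open>
  In the even part of a product, \<open>\<tau>\<^sup>2\<close> times the product of the odd parts appears.  Divided by the square
  of \<open>half_factor k0 \<sigma>\<close>, \<open>\<tau>\<^sup>2\<close> becomes \<open>half_factor k0 (- \<sigma>) / half_factor k0 \<sigma>\<close>, which is bounded and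
  holomorphic on the half-plane.
\<close>
lemma CG_Hinf_mult:
  assumes k0: "1 < k0" and \<mu>: "0 < \<mu>" and \<sigma>: "\<bar>\<sigma>\<bar> = 1"
    and f: "f \<in> CG_Hinf k0 \<mu> \<sigma>" and g: "g \<in> CG_Hinf k0 \<mu> \<sigma>"
  shows "(\<lambda>P. f P * g P) \<in> CG_Hinf k0 \<mu> \<sigma>"
proof -
  let ?p = "half_factor k0 \<sigma>"
  define b where "b = of_real \<sigma> * \<i>"
  define b' where "b' = of_real \<sigma> * \<i> * of_real k0"
  have s1: "0 < \<sigma> * Im b" "0 < \<sigma> * Im b'"
    using \<sigma> k0 by (auto simp: b_def b'_def elim: abs_1_cases)
  have F: "even_part k0 f \<in> H_infty (half \<sigma>)" "(\<lambda>\<xi>. ?p \<xi> * odd_part k0 f \<xi>) \<in> H_infty (half \<sigma>)"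
    and G: "even_part k0 g \<in> H_infty (half \<sigma>)" "(\<lambda>\<xi>. ?p \<xi> * odd_part k0 g \<xi>) \<in> H_infty (half \<sigma>)"
    using f g by (auto simp: CG_Hinf_def)
  have "(\<lambda>\<xi>. even_part k0 f \<xi> * even_part k0 g \<xi> + (\<xi> + - b) / (\<xi> + b) * ((\<xi> + - b') / (\<xi> + b')) *
      ((?p \<xi> * odd_part k0 f \<xi>) * (?p \<xi> * odd_part k0 g \<xi>))) \<in> H_infty (half \<sigma>)"
    by (intro H_infty_add H_infty_mult H_infty_moebius F G s1 \<sigma>)
  also have "?this \<longleftrightarrow> even_part k0 (\<lambda>P. f P * g P) \<in> H_infty (half \<sigma>)"
  proof (rule H_infty_cong)
    fix \<xi> :: complex assume \<xi>: "\<xi> \<in> \<real>"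
    have nz: "\<xi> + b \<noteq> 0" "\<xi> + b' \<noteq> 0" using half_add_nonzero[of \<xi>] \<xi> s1 by auto
    have p: "?p \<xi> = (\<xi> + b) * (\<xi> + b')" by (simp add: half_factor_def b_def b'_def)
    have "half_factor k0 (- \<sigma>) \<xi> = (\<xi> + - b) * (\<xi> + - b')" by (simp add: half_factor_def b_def b'_def)
    then have fr: "frakp k0 \<xi> = ((\<xi> + b) * (\<xi> + b')) * ((\<xi> + - b) * (\<xi> + - b'))"
      using half_factor_mult[OF \<sigma>, of k0 \<xi>] p by simp
    have "(\<xi> + - b) / (\<xi> + b) * ((\<xi> + - b') / (\<xi> + b')) * ((?p \<xi> * x) * (?p \<xi> * y)) = frakp k0 \<xi> * (x * y)" for x y
      unfolding p fr using nz by (simp add: divide_simps)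
    then show "even_part k0 f \<xi> * even_part k0 g \<xi> + (\<xi> + - b) / (\<xi> + b) * ((\<xi> + - b') / (\<xi> + b')) *
      ((?p \<xi> * odd_part k0 f \<xi>) * (?p \<xi> * odd_part k0 g \<xi>)) = even_part k0 (\<lambda>P. f P * g P) \<xi>"
      using parts_mult(1)[of k0 \<xi> f g] k0 \<xi> by simp
  qed
  finally have 1: "even_part k0 (\<lambda>P. f P * g P) \<in> H_infty (half \<sigma>)" .
  have "(\<lambda>\<xi>. even_part k0 f \<xi> * (?p \<xi> * odd_part k0 g \<xi>) + (?p \<xi> * odd_part k0 f \<xi>) * even_part k0 g \<xi>) \<in> H_infty (half \<sigma>)"
    by (intro H_infty_add H_infty_mult F G)
  also have "?this \<longleftrightarrow> (\<lambda>\<xi>. ?p \<xi> * odd_part k0 (\<lambda>P. f P * g P) \<xi>) \<in> H_infty (half \<sigma>)"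
    using k0 by (intro H_infty_cong) (simp add: parts_mult(2) algebra_simps)
  finally have 2: "(\<lambda>\<xi>. ?p \<xi> * odd_part k0 (\<lambda>P. f P * g P) \<xi>) \<in> H_infty (half \<sigma>)" .
  show ?thesis using 1 2 f g CG_mu_mult \<mu> by (auto simp: CG_Hinf_def)
qed

text \<open>
  A pair of functions of \<open>\<xi>\<close>, such as the components of a solution of the vector problem, gives a
  function on the curve.
\<close>
lemma CG_Hinf_of_sum:
  assumes k0: "1 < k0" and \<mu>: "0 < \<mu>" "\<mu> < 1" and \<sigma>: "\<bar>\<sigma>\<bar> = 1"
    and a: "a \<in> C_mu \<mu> \<inter> H_infty (half \<sigma>)" and b: "b \<in> C_mu \<mu> \<inter> H_infty (half \<sigma>)"
  shows "(\<lambda>(\<xi>, \<tau>). a \<xi> + \<tau> / half_factor k0 \<sigma> \<xi> * b \<xi>) \<in> CG_Hinf k0 \<mu> \<sigma>"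
proof -
  let ?p = "half_factor k0 \<sigma>"
  have k0': "k0 \<noteq> 0" using k0 by simp
  have pnz: "?p \<xi> \<noteq> 0" if "\<xi> \<in> \<real>" for \<xi>
    using frakp_real_nonzero[OF k0' that] half_factor_mult[OF \<sigma>, of k0 \<xi>] by auto
  have t: "tau1 k0 \<xi> / ?p \<xi> = half_factor k0 (- \<sigma>) \<xi> / tau1 k0 \<xi>" if "\<xi> \<in> \<real>" for \<xi>
    using pnz[OF that] tau1_real_nonzero[OF k0' that] half_factor_mult[OF \<sigma>, of k0 \<xi>] tau1_square[of k0 \<xi>]
    by (simp add: field_simps power2_eq_square)
  have H: "(\<lambda>\<xi>. half_factor k0 (- \<sigma>) \<xi> / tau1 k0 \<xi>) \<in> C_mu \<mu>"
    using C_mu_half_factor_tau1[OF k0 \<mu>, of "- \<sigma>"] \<sigma> by simp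
  have "(\<lambda>\<xi>. a \<xi> + half_factor k0 (- \<sigma>) \<xi> / tau1 k0 \<xi> * b \<xi>) \<in> C_mu \<mu>"
    using a b by (intro C_mu_add C_mu_mult H \<mu>) auto
  also have "?this \<longleftrightarrow> (\<lambda>\<xi>. a \<xi> + tau1 k0 \<xi> / ?p \<xi> * b \<xi>) \<in> C_mu \<mu>"
    by (intro C_mu_cong) (simp add: t)
  finally have 1: "(\<lambda>\<xi>. a \<xi> + tau1 k0 \<xi> / ?p \<xi> * b \<xi>) \<in> C_mu \<mu>" .
  have "(\<lambda>\<xi>. a \<xi> + (- 1) * (half_factor k0 (- \<sigma>) \<xi> / tau1 k0 \<xi> * b \<xi>)) \<in> C_mu \<mu>"
    using a b by (intro C_mu_add C_mu_cmult C_mu_mult H \<mu>) auto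
  also have "?this \<longleftrightarrow> (\<lambda>\<xi>. a \<xi> + - tau1 k0 \<xi> / ?p \<xi> * b \<xi>) \<in> C_mu \<mu>"
    by (intro C_mu_cong) (simp add: t)
  finally have 2: "(\<lambda>\<xi>. a \<xi> + - tau1 k0 \<xi> / ?p \<xi> * b \<xi>) \<in> C_mu \<mu>" .
  have "even_part k0 (\<lambda>(\<xi>, \<tau>). a \<xi> + \<tau> / ?p \<xi> * b \<xi>) \<in> H_infty (half \<sigma>) \<longleftrightarrow> a \<in> H_infty (half \<sigma>)"
    by (intro H_infty_cong parts_of_sum(1) k0')
  moreover have "(\<lambda>\<xi>. ?p \<xi> * odd_part k0 (\<lambda>(\<xi>, \<tau>). a \<xi> + \<tau> / ?p \<xi> * b \<xi>) \<xi>) \<in> H_infty (half \<sigma>) \<longleftrightarrow> b \<in> H_infty (half \<sigma>)"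
    by (intro H_infty_cong, subst parts_of_sum(2)[OF k0']) (auto simp: pnz)
  ultimately show ?thesis using 1 2 a b by (simp add: CG_Hinf_def CG_mu_def)
qed

lemma CG_Hinf_moebius:
  assumes "1 < k0" "0 < \<mu>" "\<mu> < 1" "\<bar>\<sigma>\<bar> = 1" "0 < \<sigma> * Im b"
  shows "(\<lambda>(\<xi>, \<tau>). (\<xi> + a) / (\<xi> + b)) \<in> CG_Hinf k0 \<mu> \<sigma>"
proof -
  have "Im b \<noteq> 0" using assms(5) by auto
  then show ?thesis
    using CG_Hinf_of_sum[OF assms(1-4), of "\<lambda>\<xi>. (\<xi> + a) / (\<xi> + b)" "\<lambda>_. 0"]
      C_mu_moebius H_infty_moebius C_mu_const H_infty_const assms by simp
qed

text \<open>
  Each factor is \<open>1 / (\<xi> + b) = (\<xi> + (b + 1)) / (\<xi> + b) - 1\<close>, a Moebius function up to a constant.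
\<close>
lemma half_factor_inverse:
  assumes k0: "1 < k0" and \<mu>: "0 < \<mu>" "\<mu> < 1" and \<sigma>: "\<bar>\<sigma>\<bar> = 1"
  shows "(\<lambda>\<xi>. 1 / half_factor k0 \<sigma> \<xi>) \<in> C_mu \<mu> \<inter> H_infty (half \<sigma>)"
proof -
  have r: "(\<lambda>\<xi>. 1 / (\<xi> + b)) \<in> C_mu \<mu> \<inter> H_infty (half \<sigma>)" if b: "0 < \<sigma> * Im b" for b
  proof -
    have "Im b \<noteq> 0" using b by auto
    then have "(\<lambda>\<xi>. (\<xi> + (b + 1)) / (\<xi> + b) + - 1) \<in> C_mu \<mu> \<inter> H_infty (half \<sigma>)"
      by (intro IntI C_mu_add C_mu_moebius C_mu_const H_infty_add H_infty_moebius H_infty_const b \<mu> \<sigma>)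
    moreover have "(\<xi> + (b + 1)) / (\<xi> + b) + - 1 = 1 / (\<xi> + b)" if "\<xi> \<in> \<real>" for \<xi>
      using half_add_nonzero[of \<xi> \<sigma> b] b that by (simp add: field_simps)
    ultimately show ?thesis
      using C_mu_cong[of "\<lambda>\<xi>. (\<xi> + (b + 1)) / (\<xi> + b) + - 1" "\<lambda>\<xi>. 1 / (\<xi> + b)"]
        H_infty_cong[of "\<lambda>\<xi>. (\<xi> + (b + 1)) / (\<xi> + b) + - 1" "\<lambda>\<xi>. 1 / (\<xi> + b)"] by blast
  qed
  have s: "0 < \<sigma> * Im (of_real \<sigma> * \<i>)" "0 < \<sigma> * Im (of_real \<sigma> * \<i> * of_real k0)"
    using \<sigma> k0 by (auto elim: abs_1_cases)
  have "(\<lambda>\<xi>. 1 / (\<xi> + of_real \<sigma> * \<i>) * (1 / (\<xi> + of_real \<sigma> * \<i> * of_real k0))) \<in> C_mu \<mu> \<inter> H_infty (half \<sigma>)"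
    using r[OF s(1)] r[OF s(2)] \<mu> by (intro IntI C_mu_mult H_infty_mult) auto
  then show ?thesis by (simp add: half_factor_def)
qed

text \<open>
  Both parts have bounded holomorphic extensions to both half-planes, so they are constant; the odd
  part decays at infinity and is therefore zero.
\<close>
theorem Liouville_curve:
  assumes k0: "1 < k0" and \<mu>: "0 < \<mu>" "\<mu> < 1"
    and p: "f \<in> CG_Hinf k0 \<mu> 1" and m: "f \<in> CG_Hinf k0 \<mu> (-1)"
  obtains c where "\<And>\<xi> \<tau>. (\<xi>, \<tau>) \<in> Gamma_fin k0 \<Longrightarrow> f (\<xi>, \<tau>) = c"
proof -
  have k0': "k0 \<noteq> 0" using k0 by simp
  have fC: "f \<in> CG_mu k0 \<mu>" using p by (simp add: CG_Hinf_def)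
  obtain c where c: "\<And>\<xi>. \<xi> \<in> \<real> \<Longrightarrow> even_part k0 f \<xi> = c"
    using Liouville_C_mu[OF CG_mu_parts(1)[OF k0 \<mu> _ fC, of 1] \<mu>(1)] p m by (auto simp: CG_Hinf_def)
  have odd: "odd_part k0 f \<in> C_mu \<mu> \<inter> H_infty (half \<sigma>)" if f: "f \<in> CG_Hinf k0 \<mu> \<sigma>" and \<sigma>: "\<bar>\<sigma>\<bar> = 1" for \<sigma>
  proof -
    have "(\<lambda>\<xi>. 1 / half_factor k0 \<sigma> \<xi> * (half_factor k0 \<sigma> \<xi> * odd_part k0 f \<xi>)) \<in> C_mu \<mu> \<inter> H_infty (half \<sigma>)"
      using C_mu_mult[OF _ CG_mu_parts(2)[OF k0 \<mu> \<sigma> fC] \<mu>(1)] H_infty_mult half_factor_inverse[OF k0 \<mu> \<sigma>] f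
      unfolding CG_Hinf_def by blast
    moreover have "1 / half_factor k0 \<sigma> \<xi> * (half_factor k0 \<sigma> \<xi> * odd_part k0 f \<xi>) = odd_part k0 f \<xi>"
      if "\<xi> \<in> \<real>" for \<xi>
      using frakp_real_nonzero[OF k0' that] half_factor_mult[OF \<sigma>, of k0 \<xi>] by auto
    ultimately show ?thesis
      using C_mu_cong[of "\<lambda>\<xi>. 1 / half_factor k0 \<sigma> \<xi> * (half_factor k0 \<sigma> \<xi> * odd_part k0 f \<xi>)" "odd_part k0 f"]
        H_infty_cong[of "\<lambda>\<xi>. 1 / half_factor k0 \<sigma> \<xi> * (half_factor k0 \<sigma> \<xi> * odd_part k0 f \<xi>)" "odd_part k0 f"]
      by blast
  qed
  obtain d where d: "\<And>\<xi>. \<xi> \<in> \<real> \<Longrightarrow> odd_part k0 f \<xi> = d"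
    using Liouville_C_mu[of "odd_part k0 f" \<mu>] odd[OF p] odd[OF m] \<mu> by auto
  \<comment> \<open>The constant \<open>d\<close> vanishes because its product with a quadratic polynomial is bounded on the line.\<close>
  have "d = 0"
  proof (rule ccontr)
    assume "d \<noteq> 0"
    obtain B where B: "0 \<le> B" "\<And>\<xi>. \<xi> \<in> \<real> \<Longrightarrow> cmod (half_factor k0 1 \<xi> * odd_part k0 f \<xi>) \<le> B"
      using C_mu_bounded[OF CG_mu_parts(2)[OF k0 \<mu> _ fC, of 1] \<mu>(1)] by auto
    \<comment> \<open>At \<open>x\<close> the polynomial has modulus at least \<open>x\<^sup>2\<close>, and \<open>x\<^sup>2 * cmod d\<close> exceeds the bound \<open>B\<close>.\<close>
    define x where "x = 1 + B / cmod d"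
    have x: "1 \<le> x" using B(1) by (simp add: x_def)
    have "x \<le> cmod (of_real x + \<i>)" "x \<le> cmod (of_real x + \<i> * of_real k0)"
      using complex_Re_le_cmod[of "of_real x + \<i>"] complex_Re_le_cmod[of "of_real x + \<i> * of_real k0"] by simp_all
    then have "x * x \<le> cmod (half_factor k0 1 (of_real x))"
      unfolding half_factor_def norm_mult using x by (intro mult_mono) simp_all
    moreover have "x \<le> x * x" using x by simp
    ultimately have "x * cmod d \<le> cmod (half_factor k0 1 (of_real x)) * cmod d"
      by (intro mult_right_mono) auto
    also have "\<dots> \<le> B" using B(2)[of "of_real x"] d[of "of_real x"] by (simp add: norm_mult)
    finally show False using \<open>d \<noteq> 0\<close> by (simp add: x_def ring_distribs)
  qed
  then show thesis
    using that[of c] even_odd_decomposition[OF k0', of _ _ f] c d Gamma_fin_cases(1) by fastforce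
qed

section \<open>The two Riemann--Hilbert problems\<close>

text \<open>
  Two entries of \<open>G\<^sup>T Q G = det G Q\<close>, together with the definition of the determinant \<open>D\<close>, give
  \<open>a D = d D\<close> and \<open>c D = q b D\<close> for the entries \<open>a, b, c, d\<close> of \<open>G\<close>; and \<open>D \<noteq> 0\<close>.
\<close>
lemma C_Q_entries:
  assumes G: "G \<in> C_Q k0 \<mu>" and k0: "k0 \<noteq> 0" and \<xi>: "\<xi> \<in> \<real>"
  shows "G \<xi> $ 2 $ 2 = G \<xi> $ 1 $ 1" "G \<xi> $ 2 $ 1 = frakp1 k0 \<xi> / frakp2 k0 \<xi> * G \<xi> $ 1 $ 2"
proof -
  define q where "q = frakp1 k0 \<xi> / frakp2 k0 \<xi>"
  have q: "q \<noteq> 0" using frakp_real_nonzero[OF k0 \<xi>] by (simp add: q_def frakp1_frakp2)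
  define a b c d where "a = G \<xi> $ 1 $ 1" "b = G \<xi> $ 1 $ 2" "c = G \<xi> $ 2 $ 1" "d = G \<xi> $ 2 $ 2"
  define D where "D = a * d - b * c"
  have det: "det (G \<xi>) = D" by (simp add: det_2 D_def a_b_c_d_def)
  obtain M where "G \<xi> ** M = mat 1" using G \<xi> unfolding C_Q_def by blast
  then have "det (G \<xi>) * det M = 1" by (metis det_I det_mul)
  then have D0: "D \<noteq> 0" using det by auto
  have eq: "transpose (G \<xi>) ** Q_mat k0 \<xi> ** G \<xi> = mat D ** Q_mat k0 \<xi>"
    using G \<xi> det unfolding C_Q_def by auto
  have e12: "c * d = q * a * b"
    using arg_cong[OF eq, of "\<lambda>M. M $ 1 $ 2"]
    by (simp add: matrix_matrix_mult_def transpose_def sum_2 Q_mat_def mat_def a_b_c_d_def q_def mult_ac add_eq_0_iff2)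
  have e22: "d * d - q * b * b = D"
    using arg_cong[OF eq, of "\<lambda>M. M $ 2 $ 2"]
    by (simp add: matrix_matrix_mult_def transpose_def sum_2 Q_mat_def mat_def a_b_c_d_def q_def algebra_simps)
  have "a * D = d * D" using e12 e22 unfolding D_def by algebra
  then show "G \<xi> $ 2 $ 2 = G \<xi> $ 1 $ 1" using D0 by (simp add: a_b_c_d_def)
  have "c * D = q * b * D" using e12 e22 unfolding D_def by algebra
  then have "c = q * b" using D0 by simp
  then show "G \<xi> $ 2 $ 1 = frakp1 k0 \<xi> / frakp2 k0 \<xi> * G \<xi> $ 1 $ 2"
    by (simp only: a_b_c_d_def q_def)
qed

text \<open>
  Since \<open>\<tau>\<^sup>2 = frakp1 k0 \<xi> * frakp2 k0 \<xi>\<close>, multiplying by the symbol acts on the pair of an even and an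
  odd part as multiplying by the matrix, so the vector equation on the line and the scalar equation on
  the curve are the same.
\<close>
lemma vector_equation_iff_symbol:
  assumes G: "G \<in> C_Q k0 \<mu>" and k0: "k0 \<noteq> 0" and \<xi>: "\<xi> \<in> \<real>"
  shows "G \<xi> *v v = w \<longleftrightarrow> (\<forall>\<tau>. \<tau>^2 = frakp k0 \<xi> \<longrightarrow>
    Sigma_symbol k0 G (\<xi>, \<tau>) * (v $ 1 + \<tau> / frakp1 k0 \<xi> * v $ 2) = \<tau> / frakp1 k0 \<xi> * (w $ 2 + \<tau> / frakp2 k0 \<xi> * w $ 1))"
proof -
  define X where "X = G \<xi> *v v"
  have X: "X $ 1 = G \<xi> $ 1 $ 1 * v $ 1 + G \<xi> $ 1 $ 2 * v $ 2"
    "X $ 2 = frakp1 k0 \<xi> / frakp2 k0 \<xi> * G \<xi> $ 1 $ 2 * v $ 1 + G \<xi> $ 1 $ 1 * v $ 2"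
    using C_Q_entries[OF assms] by (simp_all add: X_def matrix_vector_mult_def sum_2)
  have nz: "frakp1 k0 \<xi> \<noteq> 0" "frakp2 k0 \<xi> \<noteq> 0" "tau1 k0 \<xi> \<noteq> 0"
    using frakp_real_nonzero[OF k0 \<xi>] tau1_real_nonzero[OF k0 \<xi>] by (auto simp: frakp1_frakp2)
  have e: "Sigma_symbol k0 G (\<xi>, \<tau>) * (v $ 1 + \<tau> / frakp1 k0 \<xi> * v $ 2) = X $ 1 + \<tau> / frakp1 k0 \<xi> * X $ 2"
    "\<tau> / frakp1 k0 \<xi> * (w $ 2 + \<tau> / frakp2 k0 \<xi> * w $ 1) = w $ 1 + \<tau> / frakp1 k0 \<xi> * w $ 2"
    if "\<tau>^2 = frakp k0 \<xi>" for \<tau>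
  proof -
    have s: "\<tau> / frakp2 k0 \<xi> * (\<tau> / frakp1 k0 \<xi>) = 1"
      using that nz by (simp add: frakp1_frakp2 power2_eq_square)
    have s': "\<tau> / frakp1 k0 \<xi> * (frakp1 k0 \<xi> / frakp2 k0 \<xi>) = \<tau> / frakp2 k0 \<xi>" using nz by simp
    define t where "t = \<tau> / frakp1 k0 \<xi>"
    define u where "u = \<tau> / frakp2 k0 \<xi>"
    define q where "q = frakp1 k0 \<xi> / frakp2 k0 \<xi>"
    have tu: "u * t = 1" "t * q = u" using s s' by (simp_all add: t_def u_def q_def)
    show "Sigma_symbol k0 G (\<xi>, \<tau>) * (v $ 1 + \<tau> / frakp1 k0 \<xi> * v $ 2) = X $ 1 + \<tau> / frakp1 k0 \<xi> * X $ 2"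
      unfolding X Sigma_symbol_def split_conv t_def[symmetric] u_def[symmetric] q_def[symmetric]
      using tu by algebra
    show "\<tau> / frakp1 k0 \<xi> * (w $ 2 + \<tau> / frakp2 k0 \<xi> * w $ 1) = w $ 1 + \<tau> / frakp1 k0 \<xi> * w $ 2"
      unfolding t_def[symmetric] u_def[symmetric] using tu by algebra
  qed
  have "X = w \<longleftrightarrow> (\<forall>\<tau>. \<tau>^2 = frakp k0 \<xi> \<longrightarrow> X $ 1 + \<tau> / frakp1 k0 \<xi> * X $ 2 = w $ 1 + \<tau> / frakp1 k0 \<xi> * w $ 2)"
  proof
    assume *: "\<forall>\<tau>. \<tau>^2 = frakp k0 \<xi> \<longrightarrow> X $ 1 + \<tau> / frakp1 k0 \<xi> * X $ 2 = w $ 1 + \<tau> / frakp1 k0 \<xi> * w $ 2"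
    define t where "t = tau1 k0 \<xi> / frakp1 k0 \<xi>"
    have t: "t \<noteq> 0" using nz by (simp add: t_def)
    have 1: "X $ 1 + t * X $ 2 = w $ 1 + t * w $ 2" "X $ 1 - t * X $ 2 = w $ 1 - t * w $ 2"
      using *[rule_format, of "tau1 k0 \<xi>"] *[rule_format, of "- tau1 k0 \<xi>"] by (simp_all add: tau1_square t_def)
    then have "2 * X $ 1 = 2 * w $ 1" "2 * (t * X $ 2) = 2 * (t * w $ 2)" by algebra+
    then have "X $ 1 = w $ 1" "X $ 2 = w $ 2" using t by auto
    then show "X = w" by (simp add: vec_eq_iff forall_2)
  qed simp
  then show ?thesis using e by (simp add: X_def)
qed

lemma C_mu_plus_half: "C_mu_plus \<mu> = C_mu \<mu> \<inter> H_infty (half 1)"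
  and C_mu_minus_half: "C_mu_minus \<mu> = C_mu \<mu> \<inter> H_infty (half (-1))"
  and CG_mu_plus_half: "CG_mu_plus k0 \<mu> = CG_mu_half k0 \<mu> (half 1)"
  and CG_mu_minus_half: "CG_mu_minus k0 \<mu> = CG_mu_half k0 \<mu> (half (-1))"
  by (simp_all add: C_mu_plus_def C_mu_minus_def CG_mu_plus_def CG_mu_minus_def half_one half_minus_one)

lemma units_on_inverse:
  assumes "f \<in> units_on D A"
  obtains h where "h \<in> A" "\<And>x. x \<in> D \<Longrightarrow> f x * h x = 1" "\<And>x. x \<in> D \<Longrightarrow> inverse (f x) = h x" "\<And>x. x \<in> D \<Longrightarrow> f x \<noteq> 0"
proof -
  obtain h where h: "h \<in> A" "\<forall>x\<in>D. f x * h x = 1" using assms by (auto simp: units_on_def)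
  show thesis
    using that[of h] h by (metis inverse_unique mult_zero_left zero_neq_one)
qed

lemma CG_Hinf_components:
  assumes k0: "1 < k0" and \<mu>: "0 < \<mu>" "\<mu> < 1" and \<sigma>: "\<bar>\<sigma>\<bar> = 1" and f: "f \<in> CG_Hinf k0 \<mu> \<sigma>"
  shows "even_part k0 f \<in> C_mu \<mu> \<inter> H_infty (half \<sigma>)"
    "(\<lambda>\<xi>. half_factor k0 \<sigma> \<xi> * odd_part k0 f \<xi>) \<in> C_mu \<mu> \<inter> H_infty (half \<sigma>)"
  using f CG_mu_parts[OF k0 \<mu> \<sigma>] unfolding CG_Hinf_def by blast+

text \<open>
  In a solution of the scalar equation all plus-factors can be collected on one side and all
  minus-factors on the other; the common value lies in both classes, hence is constant.
\<close>
lemma symbol_equation_solution: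
  assumes k0: "1 < k0" and \<mu>: "0 < \<mu>" "\<mu> < 1"
    and gm: "gm \<in> units_on (Gamma_fin k0) (CG_mu_minus k0 \<mu>)"
    and gp: "gp \<in> units_on (Gamma_fin k0) (CG_mu_plus k0 \<mu>)"
    and \<psi>: "\<psi> \<in> CG_Hinf k0 \<mu> 1" and h: "h \<in> CG_Hinf k0 \<mu> (-1)"
    and eq: "\<And>\<xi> \<tau>. (\<xi>, \<tau>) \<in> Gamma_fin k0 \<Longrightarrow>
      gm (\<xi>, \<tau>) * (\<tau> / ((\<xi> + \<i>) * (\<xi> - \<i> * of_real k0))) * gp (\<xi>, \<tau>) * \<psi> (\<xi>, \<tau>)
        = \<tau> / frakp1 k0 \<xi> * ((\<xi> + \<i>) / (\<xi> - \<i>) * h (\<xi>, \<tau>))"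
  obtains c where
    "\<And>\<xi> \<tau>. (\<xi>, \<tau>) \<in> Gamma_fin k0 \<Longrightarrow> \<psi> (\<xi>, \<tau>) = c * ((\<xi> + \<i>) / (\<xi> + \<i> * of_real k0) * inverse (gp (\<xi>, \<tau>)))"
    "\<And>\<xi> \<tau>. (\<xi>, \<tau>) \<in> Gamma_fin k0 \<Longrightarrow>
      (\<xi> + \<i>) / (\<xi> - \<i>) * h (\<xi>, \<tau>) = c * ((\<xi> + \<i>) / (\<xi> - \<i> * of_real k0) * gm (\<xi>, \<tau>))"
proof -
  obtain gm' where gm': "gm' \<in> CG_mu_minus k0 \<mu>" "\<And>P. P \<in> Gamma_fin k0 \<Longrightarrow> gm P * gm' P = 1"
    using units_on_inverse[OF gm] by metis
  have gp0: "\<And>P. P \<in> Gamma_fin k0 \<Longrightarrow> gp P \<noteq> 0" using units_on_inverse[OF gp] by metis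
  have k0': "k0 \<noteq> 0" using k0 by simp
  define L where "L = (\<lambda>P. (case P of (\<xi>, \<tau>) \<Rightarrow> (\<xi> + \<i> * of_real k0) / (\<xi> + \<i>)) * (gp P * \<psi> P))"
  define M where "M = (\<lambda>P. (case P of (\<xi>, \<tau>) \<Rightarrow> (\<xi> + - \<i> * of_real k0) / (\<xi> + - \<i>)) * (gm' P * h P))"
  have gpH: "gp \<in> CG_Hinf k0 \<mu> 1"
    using gp CG_mu_half_subset_Hinf[OF k0, of 1] by (auto simp: units_on_def CG_mu_plus_half)
  have gmH: "gm' \<in> CG_Hinf k0 \<mu> (-1)"
    using gm'(1) CG_mu_half_subset_Hinf[OF k0, of "-1"] by (simp add: CG_mu_minus_half)
  have L: "L \<in> CG_Hinf k0 \<mu> 1"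
    unfolding L_def by (intro CG_Hinf_mult CG_Hinf_moebius k0 \<mu> gpH \<psi>) auto
  have M: "M \<in> CG_Hinf k0 \<mu> (-1)"
    unfolding M_def by (intro CG_Hinf_mult CG_Hinf_moebius k0 \<mu> gmH h) auto
  have nz: "\<xi> + \<i> \<noteq> 0" "\<xi> - \<i> \<noteq> 0" "\<xi> + \<i> * of_real k0 \<noteq> 0" "\<xi> - \<i> * of_real k0 \<noteq> 0" "\<tau> \<noteq> 0"
    if "(\<xi>, \<tau>) \<in> Gamma_fin k0" for \<xi> \<tau>
  proof -
    have R: "\<xi> \<in> \<real>" using Gamma_fin_cases[OF that] by simp
    have "frakp k0 \<xi> \<noteq> 0" using frakp_real_nonzero[OF k0' R] .
    then show "\<xi> + \<i> \<noteq> 0" "\<xi> - \<i> \<noteq> 0" "\<xi> + \<i> * of_real k0 \<noteq> 0" "\<xi> - \<i> * of_real k0 \<noteq> 0"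
      unfolding frakp_factor by auto
    show "\<tau> \<noteq> 0" using Gamma_fin_cases[OF that] tau1_real_nonzero[OF k0' R] by auto
  qed
  have LM: "L (\<xi>, \<tau>) = M (\<xi>, \<tau>)" if G: "(\<xi>, \<tau>) \<in> Gamma_fin k0" for \<xi> \<tau>
  proof -
    define x where "x = gp (\<xi>, \<tau>) * \<psi> (\<xi>, \<tau>)"
    define y where "y = h (\<xi>, \<tau>)"
    have "gm (\<xi>, \<tau>) * x * (\<xi> + \<i> * of_real k0) * (\<xi> - \<i>) = (\<xi> + \<i>) * y * (\<xi> - \<i> * of_real k0)"
      using eq[OF G] nz[OF G] unfolding frakp1_def x_def y_def by (simp add: divide_simps mult_ac)
    then have "gm (\<xi>, \<tau>) * gm' (\<xi>, \<tau>) * (x * (\<xi> + \<i> * of_real k0) * (\<xi> - \<i>))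
        = gm' (\<xi>, \<tau>) * ((\<xi> + \<i>) * y * (\<xi> - \<i> * of_real k0))" by algebra
    then have "x * (\<xi> + \<i> * of_real k0) * (\<xi> - \<i>) = gm' (\<xi>, \<tau>) * ((\<xi> + \<i>) * y * (\<xi> - \<i> * of_real k0))"
      using gm'(2)[OF G] by simp
    then show ?thesis
      using nz[OF G] by (simp add: L_def M_def x_def y_def divide_simps mult_ac)
  qed
  have "M \<in> CG_Hinf k0 \<mu> (-1) \<longleftrightarrow> L \<in> CG_Hinf k0 \<mu> (-1)" by (rule CG_Hinf_cong) (simp add: LM)
  then obtain c where c: "\<And>\<xi> \<tau>. (\<xi>, \<tau>) \<in> Gamma_fin k0 \<Longrightarrow> L (\<xi>, \<tau>) = c"
    using Liouville_curve[OF k0 \<mu> L] M by metis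
  show thesis
  proof (rule that[of c])
    fix \<xi> \<tau> assume G: "(\<xi>, \<tau>) \<in> Gamma_fin k0"
    show "\<psi> (\<xi>, \<tau>) = c * ((\<xi> + \<i>) / (\<xi> + \<i> * of_real k0) * inverse (gp (\<xi>, \<tau>)))"
      using nz[OF G] gp0[OF G] unfolding c[OF G, symmetric] L_def by (simp add: divide_simps mult_ac)
    have "c = M (\<xi>, \<tau>)" using c[OF G] LM[OF G] by simp
    then have "c * gm (\<xi>, \<tau>) = (\<xi> - \<i> * of_real k0) / (\<xi> - \<i>) * ((gm (\<xi>, \<tau>) * gm' (\<xi>, \<tau>)) * h (\<xi>, \<tau>))"
      by (simp add: M_def)
    then have "c * gm (\<xi>, \<tau>) = (\<xi> - \<i> * of_real k0) / (\<xi> - \<i>) * h (\<xi>, \<tau>)"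
      using gm'(2)[OF G] by simp
    moreover have "c * ((\<xi> + \<i>) / (\<xi> - \<i> * of_real k0) * gm (\<xi>, \<tau>)) = (\<xi> + \<i>) / (\<xi> - \<i> * of_real k0) * (c * gm (\<xi>, \<tau>))"
      by simp
    ultimately show "(\<xi> + \<i>) / (\<xi> - \<i>) * h (\<xi>, \<tau>) = c * ((\<xi> + \<i>) / (\<xi> - \<i> * of_real k0) * gm (\<xi>, \<tau>))"
      using nz[OF G] by simp
  qed
qed

theorem theorem6p3:
  fixes k0 \<mu> :: real and m :: int
    and G :: "complex \<Rightarrow> complex^2^2"
    and \<gamma>m \<gamma>p :: "complex \<Rightarrow> complex"
    and gm gp :: "complex \<times> complex \<Rightarrow> complex"
  assumes "1 < k0" and "0 < \<mu>" and "\<mu> < 1"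
    and "G \<in> C_Q k0 \<mu>"
    and "\<gamma>m \<in> units_on \<real> (C_mu_minus \<mu>)" and "\<gamma>p \<in> units_on \<real> (C_mu_plus \<mu>)"
    and "\<forall>\<xi>\<in>\<real>. det (G \<xi>) = \<gamma>m \<xi> * ((\<xi> - \<i>) / (\<xi> + \<i>)) powi m * \<gamma>p \<xi>"
    and "m = 0"
    and "gm \<in> units_on (Gamma_fin k0) (CG_mu_minus k0 \<mu>)"
    and "gp \<in> units_on (Gamma_fin k0) (CG_mu_plus k0 \<mu>)"
    and "\<forall>(\<xi>, \<tau>)\<in>Gamma_fin k0. Sigma_symbol k0 G (\<xi>, \<tau>) =
           gm (\<xi>, \<tau>) * (\<tau> / ((\<xi> + \<i>) * (\<xi> - \<i> * of_real k0))) * gp (\<xi>, \<tau>)"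
  shows
    "{(\<psi>p, \<psi>m). \<psi>p \<in> CG_mu_plus k0 \<mu> \<and> \<psi>m \<in> CG_mu0_minus k0 \<mu> \<and>
        (\<forall>(\<xi>, \<tau>)\<in>Gamma_fin k0.
           Sigma_symbol k0 G (\<xi>, \<tau>) * \<psi>p (\<xi>, \<tau>) = \<tau> / frakp1 k0 \<xi> * \<psi>m (\<xi>, \<tau>))}
     = {(\<psi>p, \<psi>m). \<exists>c::complex. \<forall>(\<xi>, \<tau>)\<in>Gamma_fin k0.
          \<psi>p (\<xi>, \<tau>) = c * ((\<xi> + \<i>) / (\<xi> + \<i> * of_real k0) * inverse (gp (\<xi>, \<tau>))) \<and>
          \<psi>m (\<xi>, \<tau>) = c * ((\<xi> + \<i>) / (\<xi> - \<i> * of_real k0) * gm (\<xi>, \<tau>))}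
     \<and>
     {(\<phi>p :: complex \<Rightarrow> complex^2, \<phi>m :: complex \<Rightarrow> complex^2).
        (\<forall>i. (\<lambda>\<xi>. \<phi>p \<xi> $ i) \<in> C_mu_plus \<mu>) \<and> (\<forall>i. (\<lambda>\<xi>. \<phi>m \<xi> $ i) \<in> C_mu0_minus \<mu>) \<and>
        (\<forall>\<xi>\<in>\<real>. G \<xi> *v \<phi>p \<xi> = \<phi>m \<xi>)}
     = {(\<phi>p, \<phi>m). \<exists>c::complex. \<forall>\<xi>\<in>\<real>.
          \<phi>p \<xi> = c *s vector [(\<xi> + \<i>) / (\<xi> + \<i> * of_real k0) * even_part k0 (\<lambda>P. inverse (gp P)) \<xi>,
                            (\<xi> + \<i>)^2 * odd_part k0 (\<lambda>P. inverse (gp P)) \<xi>] \<and>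
          \<phi>m \<xi> = c *s vector [(\<xi>^2 + 1) * odd_part k0 gm \<xi>,
                            (\<xi> + \<i>) / (\<xi> - \<i> * of_real k0) * even_part k0 gm \<xi>]}"
proof -
  note k0 = \<open>1 < k0\<close> and \<mu> = \<open>0 < \<mu>\<close> \<open>\<mu> < 1\<close> and G = \<open>G \<in> C_Q k0 \<mu>\<close>
    and gm = \<open>gm \<in> units_on (Gamma_fin k0) (CG_mu_minus k0 \<mu>)\<close>
    and gp = \<open>gp \<in> units_on (Gamma_fin k0) (CG_mu_plus k0 \<mu>)\<close>
  have k0': "k0 \<noteq> 0" using k0 by simp
  have symbol: "Sigma_symbol k0 G (\<xi>, \<tau>) = gm (\<xi>, \<tau>) * (\<tau> / ((\<xi> + \<i>) * (\<xi> - \<i> * of_real k0))) * gp (\<xi>, \<tau>)"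
    if "(\<xi>, \<tau>) \<in> Gamma_fin k0" for \<xi> \<tau>
    using assms(11) that by blast
  obtain gp' where gp': "gp' \<in> CG_mu_plus k0 \<mu>" "\<And>P. P \<in> Gamma_fin k0 \<Longrightarrow> inverse (gp P) = gp' P"
    and gp0: "\<And>P. P \<in> Gamma_fin k0 \<Longrightarrow> gp P \<noteq> 0"
    using units_on_inverse[OF gp] by metis
  have nz: "\<xi> + \<i> \<noteq> 0" "\<xi> - \<i> \<noteq> 0" "\<xi> + \<i> * of_real k0 \<noteq> 0" "\<xi> - \<i> * of_real k0 \<noteq> 0" if "\<xi> \<in> \<real>" for \<xi>
    using frakp_real_nonzero[OF k0' that] unfolding frakp_factor by auto

  \<comment> \<open>The generators for the multiple \<open>c\<close>, the second one without the factor \<open>(\<xi> + \<i>) / (\<xi> - \<i>)\<close>.\<close>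
  define \<Psi> where "\<Psi> c = (\<lambda>(\<xi>, \<tau>). c * ((\<xi> + \<i>) / (\<xi> + \<i> * of_real k0)) * inverse (gp (\<xi>, \<tau>)))" for c
  define \<Theta> where "\<Theta> c = (\<lambda>(\<xi>, \<tau>). c * ((\<xi> - \<i>) / (\<xi> - \<i> * of_real k0)) * gm (\<xi>, \<tau>))" for c
  have \<Psi>: "\<Psi> c \<in> CG_mu_half k0 \<mu> (half 1)" for c
  proof -
    have "(\<lambda>(\<xi>, \<tau>). c * ((\<xi> + \<i>) / (\<xi> + \<i> * of_real k0)) * gp' (\<xi>, \<tau>)) \<in> CG_mu_half k0 \<mu> (half 1)"
      using gp'(1) k0 by (intro CG_mu_half_moebius_mult \<mu>) (auto simp: CG_mu_plus_half)
    also have "?this \<longleftrightarrow> \<Psi> c \<in> CG_mu_half k0 \<mu> (half 1)"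
      by (rule CG_mu_half_cong) (simp add: \<Psi>_def gp'(2))
    finally show ?thesis .
  qed
  have \<Theta>: "\<Theta> c \<in> CG_mu_half k0 \<mu> (half (-1))" for c
  proof -
    have "gm \<in> CG_mu_half k0 \<mu> (half (-1))" using gm by (simp add: units_on_def CG_mu_minus_half)
    then have "(\<lambda>(\<xi>, \<tau>). c * ((\<xi> + - \<i>) / (\<xi> + - \<i> * of_real k0)) * gm (\<xi>, \<tau>)) \<in> CG_mu_half k0 \<mu> (half (-1))"
      using k0 by (intro CG_mu_half_moebius_mult \<mu>) auto
    then show ?thesis by (simp add: \<Theta>_def)
  qed
  have \<Psi>H: "\<Psi> c \<in> CG_Hinf k0 \<mu> 1" and \<Theta>H: "\<Theta> c \<in> CG_Hinf k0 \<mu> (-1)" for c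
    using CG_mu_half_subset_Hinf[OF k0 _ \<Psi>] CG_mu_half_subset_Hinf[OF k0 _ \<Theta>] by simp_all
  have \<Theta>m: "(\<xi> + \<i>) / (\<xi> - \<i>) * \<Theta> c (\<xi>, \<tau>) = c * ((\<xi> + \<i>) / (\<xi> - \<i> * of_real k0) * gm (\<xi>, \<tau>))"
    if "\<xi> \<in> \<real>" for c \<xi> \<tau>
    using nz[OF that] by (simp add: \<Theta>_def)
  have generator: "Sigma_symbol k0 G (\<xi>, \<tau>) * \<Psi> c (\<xi>, \<tau>) = \<tau> / frakp1 k0 \<xi> * ((\<xi> + \<i>) / (\<xi> - \<i>) * \<Theta> c (\<xi>, \<tau>))"
    if P: "(\<xi>, \<tau>) \<in> Gamma_fin k0" for c \<xi> \<tau>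
    using nz[OF Gamma_fin_cases(1)[OF P]] gp0[OF P] unfolding symbol[OF P]
    by (simp add: \<Psi>_def \<Theta>_def frakp1_def divide_simps mult_ac)

  have scalar: "(\<psi>p \<in> CG_mu_plus k0 \<mu> \<and> \<psi>m \<in> CG_mu0_minus k0 \<mu> \<and>
        (\<forall>(\<xi>, \<tau>)\<in>Gamma_fin k0. Sigma_symbol k0 G (\<xi>, \<tau>) * \<psi>p (\<xi>, \<tau>) = \<tau> / frakp1 k0 \<xi> * \<psi>m (\<xi>, \<tau>)))
      \<longleftrightarrow> (\<exists>c. \<forall>(\<xi>, \<tau>)\<in>Gamma_fin k0.
          \<psi>p (\<xi>, \<tau>) = c * ((\<xi> + \<i>) / (\<xi> + \<i> * of_real k0) * inverse (gp (\<xi>, \<tau>))) \<and>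
          \<psi>m (\<xi>, \<tau>) = c * ((\<xi> + \<i>) / (\<xi> - \<i> * of_real k0) * gm (\<xi>, \<tau>)))" (is "?L \<longleftrightarrow> ?R") for \<psi>p \<psi>m
  proof
    assume ?L
    then have \<psi>p: "\<psi>p \<in> CG_Hinf k0 \<mu> 1"
      using CG_mu_half_subset_Hinf[OF k0, of 1] by (simp add: CG_mu_plus_half)
    obtain h where h: "h \<in> CG_mu_minus k0 \<mu>"
        "\<forall>(\<xi>, \<tau>)\<in>Gamma_fin k0. \<psi>m (\<xi>, \<tau>) = (\<xi> + \<i>) / (\<xi> - \<i>) * h (\<xi>, \<tau>)"
      using \<open>?L\<close> unfolding CG_mu0_minus_def by blast
    have hH: "h \<in> CG_Hinf k0 \<mu> (-1)"
      using h(1) CG_mu_half_subset_Hinf[OF k0, of "-1"] by (simp add: CG_mu_minus_half)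
    have \<psi>m: "\<psi>m (\<xi>, \<tau>) = (\<xi> + \<i>) / (\<xi> - \<i>) * h (\<xi>, \<tau>)" if "(\<xi>, \<tau>) \<in> Gamma_fin k0" for \<xi> \<tau>
      using h(2) that by blast
    have "gm (\<xi>, \<tau>) * (\<tau> / ((\<xi> + \<i>) * (\<xi> - \<i> * of_real k0))) * gp (\<xi>, \<tau>) * \<psi>p (\<xi>, \<tau>)
        = \<tau> / frakp1 k0 \<xi> * ((\<xi> + \<i>) / (\<xi> - \<i>) * h (\<xi>, \<tau>))" if P: "(\<xi>, \<tau>) \<in> Gamma_fin k0" for \<xi> \<tau>
      unfolding symbol[OF P, symmetric] \<psi>m[OF P, symmetric] using \<open>?L\<close> P by blast
    from symbol_equation_solution[OF k0 \<mu> gm gp \<psi>p hH this] obtain c where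
      "\<And>\<xi> \<tau>. (\<xi>, \<tau>) \<in> Gamma_fin k0 \<Longrightarrow> \<psi>p (\<xi>, \<tau>) = c * ((\<xi> + \<i>) / (\<xi> + \<i> * of_real k0) * inverse (gp (\<xi>, \<tau>)))"
      "\<And>\<xi> \<tau>. (\<xi>, \<tau>) \<in> Gamma_fin k0 \<Longrightarrow> (\<xi> + \<i>) / (\<xi> - \<i>) * h (\<xi>, \<tau>) = c * ((\<xi> + \<i>) / (\<xi> - \<i> * of_real k0) * gm (\<xi>, \<tau>))"
      by metis
    then show ?R using \<psi>m by (intro exI[of _ c]) auto
  next
    assume ?R
    then obtain c where c: "\<And>\<xi> \<tau>. (\<xi>, \<tau>) \<in> Gamma_fin k0 \<Longrightarrow> \<psi>p (\<xi>, \<tau>) = \<Psi> c (\<xi>, \<tau>)"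
      "\<And>\<xi> \<tau>. (\<xi>, \<tau>) \<in> Gamma_fin k0 \<Longrightarrow> \<psi>m (\<xi>, \<tau>) = (\<xi> + \<i>) / (\<xi> - \<i>) * \<Theta> c (\<xi>, \<tau>)"
      using \<Theta>m Gamma_fin_cases(1) by (force simp: \<Psi>_def)
    have "\<psi>p \<in> CG_mu_half k0 \<mu> (half 1) \<longleftrightarrow> \<Psi> c \<in> CG_mu_half k0 \<mu> (half 1)"
      by (rule CG_mu_half_cong) (rule c(1))
    moreover have "\<psi>m \<in> CG_mu0_minus k0 \<mu>"
      unfolding CG_mu0_minus_def CG_mu_minus_half using \<Theta>[of c] c(2) by blast
    ultimately show ?L using \<Psi>[of c] generator c by (auto simp: CG_mu_plus_half)
  qed

  \<comment> \<open>The even and odd parts of the scalar generators are the components of the vector generators.\<close>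
  have vgen: "even_part k0 (\<Psi> c) \<xi> = c * ((\<xi> + \<i>) / (\<xi> + \<i> * of_real k0) * even_part k0 (\<lambda>P. inverse (gp P)) \<xi>)"
    "frakp1 k0 \<xi> * odd_part k0 (\<Psi> c) \<xi> = c * ((\<xi> + \<i>)^2 * odd_part k0 (\<lambda>P. inverse (gp P)) \<xi>)"
    "(\<xi> + \<i>) / (\<xi> - \<i>) * (frakp2 k0 \<xi> * odd_part k0 (\<Theta> c) \<xi>) = c * ((\<xi>^2 + 1) * odd_part k0 gm \<xi>)"
    "(\<xi> + \<i>) / (\<xi> - \<i>) * even_part k0 (\<Theta> c) \<xi> = c * ((\<xi> + \<i>) / (\<xi> - \<i> * of_real k0) * even_part k0 gm \<xi>)"
    if \<xi>: "\<xi> \<in> \<real>" for c \<xi>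
  proof -
    have E: "even_part k0 (\<Psi> c) \<xi> = c * ((\<xi> + \<i>) / (\<xi> + \<i> * of_real k0)) * even_part k0 (\<lambda>P. inverse (gp P)) \<xi>"
      "odd_part k0 (\<Psi> c) \<xi> = c * ((\<xi> + \<i>) / (\<xi> + \<i> * of_real k0)) * odd_part k0 (\<lambda>P. inverse (gp P)) \<xi>"
      unfolding \<Psi>_def by (rule parts_coordinate_mult)+
    have O: "even_part k0 (\<Theta> c) \<xi> = c * ((\<xi> - \<i>) / (\<xi> - \<i> * of_real k0)) * even_part k0 gm \<xi>"
      "odd_part k0 (\<Theta> c) \<xi> = c * ((\<xi> - \<i>) / (\<xi> - \<i> * of_real k0)) * odd_part k0 gm \<xi>"
      unfolding \<Theta>_def by (rule parts_coordinate_mult)+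
    have s: "\<xi>^2 + 1 = (\<xi> + \<i>) * (\<xi> - \<i>)" by (simp add: algebra_simps power2_eq_square)
    show "even_part k0 (\<Psi> c) \<xi> = c * ((\<xi> + \<i>) / (\<xi> + \<i> * of_real k0) * even_part k0 (\<lambda>P. inverse (gp P)) \<xi>)"
      "frakp1 k0 \<xi> * odd_part k0 (\<Psi> c) \<xi> = c * ((\<xi> + \<i>)^2 * odd_part k0 (\<lambda>P. inverse (gp P)) \<xi>)"
      "(\<xi> + \<i>) / (\<xi> - \<i>) * (frakp2 k0 \<xi> * odd_part k0 (\<Theta> c) \<xi>) = c * ((\<xi>^2 + 1) * odd_part k0 gm \<xi>)"
      "(\<xi> + \<i>) / (\<xi> - \<i>) * even_part k0 (\<Theta> c) \<xi> = c * ((\<xi> + \<i>) / (\<xi> - \<i> * of_real k0) * even_part k0 gm \<xi>)"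
      using nz[OF \<xi>] unfolding E O s frakp1_def frakp2_def by (simp_all add: power2_eq_square)
  qed

  have vector: "((\<forall>i. (\<lambda>\<xi>. \<phi>p \<xi> $ i) \<in> C_mu_plus \<mu>) \<and> (\<forall>i. (\<lambda>\<xi>. \<phi>m \<xi> $ i) \<in> C_mu0_minus \<mu>) \<and>
        (\<forall>\<xi>\<in>\<real>. G \<xi> *v \<phi>p \<xi> = \<phi>m \<xi>))
      \<longleftrightarrow> (\<exists>c. \<forall>\<xi>\<in>\<real>.
          \<phi>p \<xi> = c *s vector [(\<xi> + \<i>) / (\<xi> + \<i> * of_real k0) * even_part k0 (\<lambda>P. inverse (gp P)) \<xi>,
                            (\<xi> + \<i>)^2 * odd_part k0 (\<lambda>P. inverse (gp P)) \<xi>] \<and>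
          \<phi>m \<xi> = c *s vector [(\<xi>^2 + 1) * odd_part k0 gm \<xi>,
                            (\<xi> + \<i>) / (\<xi> - \<i> * of_real k0) * even_part k0 gm \<xi>])" (is "?L \<longleftrightarrow> ?R")
    for \<phi>p \<phi>m :: "complex \<Rightarrow> complex^2"
  proof -
    have R: "?R \<longleftrightarrow> (\<exists>c. \<forall>\<xi>\<in>\<real>.
        \<phi>p \<xi> $ 1 = even_part k0 (\<Psi> c) \<xi> \<and> \<phi>p \<xi> $ 2 = frakp1 k0 \<xi> * odd_part k0 (\<Psi> c) \<xi> \<and>
        \<phi>m \<xi> $ 1 = (\<xi> + \<i>) / (\<xi> - \<i>) * (frakp2 k0 \<xi> * odd_part k0 (\<Theta> c) \<xi>) \<and>
        \<phi>m \<xi> $ 2 = (\<xi> + \<i>) / (\<xi> - \<i>) * even_part k0 (\<Theta> c) \<xi>)"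
      by (intro ex_cong1 ball_cong refl, simp only: vgen) (simp add: vec_eq_iff forall_2 conj_assoc)
    show ?thesis unfolding R
    proof
      assume L: ?L
      then have a: "(\<lambda>\<xi>. \<phi>p \<xi> $ 1) \<in> C_mu \<mu> \<inter> H_infty (half 1)" "(\<lambda>\<xi>. \<phi>p \<xi> $ 2) \<in> C_mu \<mu> \<inter> H_infty (half 1)"
        unfolding C_mu_plus_half by blast+
      obtain h1 where h1: "h1 \<in> C_mu \<mu> \<inter> H_infty (half (-1))" "\<And>\<xi>. \<xi> \<in> \<real> \<Longrightarrow> \<phi>m \<xi> $ 1 = (\<xi> + \<i>) / (\<xi> - \<i>) * h1 \<xi>"
        using L unfolding C_mu0_minus_def C_mu_minus_half by blast
      obtain h2 where h2: "h2 \<in> C_mu \<mu> \<inter> H_infty (half (-1))" "\<And>\<xi>. \<xi> \<in> \<real> \<Longrightarrow> \<phi>m \<xi> $ 2 = (\<xi> + \<i>) / (\<xi> - \<i>) * h2 \<xi>"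
        using L unfolding C_mu0_minus_def C_mu_minus_half by blast
      \<comment> \<open>The functions on the curve with the components of the vector solution as parts.\<close>
      define \<psi> where "\<psi> = (\<lambda>(\<xi>, \<tau>). \<phi>p \<xi> $ 1 + \<tau> / half_factor k0 1 \<xi> * \<phi>p \<xi> $ 2)"
      define h where "h = (\<lambda>(\<xi>, \<tau>). h2 \<xi> + \<tau> / half_factor k0 (-1) \<xi> * h1 \<xi>)"
      have \<psi>: "\<psi> \<in> CG_Hinf k0 \<mu> 1" unfolding \<psi>_def by (rule CG_Hinf_of_sum[OF k0 \<mu> _ a]) simp
      have h: "h \<in> CG_Hinf k0 \<mu> (-1)" unfolding h_def by (rule CG_Hinf_of_sum[OF k0 \<mu> _ h2(1) h1(1)]) simp
      have eq: "gm (\<xi>, \<tau>) * (\<tau> / ((\<xi> + \<i>) * (\<xi> - \<i> * of_real k0))) * gp (\<xi>, \<tau>) * \<psi> (\<xi>, \<tau>)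
          = \<tau> / frakp1 k0 \<xi> * ((\<xi> + \<i>) / (\<xi> - \<i>) * h (\<xi>, \<tau>))" if P: "(\<xi>, \<tau>) \<in> Gamma_fin k0" for \<xi> \<tau>
      proof -
        have \<xi>: "\<xi> \<in> \<real>" "\<tau>^2 = frakp k0 \<xi>" using Gamma_fin_cases[OF P] by auto
        have "G \<xi> *v \<phi>p \<xi> = \<phi>m \<xi>" using L \<xi> by blast
        then have "Sigma_symbol k0 G (\<xi>, \<tau>) * (\<phi>p \<xi> $ 1 + \<tau> / frakp1 k0 \<xi> * \<phi>p \<xi> $ 2)
            = \<tau> / frakp1 k0 \<xi> * (\<phi>m \<xi> $ 2 + \<tau> / frakp2 k0 \<xi> * \<phi>m \<xi> $ 1)"
          using \<xi> unfolding vector_equation_iff_symbol[OF G k0' \<xi>(1)] by blast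
        moreover have "\<phi>m \<xi> $ 2 + \<tau> / frakp2 k0 \<xi> * \<phi>m \<xi> $ 1 = (\<xi> + \<i>) / (\<xi> - \<i>) * h (\<xi>, \<tau>)"
          unfolding h_def half_factor_minus_1 split_conv h1(2)[OF \<xi>(1)] h2(2)[OF \<xi>(1)]
          by (simp only: distrib_left mult.left_commute)
        ultimately show ?thesis unfolding symbol[OF P, symmetric] by (simp add: \<psi>_def half_factor_1)
      qed
      from symbol_equation_solution[OF k0 \<mu> gm gp \<psi> h eq] obtain c where
        c: "\<And>\<xi> \<tau>. (\<xi>, \<tau>) \<in> Gamma_fin k0 \<Longrightarrow> \<psi> (\<xi>, \<tau>) = c * ((\<xi> + \<i>) / (\<xi> + \<i> * of_real k0) * inverse (gp (\<xi>, \<tau>)))"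
        "\<And>\<xi> \<tau>. (\<xi>, \<tau>) \<in> Gamma_fin k0 \<Longrightarrow> (\<xi> + \<i>) / (\<xi> - \<i>) * h (\<xi>, \<tau>) = c * ((\<xi> + \<i>) / (\<xi> - \<i> * of_real k0) * gm (\<xi>, \<tau>))"
        by metis
      have \<psi>c: "\<psi> (\<xi>, \<tau>) = \<Psi> c (\<xi>, \<tau>)" if "(\<xi>, \<tau>) \<in> Gamma_fin k0" for \<xi> \<tau>
        using c(1)[OF that] by (simp add: \<Psi>_def)
      have hc: "h (\<xi>, \<tau>) = \<Theta> c (\<xi>, \<tau>)" if P: "(\<xi>, \<tau>) \<in> Gamma_fin k0" for \<xi> \<tau>
      proof -
        have \<xi>: "\<xi> \<in> \<real>" using Gamma_fin_cases[OF P] by simp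
        have "(\<xi> + \<i>) / (\<xi> - \<i>) * h (\<xi>, \<tau>) = (\<xi> + \<i>) / (\<xi> - \<i>) * \<Theta> c (\<xi>, \<tau>)"
          using c(2)[OF P] \<Theta>m[OF \<xi>] by simp
        then show ?thesis using nz[OF \<xi>] by simp
      qed
      show "\<exists>c. \<forall>\<xi>\<in>\<real>.
        \<phi>p \<xi> $ 1 = even_part k0 (\<Psi> c) \<xi> \<and> \<phi>p \<xi> $ 2 = frakp1 k0 \<xi> * odd_part k0 (\<Psi> c) \<xi> \<and>
        \<phi>m \<xi> $ 1 = (\<xi> + \<i>) / (\<xi> - \<i>) * (frakp2 k0 \<xi> * odd_part k0 (\<Theta> c) \<xi>) \<and>
        \<phi>m \<xi> $ 2 = (\<xi> + \<i>) / (\<xi> - \<i>) * even_part k0 (\<Theta> c) \<xi>"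
      proof (intro exI[of _ c] ballI)
        fix \<xi> :: complex assume \<xi>: "\<xi> \<in> \<real>"
        have p: "frakp1 k0 \<xi> \<noteq> 0" "frakp2 k0 \<xi> \<noteq> 0"
          using frakp_real_nonzero[OF k0' \<xi>] by (auto simp: frakp1_frakp2)
        have "even_part k0 (\<Psi> c) \<xi> = even_part k0 \<psi> \<xi>" "odd_part k0 (\<Psi> c) \<xi> = odd_part k0 \<psi> \<xi>"
          by (rule parts_cong[OF _ \<xi>]; simp add: \<psi>c)+
        moreover have "even_part k0 (\<Theta> c) \<xi> = even_part k0 h \<xi>" "odd_part k0 (\<Theta> c) \<xi> = odd_part k0 h \<xi>"
          by (rule parts_cong[OF _ \<xi>]; simp add: hc)+
        moreover have "even_part k0 \<psi> \<xi> = \<phi>p \<xi> $ 1" "odd_part k0 \<psi> \<xi> = \<phi>p \<xi> $ 2 / half_factor k0 1 \<xi>"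
          "even_part k0 h \<xi> = h2 \<xi>" "odd_part k0 h \<xi> = h1 \<xi> / half_factor k0 (-1) \<xi>"
          unfolding \<psi>_def h_def by (rule parts_of_sum[OF k0' \<xi>])+
        ultimately show "\<phi>p \<xi> $ 1 = even_part k0 (\<Psi> c) \<xi> \<and> \<phi>p \<xi> $ 2 = frakp1 k0 \<xi> * odd_part k0 (\<Psi> c) \<xi> \<and>
          \<phi>m \<xi> $ 1 = (\<xi> + \<i>) / (\<xi> - \<i>) * (frakp2 k0 \<xi> * odd_part k0 (\<Theta> c) \<xi>) \<and>
          \<phi>m \<xi> $ 2 = (\<xi> + \<i>) / (\<xi> - \<i>) * even_part k0 (\<Theta> c) \<xi>"
          using p h1(2)[OF \<xi>] h2(2)[OF \<xi>] by (simp add: half_factor_1 half_factor_minus_1)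
      qed
    next
      assume "\<exists>c. \<forall>\<xi>\<in>\<real>.
        \<phi>p \<xi> $ 1 = even_part k0 (\<Psi> c) \<xi> \<and> \<phi>p \<xi> $ 2 = frakp1 k0 \<xi> * odd_part k0 (\<Psi> c) \<xi> \<and>
        \<phi>m \<xi> $ 1 = (\<xi> + \<i>) / (\<xi> - \<i>) * (frakp2 k0 \<xi> * odd_part k0 (\<Theta> c) \<xi>) \<and>
        \<phi>m \<xi> $ 2 = (\<xi> + \<i>) / (\<xi> - \<i>) * even_part k0 (\<Theta> c) \<xi>"
      then obtain c where c:
        "\<And>\<xi>. \<xi> \<in> \<real> \<Longrightarrow> \<phi>p \<xi> $ 1 = even_part k0 (\<Psi> c) \<xi>"
        "\<And>\<xi>. \<xi> \<in> \<real> \<Longrightarrow> \<phi>p \<xi> $ 2 = half_factor k0 1 \<xi> * odd_part k0 (\<Psi> c) \<xi>"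
        "\<And>\<xi>. \<xi> \<in> \<real> \<Longrightarrow> \<phi>m \<xi> $ 1 = (\<xi> + \<i>) / (\<xi> - \<i>) * (half_factor k0 (-1) \<xi> * odd_part k0 (\<Theta> c) \<xi>)"
        "\<And>\<xi>. \<xi> \<in> \<real> \<Longrightarrow> \<phi>m \<xi> $ 2 = (\<xi> + \<i>) / (\<xi> - \<i>) * even_part k0 (\<Theta> c) \<xi>"
        unfolding half_factor_1 half_factor_minus_1 by blast
      have 1: "even_part k0 (\<Psi> c) \<in> C_mu \<mu> \<inter> H_infty (half 1)"
        "(\<lambda>\<xi>. half_factor k0 1 \<xi> * odd_part k0 (\<Psi> c) \<xi>) \<in> C_mu \<mu> \<inter> H_infty (half 1)"
        using CG_Hinf_components[OF k0 \<mu> _ \<Psi>H] by simp_all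
      have 2: "even_part k0 (\<Theta> c) \<in> C_mu_minus \<mu>"
        "(\<lambda>\<xi>. half_factor k0 (-1) \<xi> * odd_part k0 (\<Theta> c) \<xi>) \<in> C_mu_minus \<mu>"
        unfolding C_mu_minus_half using CG_Hinf_components[OF k0 \<mu> _ \<Theta>H] by simp_all
      have "(\<lambda>\<xi>. \<phi>p \<xi> $ 1) \<in> C_mu_plus \<mu>" "(\<lambda>\<xi>. \<phi>p \<xi> $ 2) \<in> C_mu_plus \<mu>"
        unfolding C_mu_plus_half
        by (rule C_mu_H_infty_transfer[OF 1(1)], erule c(1), rule C_mu_H_infty_transfer[OF 1(2)], erule c(2))
      then have "\<forall>i. (\<lambda>\<xi>. \<phi>p \<xi> $ i) \<in> C_mu_plus \<mu>" unfolding forall_2 by blast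
      moreover have "(\<lambda>\<xi>. \<phi>m \<xi> $ 1) \<in> C_mu0_minus \<mu>"
        unfolding C_mu0_minus_def mem_Collect_eq by (rule bexI[OF _ 2(2)], rule ballI, erule c(3))
      moreover have "(\<lambda>\<xi>. \<phi>m \<xi> $ 2) \<in> C_mu0_minus \<mu>"
        unfolding C_mu0_minus_def mem_Collect_eq by (rule bexI[OF _ 2(1)], rule ballI, erule c(4))
      moreover have "G \<xi> *v \<phi>p \<xi> = \<phi>m \<xi>" if \<xi>: "\<xi> \<in> \<real>" for \<xi>
        unfolding vector_equation_iff_symbol[OF G k0' \<xi>]
      proof (intro allI impI)
        fix \<tau> assume "\<tau>^2 = frakp k0 \<xi>"
        then have P: "(\<xi>, \<tau>) \<in> Gamma_fin k0" using \<xi> by (simp add: Gamma_fin_def)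
        have p: "frakp1 k0 \<xi> \<noteq> 0" "frakp2 k0 \<xi> \<noteq> 0"
          using frakp_real_nonzero[OF k0' \<xi>] by (auto simp: frakp1_frakp2)
        have "\<phi>p \<xi> $ 1 + \<tau> / frakp1 k0 \<xi> * \<phi>p \<xi> $ 2 = \<Psi> c (\<xi>, \<tau>)"
          unfolding even_odd_decomposition[OF k0' P, of "\<Psi> c"] using c(1,2)[OF \<xi>] p by (simp add: half_factor_1)
        moreover have "\<phi>m \<xi> $ 2 + \<tau> / frakp2 k0 \<xi> * \<phi>m \<xi> $ 1 = (\<xi> + \<i>) / (\<xi> - \<i>) * \<Theta> c (\<xi>, \<tau>)"
        proof -
          have "\<tau> / frakp2 k0 \<xi> * (r * (frakp2 k0 \<xi> * x)) = r * (\<tau> * x)" for r x using p by simp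
          then show ?thesis
            unfolding even_odd_decomposition[OF k0' P, of "\<Theta> c"] c(3,4)[OF \<xi>] half_factor_minus_1
            by (simp only: distrib_left)
        qed
        ultimately show "Sigma_symbol k0 G (\<xi>, \<tau>) * (\<phi>p \<xi> $ 1 + \<tau> / frakp1 k0 \<xi> * \<phi>p \<xi> $ 2)
            = \<tau> / frakp1 k0 \<xi> * (\<phi>m \<xi> $ 2 + \<tau> / frakp2 k0 \<xi> * \<phi>m \<xi> $ 1)"
          using generator[OF P, of c] by simp
      qed
      ultimately show ?L unfolding forall_2 by blast
    qed
  qed
  show ?thesis unfolding scalar vector by (intro conjI refl)
qed

end
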